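(* For every $\lambda\in(0,1]$, $$\int_0^\infty e^{-\lambda t}\,\overline p_t(0,0)\,\mathrm dt\le 2048,$$ and hence $\int_0^\infty\overline p_t(0,0)\,\mathrm dt<\infty$.
   Context: Let $e_1,e_2$ be the standard basis of $\mathbb Z^2$. The environment is a function $\omega\colon\mathbb Z^2\times\{1,2\}\to\{-1,1\}$ such that $\omega(z,i)$ is constant along each line parallel to $e_i$ (i.e. $\omega(z+e_i,i)=\omega(z,i)$ for all $z$); $\omega(z,i)$ is the orientation of the line through $z$ parallel to $e_i$. Under the law $\mathbb P$ (expectation $\mathbb E$) the orientations of all horizontal lines ($i=1$) and all vertical lines ($i=2$) are independent and uniform on $\{-1,1\}$. For fixed $\omega$, the continuous-time walk on $\mathbb Z^2$ is the Markov process which from $z$ jumps to $z+\omega(z,1)e_1$ at rate $1$ and to $z+\omega(z,2)e_2$ at rate $1$. $p^\omega_t(z,z')$ ($t\ge0$) denotes its transition probabilities, and $\overline p_t(0,0)=\mathbb E\,p^\omega_t(0,0)$. *)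

theory Defs
  imports "HOL-Probability.Probability"
begin

text \<open>The lattice is \<open>int^2\<close>, with index type \<open>2 = {1, 2}\<close> and standard basis \<open>axis i 1\<close>.\<close>

type_synonym site = "int^2"
type_synonym env = "site \<times> 2 \<Rightarrow> int"

definition environments :: "env set" where
  "environments = {\<omega>. (\<forall>z i. \<omega> (z, i) \<in> {-1, 1}) \<and> (\<forall>z i. \<omega> (z + axis i 1, i) = \<omega> (z, i))}"

definition env_space :: "env measure" where
  "env_space = restrict_space (\<Pi>\<^sub>M _\<in>UNIV. count_space {-1, 1}) environments"

text \<open>Arithmetic in the type \<open>2\<close> is modulo 2, so \<open>i + 1\<close> is the index other than \<open>i\<close>. Hence the
  lines parallel to \<open>axis i 1\<close> correspond to the values of the coordinate \<open>z $ (i + 1)\<close>,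
  and the set of all lines is indexed by \<open>2 \<times> int\<close>.\<close>

definition env_of_lines :: "(2 \<times> int \<Rightarrow> int) \<Rightarrow> env" where
  "env_of_lines \<sigma> = (\<lambda>(z, i). \<sigma> (i, z $ (i + 1)))"

definition env_law :: "env measure" where
  "env_law = distr (\<Pi>\<^sub>M _\<in>UNIV. uniform_count_measure {-1, 1}) env_space env_of_lines"

text \<open>\<open>P t x y\<close> (\<open>t \<ge> 0\<close>) are the transition probabilities of a continuous-time Markov process that
  jumps from \<open>x\<close> to \<open>y \<noteq> x\<close> at rate \<open>q x y\<close>: a semigroup of stochastic matrices whose
  right derivative at time 0 is the conservative generator with off-diagonal entries \<open>q\<close>.
  Values of \<open>P\<close> at negative times are irrelevant. When the rates are bounded,
  as they are for the walk below, \<open>P\<close> is uniquely determined for \<open>t \<ge> 0\<close>.\<close>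

definition markov_transition_probs ::
    "('s \<Rightarrow> 's \<Rightarrow> real) \<Rightarrow> (real \<Rightarrow> 's \<Rightarrow> 's \<Rightarrow> real) \<Rightarrow> bool" where
  "markov_transition_probs q P \<longleftrightarrow>
     (\<forall>t\<ge>0. \<forall>x y. P t x y \<ge> 0) \<and>
     (\<forall>t\<ge>0. \<forall>x. (P t x has_sum 1) UNIV) \<and>
     (\<forall>x y. P 0 x y = (if x = y then 1 else 0)) \<and>
     (\<forall>s\<ge>0. \<forall>t\<ge>0. \<forall>x z. ((\<lambda>y. P s x y * P t y z) has_sum P (s + t) x z) UNIV) \<and>
     (\<forall>x y. x \<noteq> y \<longrightarrow> ((\<lambda>t. P t x y) has_real_derivative q x y) (at 0 within {0..})) \<and>
     (\<forall>x. ((\<lambda>t. P t x x) has_real_derivative - (\<Sum>\<^sub>\<infinity>y\<in>UNIV - {x}. q x y)) (at 0 within {0..}))"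

definition jump_rate :: "env \<Rightarrow> site \<Rightarrow> site \<Rightarrow> real" where
  "jump_rate \<omega> z z' = (\<Sum>i\<in>UNIV. if z' = z + \<omega> (z, i) *s axis i 1 then 1 else 0)"

definition annealed_return_prob ::
    "(env \<Rightarrow> real \<Rightarrow> site \<Rightarrow> site \<Rightarrow> real) \<Rightarrow> real \<Rightarrow> real" where
  "annealed_return_prob p t = (\<integral>\<omega>. p \<omega> t 0 0 \<partial>env_law)"

lemma env_of_lines_measurable:
  "env_of_lines \<in> (\<Pi>\<^sub>M _\<in>UNIV. uniform_count_measure {-1, 1}) \<rightarrow>\<^sub>M env_space"
proof -
  let ?L = "\<Pi>\<^sub>M _\<in>(UNIV :: (2 \<times> int) set). uniform_count_measure {-1, 1 :: int}"
  have ne: "i + 1 \<noteq> i" for i :: 2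
    by simp
  have ax: "(z + axis i 1) $ (i + 1) = z $ (i + 1)" for z :: site and i :: 2
    using ne[of i] by (simp add: axis_def)
  have sets: "sets (uniform_count_measure {-1, 1 :: int}) = sets (count_space {-1, 1})"
    by (simp add: sets_uniform_count_measure_count_space)
  have "env_of_lines \<in> ?L \<rightarrow>\<^sub>M (\<Pi>\<^sub>M _\<in>UNIV. count_space {-1, 1})"
  proof (rule measurable_PiM_single')
    fix a :: "site \<times> 2"
    have "(\<lambda>\<sigma>. \<sigma> (snd a, fst a $ (snd a + 1))) \<in> ?L \<rightarrow>\<^sub>M uniform_count_measure {-1, 1}"
      by (rule measurable_component_singleton) simp
    then show "(\<lambda>\<sigma>. env_of_lines \<sigma> a) \<in> ?L \<rightarrow>\<^sub>M count_space {-1, 1}"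
      unfolding env_of_lines_def measurable_cong_sets[OF refl sets] by (simp add: case_prod_beta)
  qed (auto simp: env_of_lines_def space_PiM space_uniform_count_measure PiE_iff)
  moreover have "env_of_lines \<in> space ?L \<rightarrow> environments"
    using ax by (auto simp: env_of_lines_def environments_def space_PiM space_uniform_count_measure PiE_iff)
  ultimately show ?thesis
    unfolding env_space_def by (intro measurable_restrict_space2) auto
qed

lemma prob_space_env_law: "prob_space env_law"
  unfolding env_law_def
  by (intro prob_space.prob_space_distr env_of_lines_measurable prob_space_PiM
      prob_space_uniform_count_measure) auto

lemma space_env_law: "space env_law = environments"
  by (auto simp: env_law_def env_space_def environments_def space_restrict_space space_PiM PiE_iff)

end

theory Submission
  imports Defs
begin

text \<open>Uniformization turns the Laplace transform into \<open>\<Sum>n. E(number of n-step loops at 0) / (2 + l)^(n+1)\<close>,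
  and the first \<open>n\<close> steps only see finitely many lines, so the orientations may be taken periodic with a large
  odd period \<open>Q\<close>. Seen from the walker, the environment is then a pair \<open>(\<xi>, \<zeta>)\<close> of periodic signs (rows and columns),
  a horizontal step translates \<open>\<zeta>\<close> by \<open>\<xi> 0\<close> and a vertical step translates \<open>\<xi>\<close> by \<open>\<zeta> 0\<close>. The Fourier
  transform in the displacement attaches phases \<open>z1, z2\<close> to the two kinds of steps, and one has to bound the mean \<open>G\<close> of the
  solution \<open>u\<close> of \<open>(2 + l) u - T1 u - T2 u = 1\<close> by a quantity summable over the modes.

  Pair \<open>u\<close> with the flow \<open>F = c (1 + \<partial>2 \<Psi>, - \<partial>1 \<Psi>)\<close>, \<open>c = 1 / (1 - cnj z1)\<close>. It has divergence 1 for every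
  potential \<open>\<Psi>\<close>. The part of \<open>F / c\<close> of the form \<open>(\<xi> 0 g, \<zeta> 0 g)\<close> is absorbed by the drift in
  the equation, so only the residual \<open>F / c - (\<xi> 0 g, \<zeta> 0 g)\<close> and small error terms are paid for, by the
  Dirichlet form of \<open>u\<close>, which is controlled by \<open>G\<close> itself. Hence \<open>G\<close> is at most of order \<open>\<bar>1 - z1\<bar>^-2\<close>
  times the squared norm of the residual.

  With \<open>\<Psi> = g = 0\<close> this gives \<open>\<bar>1 - z1\<bar>^-2\<close>, whose sum over the modes diverges logarithmically. Better test
  functions are low degree polynomials in the signs. Take for \<open>g\<close> the sum of the row signs near the walker with a slowly
  decaying logarithmic weight. Then \<open>\<xi> 0 g\<close> cancels the 1 up to pair products, which \<open>\<partial>2\<close> removes at little cost, and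
  \<open>\<zeta> 0 g\<close> is the divergence source of a flow in the plane of the pairs (column, row). Routing this flow logarithmically costs
  \<open>1 / log\<close>. Stretching it by a factor \<open>K\<close> in the column direction makes one component cheap (\<open>1 / (K log)\<close>) and
  the other one dear (\<open>K / log\<close>), but the dear one is a vertical flow along columns, and the same cancellation, now with
  the column signs, gains a second logarithm for it. With \<open>log\<close> of order \<open>K^2\<close> both are of order \<open>K^-3\<close>. This applies to
  modes of size at most \<open>2^(-20 K^2)\<close>. There are of order \<open>K\<close> dyadic scales for each \<open>K\<close>, so the total is of order
  \<open>\<Sum> K * K^-3\<close>, which converges.\<close>

section \<open>The resolvent bound by duality\<close>

text \<open>The test functions \<open>\<Psi>\<close> and \<open>g\<close> are real and do not depend
  on the mode. The phases enter the duality bound only through \<open>cmod (1 - z1)\<close> and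
  \<open>cmod (1 - z2)\<close>, multiplied by norms of \<open>\<Psi>\<close> and \<open>g\<close>.
  These norms may therefore be as large as a fixed power of \<open>r = 2 ^ (K ^ 2)\<close>, and this
  fixes the admissible modes as those of size at most of order \<open>r ^ (-20)\<close>. All other
  scales are powers of \<open>r\<close> as well. The obstacle is that one logarithm is not enough: a
  gain of order \<open>K ^ (-2)\<close> on about \<open>K\<close> dyadic scales would leave a
  harmonic series in \<open>K\<close>. Stretching alone does not help either, since the two
  components \<open>1 / (K * H)\<close> and \<open>K / H\<close> of the energy have a product of
  order \<open>H ^ (-2)\<close>. Only the second logarithm \<open>L\<close>, which turns
  \<open>K / H\<close> into \<open>K / (L * H)\<close>, allows both to be smaller than
  \<open>1 / H\<close>. All bounds have to be uniform in \<open>l\<close>. Modes with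
  \<open>cmod (1 - z1) ^ 2 < l\<close>, and the zero mode, are bounded by \<open>1 / l\<close>
  instead; their number is of order \<open>l * Q ^ 2\<close>, so after division by
  \<open>Q ^ 2\<close> they contribute a constant.\<close>

locale signed_shift =
  fixes \<Omega> :: "'a set" and \<sigma> \<sigma>' :: "'a \<Rightarrow> 'a" and s :: "'a \<Rightarrow> real" and z :: complex
  assumes finite_space: "finite \<Omega>"
    and shift_in: "\<omega> \<in> \<Omega> \<Longrightarrow> \<sigma> \<omega> \<in> \<Omega>" "\<omega> \<in> \<Omega> \<Longrightarrow> \<sigma>' \<omega> \<in> \<Omega>"
    and shift_inverse: "\<omega> \<in> \<Omega> \<Longrightarrow> \<sigma> (\<sigma>' \<omega>) = \<omega>" "\<omega> \<in> \<Omega> \<Longrightarrow> \<sigma>' (\<sigma> \<omega>) = \<omega>"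
    and sign: "\<omega> \<in> \<Omega> \<Longrightarrow> s \<omega> = 1 \<or> s \<omega> = -1"
    and sign_shift: "\<omega> \<in> \<Omega> \<Longrightarrow> s (\<sigma> \<omega>) = s \<omega>"
    and norm_phase: "cmod z = 1"
begin

definition T :: "('a \<Rightarrow> complex) \<Rightarrow> 'a \<Rightarrow> complex" where
  "T f \<omega> = (if s \<omega> = 1 then z * f (\<sigma> \<omega>) else cnj z * f (\<sigma>' \<omega>))"

definition D :: "('a \<Rightarrow> complex) \<Rightarrow> 'a \<Rightarrow> complex" where
  "D f \<omega> = f \<omega> - z * f (\<sigma> \<omega>)"

lemma sum_shift: "(\<Sum>\<omega>\<in>\<Omega>. F (\<sigma> \<omega>)) = (\<Sum>\<omega>\<in>\<Omega>. F \<omega>)"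
  by (rule sum.reindex_bij_witness[of _ \<sigma>' \<sigma>]) (auto simp: shift_in shift_inverse)

lemma sum_shift': "(\<Sum>\<omega>\<in>\<Omega>. F (\<sigma>' \<omega>)) = (\<Sum>\<omega>\<in>\<Omega>. F \<omega>)"
  by (rule sum.reindex_bij_witness[of _ \<sigma> \<sigma>']) (auto simp: shift_in shift_inverse)

lemma sign_shift': "\<omega> \<in> \<Omega> \<Longrightarrow> s (\<sigma>' \<omega>) = s \<omega>"
  using sign_shift[of "\<sigma>' \<omega>"] by (simp add: shift_in shift_inverse)

lemma phase_cnj: "z * cnj z = 1" "cnj z * z = 1"
  using norm_phase by (simp_all add: complex_norm_square[symmetric] mult.commute)

lemma sum_negative_shift':
  "(\<Sum>\<omega>\<in>\<Omega>. if s \<omega> = 1 then 0 else F (\<sigma>' \<omega>)) = (\<Sum>\<omega>\<in>\<Omega>. if s \<omega> = 1 then 0 else F \<omega>)"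
proof -
  have "(\<Sum>\<omega>\<in>\<Omega>. if s \<omega> = 1 then 0 else F (\<sigma>' \<omega>)) = (\<Sum>\<omega>\<in>\<Omega>. (\<lambda>\<omega>. if s \<omega> = 1 then 0 else F \<omega>) (\<sigma>' \<omega>))"
    by (rule sum.cong) (auto simp: sign_shift')
  then show ?thesis using sum_shift'[of "\<lambda>\<omega>. if s \<omega> = 1 then 0 else F \<omega>"] by simp
qed

lemma diff_shift'_eq: "\<omega> \<in> \<Omega> \<Longrightarrow> f \<omega> - cnj z * f (\<sigma>' \<omega>) = - cnj z * D f (\<sigma>' \<omega>)"
  by (simp add: D_def shift_inverse algebra_simps phase_cnj mult.assoc[symmetric])

text \<open>The sign is constant along each orbit of \<open>\<sigma>\<close>, so there
  \<open>T\<close> is a translation in one fixed direction times a phase of modulus 1, hence an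
  isometry.\<close>

lemma norm_T_sum: "(\<Sum>\<omega>\<in>\<Omega>. (cmod (T f \<omega>))\<^sup>2) = (\<Sum>\<omega>\<in>\<Omega>. (cmod (f \<omega>))\<^sup>2)"
proof -
  let ?F = "\<lambda>\<omega>. (cmod (f \<omega>))\<^sup>2"
  have "(\<Sum>\<omega>\<in>\<Omega>. (cmod (T f \<omega>))\<^sup>2)
      = (\<Sum>\<omega>\<in>\<Omega>. (\<lambda>\<omega>. if s \<omega> = 1 then ?F \<omega> else 0) (\<sigma> \<omega>)) + (\<Sum>\<omega>\<in>\<Omega>. if s \<omega> = 1 then 0 else ?F (\<sigma>' \<omega>))"
    unfolding sum.distrib[symmetric]
    by (rule sum.cong) (auto simp: T_def norm_mult norm_phase sign_shift)
  also have "\<dots> = (\<Sum>\<omega>\<in>\<Omega>. ?F \<omega>)"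
    unfolding sum_shift[of "\<lambda>\<omega>. if s \<omega> = 1 then ?F \<omega> else 0"] sum_negative_shift'[of ?F] sum.distrib[symmetric]
    by (rule sum.cong) auto
  finally show ?thesis .
qed

text \<open>On negative points \<open>f - T f\<close> is a backward difference, which up to a unit
  factor is \<open>D f\<close> at the preceding point. The orientation thus drops out of the
  norm.\<close>

lemma norm_diff_T_sum: "(\<Sum>\<omega>\<in>\<Omega>. (cmod (f \<omega> - T f \<omega>))\<^sup>2) = (\<Sum>\<omega>\<in>\<Omega>. (cmod (D f \<omega>))\<^sup>2)"
proof -
  let ?F = "\<lambda>\<omega>. (cmod (D f \<omega>))\<^sup>2"
  have "(\<Sum>\<omega>\<in>\<Omega>. (cmod (f \<omega> - T f \<omega>))\<^sup>2)
      = (\<Sum>\<omega>\<in>\<Omega>. if s \<omega> = 1 then ?F \<omega> else 0) + (\<Sum>\<omega>\<in>\<Omega>. if s \<omega> = 1 then 0 else ?F (\<sigma>' \<omega>))"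
    unfolding sum.distrib[symmetric]
  proof (rule sum.cong)
    fix \<omega> assume w: "\<omega> \<in> \<Omega>"
    show "(cmod (f \<omega> - T f \<omega>))\<^sup>2 = (if s \<omega> = 1 then ?F \<omega> else 0) + (if s \<omega> = 1 then 0 else ?F (\<sigma>' \<omega>))"
      using diff_shift'_eq[OF w, of f] by (simp add: T_def norm_mult norm_phase D_def)
  qed simp
  also have "\<dots> = (\<Sum>\<omega>\<in>\<Omega>. ?F \<omega>)"
    unfolding sum_negative_shift'[of ?F] sum.distrib[symmetric]
    by (rule sum.cong) auto
  finally show ?thesis .
qed

text \<open>For an isometry the real part of the pairing of \<open>f\<close> with
  \<open>f - T f\<close> is half the squared norm of \<open>f - T f\<close>. Although the walk is
  not reversible, its dissipation is therefore a symmetric Dirichlet form.\<close>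

lemma energy_identity:
  "Re (\<Sum>\<omega>\<in>\<Omega>. cnj (f \<omega>) * (f \<omega> - T f \<omega>)) = (\<Sum>\<omega>\<in>\<Omega>. (cmod (D f \<omega>))\<^sup>2) / 2"
proof -
  have pt: "2 * Re (cnj a * (a - b)) = (cmod a)\<^sup>2 - (cmod b)\<^sup>2 + (cmod (a - b))\<^sup>2" for a b :: complex
    by (simp add: cmod_power2) (simp add: power2_eq_square algebra_simps)
  have "2 * Re (\<Sum>\<omega>\<in>\<Omega>. cnj (f \<omega>) * (f \<omega> - T f \<omega>)) =
     (\<Sum>\<omega>\<in>\<Omega>. (cmod (f \<omega>))\<^sup>2 - (cmod (T f \<omega>))\<^sup>2 + (cmod (f \<omega> - T f \<omega>))\<^sup>2)"
    unfolding Re_sum sum_distrib_left pt ..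
  then show ?thesis
    by (simp add: sum.distrib sum_subtractf norm_T_sum norm_diff_T_sum)
qed

text \<open>The first factor on the left is the adjoint of \<open>D\<close> applied to
  \<open>F\<close>, that is, the discrete divergence of a flow.\<close>

lemma sum_by_parts:
  "(\<Sum>\<omega>\<in>\<Omega>. cnj (F \<omega> - cnj z * F (\<sigma>' \<omega>)) * f \<omega>) = (\<Sum>\<omega>\<in>\<Omega>. cnj (F \<omega>) * D f \<omega>)"
proof -
  have "(\<Sum>\<omega>\<in>\<Omega>. z * cnj (F (\<sigma>' \<omega>)) * f \<omega>) = (\<Sum>\<omega>\<in>\<Omega>. (\<lambda>\<omega>. z * cnj (F \<omega>) * f (\<sigma> \<omega>)) (\<sigma>' \<omega>))"
    by (rule sum.cong) (auto simp: shift_inverse)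
  also have "\<dots> = (\<Sum>\<omega>\<in>\<Omega>. z * cnj (F \<omega>) * f (\<sigma> \<omega>))" by (rule sum_shift')
  finally show ?thesis
    by (simp add: D_def algebra_simps sum_subtractf)
qed

text \<open>On positive points \<open>s * D f\<close> and \<open>f - T f\<close> coincide. On
  negative points they agree after a shift and a phase, which reindexing moves onto
  \<open>g\<close>, so the defect is only a twisted increment of \<open>g\<close>. Hence a flow of
  the form \<open>s * g\<close> can be traded for the generator of the walk.\<close>

lemma drift_by_parts:
  fixes g :: "'a \<Rightarrow> real"
  shows "cmod ((\<Sum>\<omega>\<in>\<Omega>. s \<omega> * g \<omega> * D f \<omega>) - (\<Sum>\<omega>\<in>\<Omega>. g \<omega> * (f \<omega> - T f \<omega>)))
    \<le> (L2_set (\<lambda>\<omega>. g (\<sigma> \<omega>) - g \<omega>) \<Omega> + cmod (1 - z) * L2_set g \<Omega>) * L2_set (\<lambda>\<omega>. cmod (D f \<omega>)) \<Omega>"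
proof -
  let ?e = "\<lambda>\<omega>. cnj z * g (\<sigma> \<omega>) - g \<omega>"
  have "(\<Sum>\<omega>\<in>\<Omega>. s \<omega> * g \<omega> * D f \<omega>) - (\<Sum>\<omega>\<in>\<Omega>. g \<omega> * (f \<omega> - T f \<omega>)) =
     (\<Sum>\<omega>\<in>\<Omega>. if s \<omega> = 1 then 0 else - g \<omega> * D f \<omega>) +
     (\<Sum>\<omega>\<in>\<Omega>. if s \<omega> = 1 then 0 else (\<lambda>\<omega>. cnj z * g (\<sigma> \<omega>) * D f \<omega>) (\<sigma>' \<omega>))"
    unfolding sum.distrib[symmetric] sum_subtractf[symmetric]
  proof (rule sum.cong)
    fix \<omega> assume w: "\<omega> \<in> \<Omega>"
    show "s \<omega> * g \<omega> * D f \<omega> - g \<omega> * (f \<omega> - T f \<omega>) =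
      (if s \<omega> = 1 then 0 else - g \<omega> * D f \<omega>) +
      (if s \<omega> = 1 then 0 else cnj z * g (\<sigma> (\<sigma>' \<omega>)) * D f (\<sigma>' \<omega>))"
    proof (cases "s \<omega> = 1")
      case True then show ?thesis by (simp add: T_def D_def)
    next
      case False
      then have m: "s \<omega> = -1" using sign[OF w] by simp
      have "f \<omega> - T f \<omega> = - cnj z * D f (\<sigma>' \<omega>)"
        using diff_shift'_eq[OF w, of f] False by (simp add: T_def)
      then show ?thesis using False m by (simp add: shift_inverse w)
    qed
  qed simp
  also have "\<dots> = (\<Sum>\<omega>\<in>\<Omega>. if s \<omega> = 1 then 0 else ?e \<omega> * D f \<omega>)"
    unfolding sum_negative_shift'[of "\<lambda>\<omega>. cnj z * g (\<sigma> \<omega>) * D f \<omega>"] sum.distrib[symmetric]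
    by (rule sum.cong) (auto simp: algebra_simps)
  finally have eq: "(\<Sum>\<omega>\<in>\<Omega>. s \<omega> * g \<omega> * D f \<omega>) - (\<Sum>\<omega>\<in>\<Omega>. g \<omega> * (f \<omega> - T f \<omega>)) =
    (\<Sum>\<omega>\<in>\<Omega>. if s \<omega> = 1 then 0 else ?e \<omega> * D f \<omega>)" .
  have "cmod (\<Sum>\<omega>\<in>\<Omega>. if s \<omega> = 1 then 0 else ?e \<omega> * D f \<omega>) \<le> (\<Sum>\<omega>\<in>\<Omega>. \<bar>cmod (?e \<omega>)\<bar> * \<bar>cmod (D f \<omega>)\<bar>)"
    by (rule sum_norm_le) (auto simp: norm_mult)
  also have "\<dots> \<le> L2_set (\<lambda>\<omega>. cmod (?e \<omega>)) \<Omega> * L2_set (\<lambda>\<omega>. cmod (D f \<omega>)) \<Omega>"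
    by (rule L2_set_mult_ineq)
  also have "L2_set (\<lambda>\<omega>. cmod (?e \<omega>)) \<Omega> \<le> L2_set (\<lambda>\<omega>. \<bar>g (\<sigma> \<omega>) - g \<omega>\<bar> + cmod (1 - z) * \<bar>g \<omega>\<bar>) \<Omega>"
  proof (rule L2_set_mono)
    fix \<omega> assume w: "\<omega> \<in> \<Omega>"
    have "?e \<omega> = cnj z * (of_real (g (\<sigma> \<omega>) - g \<omega>)) - cnj (1 - z) * of_real (g \<omega>)"
      by (simp add: algebra_simps)
    then have "cmod (?e \<omega>) \<le> cmod (cnj z * (of_real (g (\<sigma> \<omega>) - g \<omega>))) + cmod (cnj (1 - z) * of_real (g \<omega>))"
      by (simp only: norm_triangle_ineq4)
    then show "cmod (?e \<omega>) \<le> \<bar>g (\<sigma> \<omega>) - g \<omega>\<bar> + cmod (1 - z) * \<bar>g \<omega>\<bar>"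
      by (simp only: norm_mult complex_mod_cnj norm_phase norm_of_real) simp
  qed simp
  also have "\<dots> \<le> L2_set (\<lambda>\<omega>. \<bar>g (\<sigma> \<omega>) - g \<omega>\<bar>) \<Omega> + L2_set (\<lambda>\<omega>. cmod (1 - z) * \<bar>g \<omega>\<bar>) \<Omega>"
    by (rule L2_set_triangle_ineq)
  also have "\<dots> = L2_set (\<lambda>\<omega>. g (\<sigma> \<omega>) - g \<omega>) \<Omega> + cmod (1 - z) * L2_set g \<Omega>"
    by (simp add: L2_set_right_distrib[symmetric]) (simp add: L2_set_def)
  finally show ?thesis unfolding eq by (simp add: mult_right_mono)
qed

end

locale signed_shift_pair =
  h: signed_shift \<Omega> \<sigma>1 \<sigma>1' s1 z1 + v: signed_shift \<Omega> \<sigma>2 \<sigma>2' s2 z2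
  for \<Omega> :: "'a set" and \<sigma>1 \<sigma>1' s1 z1 \<sigma>2 \<sigma>2' s2 z2 +
  assumes shift_commute: "\<omega> \<in> \<Omega> \<Longrightarrow> \<sigma>1' (\<sigma>2' \<omega>) = \<sigma>2' (\<sigma>1' \<omega>)"
begin

text \<open>The flow is \<open>F1, F2\<close> in the proof. Summing by parts, \<open>\<Sum> u\<close> is its pairing with \<open>D u\<close>; the parts along
  \<open>s1 g\<close> and \<open>s2 g\<close> recombine through the resolvent equation into \<open>- l \<Sum> g u\<close>.\<close>

lemma resolvent_bound:
  fixes \<Psi> g :: "'a \<Rightarrow> real" and l :: real and u :: "'a \<Rightarrow> complex"
  assumes l: "l > 0" and z1: "z1 \<noteq> 1"
    and u: "\<And>\<omega>. \<omega> \<in> \<Omega> \<Longrightarrow> (2 + of_real l) * u \<omega> - h.T u \<omega> - v.T u \<omega> = 1"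
    and g0: "(\<Sum>\<omega>\<in>\<Omega>. g \<omega>) = 0"
    and A1: "L2_set (\<lambda>\<omega>. 1 + \<Psi> \<omega> - \<Psi> (\<sigma>2' \<omega>) - s1 \<omega> * g \<omega>) \<Omega> + cmod (1 - z2) * L2_set \<Psi> \<Omega>
      + L2_set (\<lambda>\<omega>. g (\<sigma>1 \<omega>) - g \<omega>) \<Omega> + cmod (1 - z1) * L2_set g \<Omega> \<le> A1"
    and A2: "L2_set (\<lambda>\<omega>. \<Psi> \<omega> - \<Psi> (\<sigma>1' \<omega>) + s2 \<omega> * g \<omega>) \<Omega> + cmod (1 - z1) * L2_set \<Psi> \<Omega>
      + L2_set (\<lambda>\<omega>. g (\<sigma>2 \<omega>) - g \<omega>) \<Omega> + cmod (1 - z2) * L2_set g \<Omega> \<le> A2"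
  shows "(cmod (1 - z1))\<^sup>2 * Re (\<Sum>\<omega>\<in>\<Omega>. u \<omega>) \<le> l * (L2_set g \<Omega>)\<^sup>2 + 2 * (A1\<^sup>2 + A2\<^sup>2)"
proof -
  define c where "c = 1 / (1 - cnj z1)"
  have z1': "1 - cnj z1 \<noteq> 0" using z1 by (metis complex_cnj_cancel_iff complex_cnj_one right_minus_eq)
  have c: "c * (1 - cnj z1) = 1" using z1' by (simp add: c_def)
  have normc: "cmod c * cmod (1 - z1) = 1"
    by (metis c complex_cnj_diff complex_cnj_one complex_mod_cnj norm_mult norm_one)
  define P where "P = Re (\<Sum>\<omega>\<in>\<Omega>. u \<omega>)"
  define Du1 where "Du1 = L2_set (\<lambda>\<omega>. cmod (h.D u \<omega>)) \<Omega>"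
  define Du2 where "Du2 = L2_set (\<lambda>\<omega>. cmod (v.D u \<omega>)) \<Omega>"
  define Nu where "Nu = L2_set (\<lambda>\<omega>. cmod (u \<omega>)) \<Omega>"
  have u': "(u \<omega> - h.T u \<omega>) + (u \<omega> - v.T u \<omega>) = 1 - of_real l * u \<omega>" if "\<omega> \<in> \<Omega>" for \<omega>
    using u[OF that] by (simp add: algebra_simps)
  have sq: "Du1\<^sup>2 = (\<Sum>\<omega>\<in>\<Omega>. (cmod (h.D u \<omega>))\<^sup>2)" "Du2\<^sup>2 = (\<Sum>\<omega>\<in>\<Omega>. (cmod (v.D u \<omega>))\<^sup>2)"
    "Nu\<^sup>2 = (\<Sum>\<omega>\<in>\<Omega>. (cmod (u \<omega>))\<^sup>2)"
    by (simp_all add: Du1_def Du2_def Nu_def L2_set_def sum_nonneg)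
  \<comment> \<open>Real part of the equation tested against \<open>u\<close>. It controls
    \<open>Nu\<close>, \<open>Du1\<close> and \<open>Du2\<close> by \<open>P\<close>, the very
    quantity to be estimated.\<close>
  have P_eq: "P = l * Nu\<^sup>2 + (Du1\<^sup>2 + Du2\<^sup>2) / 2"
  proof -
    have "(\<Sum>\<omega>\<in>\<Omega>. cnj (u \<omega>)) = (\<Sum>\<omega>\<in>\<Omega>. cnj (u \<omega>) * (of_real l * u \<omega> + (u \<omega> - h.T u \<omega>) + (u \<omega> - v.T u \<omega>)))"
      by (rule sum.cong) (auto simp: u' add.assoc)
    also have "\<dots> = of_real l * of_real (\<Sum>\<omega>\<in>\<Omega>. (cmod (u \<omega>))\<^sup>2) + (\<Sum>\<omega>\<in>\<Omega>. cnj (u \<omega>) * (u \<omega> - h.T u \<omega>))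
        + (\<Sum>\<omega>\<in>\<Omega>. cnj (u \<omega>) * (u \<omega> - v.T u \<omega>))"
      unfolding of_real_sum sum_distrib_left sum.distrib[symmetric]
      by (rule sum.cong[OF refl]) (simp only: complex_norm_square distrib_left ac_simps)
    finally have "Re (\<Sum>\<omega>\<in>\<Omega>. cnj (u \<omega>)) = l * (\<Sum>\<omega>\<in>\<Omega>. (cmod (u \<omega>))\<^sup>2) +
        Re (\<Sum>\<omega>\<in>\<Omega>. cnj (u \<omega>) * (u \<omega> - h.T u \<omega>)) + Re (\<Sum>\<omega>\<in>\<Omega>. cnj (u \<omega>) * (u \<omega> - v.T u \<omega>))"
      by (simp del: Re_sum of_real_power of_real_sum)
    then show ?thesis
      unfolding h.energy_identity v.energy_identity sq P_def by (simp add: add_divide_distrib)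
  qed
  define F1 where "F1 \<omega> = c * (1 + \<Psi> \<omega> - cnj z2 * \<Psi> (\<sigma>2' \<omega>))" for \<omega>
  define F2 where "F2 \<omega> = - c * (\<Psi> \<omega> - cnj z1 * \<Psi> (\<sigma>1' \<omega>))" for \<omega>
  define R1 where "R1 \<omega> = 1 + \<Psi> \<omega> - cnj z2 * \<Psi> (\<sigma>2' \<omega>) - s1 \<omega> * g \<omega>" for \<omega>
  define R2 where "R2 \<omega> = - (\<Psi> \<omega> - cnj z1 * \<Psi> (\<sigma>1' \<omega>)) - s2 \<omega> * g \<omega>" for \<omega>
  have F: "F1 \<omega> = c * R1 \<omega> + c * (s1 \<omega> * g \<omega>)" "F2 \<omega> = c * R2 \<omega> + c * (s2 \<omega> * g \<omega>)" for \<omega>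
    by (simp_all add: F1_def F2_def R1_def R2_def algebra_simps)
  \<comment> \<open>The mixed differences of \<open>\<Psi>\<close> cancel because the two shifts
    commute.\<close>
  have div: "(F1 \<omega> - cnj z1 * F1 (\<sigma>1' \<omega>)) + (F2 \<omega> - cnj z2 * F2 (\<sigma>2' \<omega>)) = 1" if w: "\<omega> \<in> \<Omega>" for \<omega>
  proof -
    have "(F1 \<omega> - cnj z1 * F1 (\<sigma>1' \<omega>)) + (F2 \<omega> - cnj z2 * F2 (\<sigma>2' \<omega>)) = c * (1 - cnj z1)"
      unfolding F1_def F2_def shift_commute[OF w] by (simp add: algebra_simps)
    then show ?thesis using c by simp
  qed
  have "(\<Sum>\<omega>\<in>\<Omega>. u \<omega>) = (\<Sum>\<omega>\<in>\<Omega>. cnj ((F1 \<omega> - cnj z1 * F1 (\<sigma>1' \<omega>)) + (F2 \<omega> - cnj z2 * F2 (\<sigma>2' \<omega>))) * u \<omega>)"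
    by (rule sum.cong) (auto simp only: div complex_cnj_one mult_1)
  also have "\<dots> = (\<Sum>\<omega>\<in>\<Omega>. cnj (F1 \<omega>) * h.D u \<omega>) + (\<Sum>\<omega>\<in>\<Omega>. cnj (F2 \<omega>) * v.D u \<omega>)"
    unfolding h.sum_by_parts[symmetric] v.sum_by_parts[symmetric] sum.distrib[symmetric]
    by (rule sum.cong) (simp_all only: complex_cnj_add distrib_right)
  also have "\<dots> = cnj c * ((\<Sum>\<omega>\<in>\<Omega>. cnj (R1 \<omega>) * h.D u \<omega>) + (\<Sum>\<omega>\<in>\<Omega>. cnj (R2 \<omega>) * v.D u \<omega>)
      + (\<Sum>\<omega>\<in>\<Omega>. s1 \<omega> * g \<omega> * h.D u \<omega>) + (\<Sum>\<omega>\<in>\<Omega>. s2 \<omega> * g \<omega> * v.D u \<omega>))"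
    unfolding F sum_distrib_left sum.distrib[symmetric] by (rule sum.cong) (simp_all add: algebra_simps)
  finally have main: "(\<Sum>\<omega>\<in>\<Omega>. u \<omega>) = \<dots>" .
  define E1 where "E1 = (\<Sum>\<omega>\<in>\<Omega>. s1 \<omega> * g \<omega> * h.D u \<omega>) - (\<Sum>\<omega>\<in>\<Omega>. g \<omega> * (u \<omega> - h.T u \<omega>))"
  define E2 where "E2 = (\<Sum>\<omega>\<in>\<Omega>. s2 \<omega> * g \<omega> * v.D u \<omega>) - (\<Sum>\<omega>\<in>\<Omega>. g \<omega> * (u \<omega> - v.T u \<omega>))"
  have gT: "(\<Sum>\<omega>\<in>\<Omega>. g \<omega> * (u \<omega> - h.T u \<omega>)) + (\<Sum>\<omega>\<in>\<Omega>. g \<omega> * (u \<omega> - v.T u \<omega>)) = - of_real l * (\<Sum>\<omega>\<in>\<Omega>. g \<omega> * u \<omega>)"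
  proof -
    have "(\<Sum>\<omega>\<in>\<Omega>. g \<omega> * (u \<omega> - h.T u \<omega>)) + (\<Sum>\<omega>\<in>\<Omega>. g \<omega> * (u \<omega> - v.T u \<omega>)) = (\<Sum>\<omega>\<in>\<Omega>. g \<omega> * (1 - of_real l * u \<omega>))"
      unfolding sum.distrib[symmetric] by (rule sum.cong) (simp_all add: u'[symmetric] algebra_simps)
    also have "\<dots> = of_real (\<Sum>\<omega>\<in>\<Omega>. g \<omega>) - of_real l * (\<Sum>\<omega>\<in>\<Omega>. g \<omega> * u \<omega>)"
      by (simp add: sum_distrib_left sum_subtractf[symmetric] algebra_simps)
    finally show ?thesis using g0 by simp
  qed
  have main': "(\<Sum>\<omega>\<in>\<Omega>. u \<omega>) = cnj c * ((\<Sum>\<omega>\<in>\<Omega>. cnj (R1 \<omega>) * h.D u \<omega>) + (\<Sum>\<omega>\<in>\<Omega>. cnj (R2 \<omega>) * v.D u \<omega>)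
      + E1 + E2 - of_real l * (\<Sum>\<omega>\<in>\<Omega>. g \<omega> * u \<omega>))"
    unfolding main E1_def E2_def using gT by (simp add: algebra_simps)
  have CS: "cmod (\<Sum>\<omega>\<in>\<Omega>. cnj (f \<omega>) * k \<omega>) \<le> L2_set (\<lambda>\<omega>. cmod (f \<omega>)) \<Omega> * L2_set (\<lambda>\<omega>. cmod (k \<omega>)) \<Omega>" for f k :: "'a \<Rightarrow> complex"
    using order_trans[OF sum_norm_le L2_set_mult_ineq, of \<Omega> "\<lambda>\<omega>. cnj (f \<omega>) * k \<omega>" "\<lambda>\<omega>. cmod (f \<omega>)" "\<lambda>\<omega>. cmod (k \<omega>)"]
    by (simp add: norm_mult)
  \<comment> \<open>Replacing a phase by 1 leaves a real residual that is the same for all modes,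
    and an error proportional to \<open>cmod (1 - z)\<close>.\<close>
  have tri: "L2_set (\<lambda>\<omega>. cmod (of_real (a \<omega>) + (1 - cnj z) * of_real (b \<omega>))) \<Omega> \<le> L2_set a \<Omega> + cmod (1 - z) * L2_set b \<Omega>"
    for a b :: "'a \<Rightarrow> real" and z
  proof -
    have "L2_set (\<lambda>\<omega>. cmod (of_real (a \<omega>) + (1 - cnj z) * of_real (b \<omega>))) \<Omega> \<le> L2_set (\<lambda>\<omega>. \<bar>a \<omega>\<bar> + cmod (1 - z) * \<bar>b \<omega>\<bar>) \<Omega>"
    proof (rule L2_set_mono)
      fix \<omega>
      have "cmod (1 - cnj z) = cmod (1 - z)" by (metis complex_cnj_diff complex_cnj_one complex_mod_cnj)
      then show "cmod (of_real (a \<omega>) + (1 - cnj z) * of_real (b \<omega>)) \<le> \<bar>a \<omega>\<bar> + cmod (1 - z) * \<bar>b \<omega>\<bar>"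
        using norm_triangle_ineq[of "of_real (a \<omega>)" "(1 - cnj z) * of_real (b \<omega>)"] by (simp add: norm_mult)
    qed simp
    also have "\<dots> \<le> L2_set (\<lambda>\<omega>. \<bar>a \<omega>\<bar>) \<Omega> + L2_set (\<lambda>\<omega>. cmod (1 - z) * \<bar>b \<omega>\<bar>) \<Omega>"
      by (rule L2_set_triangle_ineq)
    also have "\<dots> = L2_set a \<Omega> + cmod (1 - z) * L2_set b \<Omega>"
      by (simp add: L2_set_right_distrib[symmetric]) (simp add: L2_set_def)
    finally show ?thesis .
  qed
  have L2minus: "L2_set (\<lambda>\<omega>. - f \<omega>) \<Omega> = L2_set f \<Omega>" for f :: "'a \<Rightarrow> real" by (simp add: L2_set_def)
  have shiftN: "L2_set (\<lambda>\<omega>. \<Psi> (\<sigma>2' \<omega>)) \<Omega> = L2_set \<Psi> \<Omega>" "L2_set (\<lambda>\<omega>. \<Psi> (\<sigma>1' \<omega>)) \<Omega> = L2_set \<Psi> \<Omega>"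
    unfolding L2_set_def using v.sum_shift'[of "\<lambda>\<omega>. (\<Psi> \<omega>)\<^sup>2"] h.sum_shift'[of "\<lambda>\<omega>. (\<Psi> \<omega>)\<^sup>2"] by simp_all
  have NR1: "L2_set (\<lambda>\<omega>. cmod (R1 \<omega>)) \<Omega> \<le> L2_set (\<lambda>\<omega>. 1 + \<Psi> \<omega> - \<Psi> (\<sigma>2' \<omega>) - s1 \<omega> * g \<omega>) \<Omega> + cmod (1 - z2) * L2_set \<Psi> \<Omega>"
    using tri[of "\<lambda>\<omega>. 1 + \<Psi> \<omega> - \<Psi> (\<sigma>2' \<omega>) - s1 \<omega> * g \<omega>" z2 "\<lambda>\<omega>. \<Psi> (\<sigma>2' \<omega>)"]
    unfolding shiftN by (simp add: R1_def algebra_simps)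
  have NR2: "L2_set (\<lambda>\<omega>. cmod (R2 \<omega>)) \<Omega> \<le> L2_set (\<lambda>\<omega>. \<Psi> \<omega> - \<Psi> (\<sigma>1' \<omega>) + s2 \<omega> * g \<omega>) \<Omega> + cmod (1 - z1) * L2_set \<Psi> \<Omega>"
  proof -
    have "cmod (R2 \<omega>) = cmod (of_real (\<Psi> \<omega> - \<Psi> (\<sigma>1' \<omega>) + s2 \<omega> * g \<omega>) + (1 - cnj z1) * of_real (\<Psi> (\<sigma>1' \<omega>)))" for \<omega>
      unfolding R2_def by (subst norm_minus_cancel[symmetric]) (simp add: algebra_simps)
    then show ?thesis
      using tri[of "\<lambda>\<omega>. \<Psi> \<omega> - \<Psi> (\<sigma>1' \<omega>) + s2 \<omega> * g \<omega>" z1 "\<lambda>\<omega>. \<Psi> (\<sigma>1' \<omega>)"]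
      unfolding shiftN by simp
  qed
  define G1 where "G1 = L2_set (\<lambda>\<omega>. g (\<sigma>1 \<omega>) - g \<omega>) \<Omega> + cmod (1 - z1) * L2_set g \<Omega>"
  define G2 where "G2 = L2_set (\<lambda>\<omega>. g (\<sigma>2 \<omega>) - g \<omega>) \<Omega> + cmod (1 - z2) * L2_set g \<Omega>"
  have nn: "Du1 \<ge> 0" "Du2 \<ge> 0" "Nu \<ge> 0" by (simp_all add: Du1_def Du2_def Nu_def)
  have e: "cmod E1 \<le> G1 * Du1" "cmod E2 \<le> G2 * Du2"
    unfolding E1_def E2_def G1_def G2_def Du1_def Du2_def by (rule h.drift_by_parts v.drift_by_parts)+
  have r: "cmod (\<Sum>\<omega>\<in>\<Omega>. cnj (R1 \<omega>) * h.D u \<omega>) \<le> (A1 - G1) * Du1" "cmod (\<Sum>\<omega>\<in>\<Omega>. cnj (R2 \<omega>) * v.D u \<omega>) \<le> (A2 - G2) * Du2"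
    unfolding Du1_def Du2_def using NR1 NR2 A1 A2
    by (auto intro!: order_trans[OF CS] mult_right_mono simp: G1_def G2_def)
  have gu: "cmod (\<Sum>\<omega>\<in>\<Omega>. g \<omega> * u \<omega>) \<le> L2_set g \<Omega> * Nu"
    using CS[of "\<lambda>\<omega>. of_real (g \<omega>)" u] by (simp add: Nu_def) (simp add: L2_set_def)
  have "P \<le> cmod (\<Sum>\<omega>\<in>\<Omega>. u \<omega>)" unfolding P_def by (rule complex_Re_le_cmod)
  also have "\<dots> \<le> cmod c * (A1 * Du1 + A2 * Du2 + l * (L2_set g \<Omega> * Nu))"
  proof -
    have "cmod ((\<Sum>\<omega>\<in>\<Omega>. cnj (R1 \<omega>) * h.D u \<omega>) + (\<Sum>\<omega>\<in>\<Omega>. cnj (R2 \<omega>) * v.D u \<omega>) + E1 + E2 - of_real l * (\<Sum>\<omega>\<in>\<Omega>. g \<omega> * u \<omega>))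
      \<le> (A1 - G1) * Du1 + (A2 - G2) * Du2 + G1 * Du1 + G2 * Du2 + l * (L2_set g \<Omega> * Nu)"
      using l by (intro norm_triangle_le_diff norm_triangle_le add_mono r e) (auto simp: norm_mult intro!: mult_left_mono gu)
    also have "\<dots> = A1 * Du1 + A2 * Du2 + l * (L2_set g \<Omega> * Nu)" by (simp add: algebra_simps)
    finally show ?thesis unfolding main' by (simp add: norm_mult mult_left_mono)
  qed
  finally have b: "P \<le> cmod c * (A1 * Du1 + A2 * Du2 + l * (L2_set g \<Omega> * Nu))" .
  define k where "k = cmod (1 - z1)"
  define G where "G = L2_set g \<Omega>"
  define C where "C = cmod c"
  have Ck: "C * k = 1" using normc by (simp add: k_def C_def)
  \<comment> \<open>Young's inequality, weighted so that the terms in \<open>Du1\<close>,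
    \<open>Du2\<close> and \<open>Nu\<close> add up to exactly \<open>P / 2\<close> and can be
    absorbed.\<close>
  have "C * A1 * Du1 \<le> (C * A1)\<^sup>2 + Du1\<^sup>2 / 4" "C * A2 * Du2 \<le> (C * A2)\<^sup>2 + Du2\<^sup>2 / 4"
    using zero_le_power2[of "C * A1 - Du1 / 2"] zero_le_power2[of "C * A2 - Du2 / 2"]
    by (simp_all add: power2_eq_square algebra_simps)
  moreover have "l * (C * G * Nu) \<le> l * (((C * G)\<^sup>2 + Nu\<^sup>2) / 2)"
    using l zero_le_power2[of "C * G - Nu"] by (intro mult_left_mono) (simp_all add: power2_eq_square algebra_simps)
  moreover have "l * (((C * G)\<^sup>2 + Nu\<^sup>2) / 2) = l * (C * G)\<^sup>2 / 2 + l * Nu\<^sup>2 / 2" by (simp add: algebra_simps add_divide_distrib)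
  moreover have "P \<le> C * A1 * Du1 + C * A2 * Du2 + l * (C * G * Nu)"
    using b unfolding C_def[symmetric] G_def[symmetric] by (simp add: algebra_simps)
  moreover have "P / 2 = l * Nu\<^sup>2 / 2 + Du1\<^sup>2 / 4 + Du2\<^sup>2 / 4" using P_eq by (simp add: add_divide_distrib)
  ultimately have "P \<le> (C * A1)\<^sup>2 + (C * A2)\<^sup>2 + l * (C * G)\<^sup>2 / 2 + P / 2"
    by linarith
  then have "P \<le> C\<^sup>2 * (l * G\<^sup>2 + 2 * (A1\<^sup>2 + A2\<^sup>2))" by (simp add: power_mult_distrib algebra_simps)
  then have "k\<^sup>2 * P \<le> k\<^sup>2 * (C\<^sup>2 * (l * G\<^sup>2 + 2 * (A1\<^sup>2 + A2\<^sup>2)))" by (rule mult_left_mono) simp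
  also have "\<dots> = (C * k)\<^sup>2 * (l * G\<^sup>2 + 2 * (A1\<^sup>2 + A2\<^sup>2))" by (simp add: power_mult_distrib)
  finally show ?thesis using Ck by (simp add: k_def P_def G_def)
qed

end

section \<open>Periodic random signs\<close>

type_synonym lines = "(int \<Rightarrow> real) \<times> (int \<Rightarrow> real)"

definition orientations :: "int \<Rightarrow> (int \<Rightarrow> real) set" where
  "orientations Q = {f. (\<forall>a. f a = 1 \<or> f a = -1) \<and> (\<forall>a. f (a + Q) = f a)}"

lemma orientations_add_mult: "f \<in> orientations Q \<Longrightarrow> f (a + int n * Q) = f a"
proof (induction n)
  case (Suc n)
  have "f (a + int (Suc n) * Q) = f ((a + int n * Q) + Q)" by (simp add: algebra_simps)
  then show ?case using Suc by (simp add: orientations_def)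
qed simp

lemma orientations_mod:
  assumes "f \<in> orientations Q" "Q > 0"
  shows "f (a mod Q) = f a"
proof (cases "a div Q \<ge> 0")
  case True
  then show ?thesis
    using orientations_add_mult[OF assms(1), of "a mod Q" "nat (a div Q)"] by (simp add: mult.commute)
next
  case False
  then have "a + int (nat (- (a div Q))) * Q = a mod Q"
    by (simp add: minus_div_mult_eq_mod[symmetric])
  then show ?thesis
    using orientations_add_mult[OF assms(1), of a "nat (- (a div Q))"] by simp
qed

locale periodic =
  fixes Q :: int
  assumes Q_pos: "Q > 0"
begin

abbreviation "Or \<equiv> orientations Q"

lemma finite_orientations: "finite Or"
proof (rule inj_on_finite)
  show "inj_on (\<lambda>f. restrict f {0..<Q}) Or"
  proof (rule inj_onI, rule ext)
    fix f g :: "int \<Rightarrow> real" and a assume fg: "f \<in> Or" "g \<in> Or" "restrict f {0..<Q} = restrict g {0..<Q}"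
    have "f (a mod Q) = g (a mod Q)" using fun_cong[OF fg(3), of "a mod Q"] Q_pos by simp
    then show "f a = g a" using fg Q_pos by (simp add: orientations_mod)
  qed
  show "(\<lambda>f. restrict f {0..<Q}) ` Or \<subseteq> PiE {0..<Q} (\<lambda>_. {1, -1})"
    by (auto simp: orientations_def)
  show "finite (PiE {0..<Q} (\<lambda>_. {1, -1 :: real}))" by (intro finite_PiE) auto
qed

lemma card_orientations_pos: "card Or > 0"
proof -
  have "(\<lambda>_. 1) \<in> Or" by (simp add: orientations_def)
  then show ?thesis using finite_orientations by (auto simp: card_gt_0_iff)
qed

definition mean :: "((int \<Rightarrow> real) \<Rightarrow> real) \<Rightarrow> real" where
  "mean h = (\<Sum>f\<in>Or. h f) / card Or"

text \<open>A sign change has to act on a whole residue class to preserve periodicity. Invariance of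
  \<open>mean\<close> under these involutions stands in for independence of the signs.\<close>

definition flip :: "int \<Rightarrow> (int \<Rightarrow> real) \<Rightarrow> int \<Rightarrow> real" where
  "flip a f = (\<lambda>x. if Q dvd x - a then - f x else f x)"

lemma flip_in: "f \<in> Or \<Longrightarrow> flip a f \<in> Or"
proof -
  assume f: "f \<in> Or"
  have "Q dvd x + Q - a \<longleftrightarrow> Q dvd x - a" for x
    by (metis add_diff_eq add.commute dvd_add_triv_right_iff diff_add_eq)
  with f show ?thesis by (force simp: orientations_def flip_def)
qed

lemma flip_flip: "flip a (flip a f) = f" by (auto simp: flip_def)

lemma flip_same: "flip a f a = - f a" by (simp add: flip_def)

lemma mean_flip: "mean (\<lambda>f. h (flip a f)) = mean h"
  unfolding mean_def
  by (rule arg_cong[where f = "\<lambda>x. x / _"], rule sum.reindex_bij_witness[of _ "flip a" "flip a"])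
     (auto simp: flip_in flip_flip)

lemma mean_cong: "(\<And>f. f \<in> Or \<Longrightarrow> h f = k f) \<Longrightarrow> mean h = mean k"
  by (simp add: mean_def)

lemma mean_mono: "(\<And>f. f \<in> Or \<Longrightarrow> h f \<le> k f) \<Longrightarrow> mean h \<le> mean k"
  unfolding mean_def by (intro divide_right_mono sum_mono) auto

lemma mean_const [simp]: "mean (\<lambda>_. c) = c"
  using card_orientations_pos by (simp add: mean_def)

lemma mean_add: "mean (\<lambda>f. h f + k f) = mean h + mean k"
  by (simp add: mean_def sum.distrib add_divide_distrib)

lemma mean_cmult: "mean (\<lambda>f. c * h f) = c * mean h"
  by (simp add: mean_def sum_distrib_left[symmetric])

lemma mean_multc: "mean (\<lambda>f. h f * c) = mean h * c"
  using mean_cmult[of c h] by (simp add: mult.commute)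

lemma mean_sum: "mean (\<lambda>f. \<Sum>i\<in>I. h i f) = (\<Sum>i\<in>I. mean (h i))"
  unfolding mean_def by (subst sum.swap) (simp add: sum_divide_distrib)

lemma mean_odd:
  assumes "\<And>f. f \<in> Or \<Longrightarrow> h (flip a f) = - h f"
  shows "mean h = 0"
proof -
  have "mean h = mean (\<lambda>f. - 1 * h f)"
    unfolding mean_flip[of h a, symmetric] using assms by (intro mean_cong) simp
  then show ?thesis unfolding mean_cmult by simp
qed

text \<open>Pythagoras with a weight: factors that depend on other signs are collected in
  \<open>h\<close>, so that second moments of products can be computed one factor at a time.\<close>

lemma mean_square_orthogonal:
  assumes fin: "finite S"
    and sq: "\<And>s f. s \<in> S \<Longrightarrow> f \<in> Or \<Longrightarrow> (e s f)\<^sup>2 = 1"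
    and orth: "\<And>s t. s \<in> S \<Longrightarrow> t \<in> S \<Longrightarrow> s \<noteq> t \<Longrightarrow> mean (\<lambda>f. e s f * e t f * h f) = 0"
  shows "mean (\<lambda>f. (\<Sum>s\<in>S. c s * e s f)\<^sup>2 * h f) = (\<Sum>s\<in>S. (c s)\<^sup>2) * mean h"
proof -
  have "mean (\<lambda>f. (\<Sum>s\<in>S. c s * e s f)\<^sup>2 * h f)
      = mean (\<lambda>f. \<Sum>s\<in>S. \<Sum>t\<in>S. c s * c t * (e s f * e t f * h f))"
    unfolding power2_eq_square sum_product
    unfolding sum_distrib_right by (intro mean_cong sum.cong refl) simp
  also have "\<dots> = (\<Sum>s\<in>S. \<Sum>t\<in>S. c s * c t * mean (\<lambda>f. e s f * e t f * h f))"
    by (simp add: mean_sum mean_cmult)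
  also have "\<dots> = (\<Sum>s\<in>S. \<Sum>t\<in>S. if t = s then (c s)\<^sup>2 * mean h else 0)"
  proof (intro sum.cong refl)
    fix s t assume st: "s \<in> S" "t \<in> S"
    have "mean (\<lambda>f. e s f * e s f * h f) = mean h"
      using sq[OF st(1)] by (intro mean_cong) (simp add: power2_eq_square)
    then show "c s * c t * mean (\<lambda>f. e s f * e t f * h f) = (if t = s then (c s)\<^sup>2 * mean h else 0)"
      using orth[OF st] by (auto simp: power2_eq_square)
  qed
  also have "\<dots> = (\<Sum>s\<in>S. (c s)\<^sup>2) * mean h"
    using fin by (simp add: sum_distrib_right)
  finally show ?thesis .
qed

lemma sq_sign:
  assumes "f \<in> Or" shows "(f a)\<^sup>2 = 1" "f a * f a = 1"
proof -
  from assms have "f a = 1 \<or> f a = -1" by (simp add: orientations_def)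
  then show "(f a)\<^sup>2 = 1" "f a * f a = 1" by auto
qed

end

section \<open>Second moments of polynomials in the signs of a window\<close>

locale window = periodic +
  fixes N :: int
  assumes N_nonneg: "N \<ge> 0" and Q_gt: "2 * N < Q"
begin

abbreviation "W \<equiv> {-N..N}"

text \<open>By \<open>2 * N < Q\<close> a residue class meets the window at most once, so that a
  flip at one site of the window leaves its other sites alone.\<close>

lemma window_distinct: "a \<in> W \<Longrightarrow> b \<in> W \<Longrightarrow> a \<noteq> b \<Longrightarrow> \<not> Q dvd a - b"
proof
  assume ab: "a \<in> W" "b \<in> W" "a \<noteq> b" "Q dvd a - b"
  then have "\<bar>Q\<bar> \<le> \<bar>a - b\<bar>" by (intro dvd_imp_le_int) auto
  then show False using ab Q_gt by auto
qed

definition lin :: "(int \<Rightarrow> real) \<Rightarrow> (int \<Rightarrow> real) \<Rightarrow> real" where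
  "lin c f = (\<Sum>x\<in>W. c x * f x)"

lemma flip_window: "a \<in> W \<Longrightarrow> x \<in> W \<Longrightarrow> flip a f x = (if x = a then - f a else f x)"
  using window_distinct[of x a] by (auto simp: flip_def)

lemma lin_flip:
  assumes "a \<in> W" "c a = 0"
  shows "lin c (flip a f) = lin c f"
  unfolding lin_def using assms by (intro sum.cong) (auto simp: flip_window)

text \<open>Cross terms are killed by flips at sites where \<open>c\<close> is nonzero, so
  \<open>h\<close> has to be invariant only there. Second moments thus factorise for factors that
  read disjoint sets of lines.\<close>

lemma mean_square_lin:
  assumes h: "\<And>a f. a \<in> W \<Longrightarrow> c a \<noteq> 0 \<Longrightarrow> f \<in> Or \<Longrightarrow> h (flip a f) = h f"
  shows "mean (\<lambda>f. (lin c f)\<^sup>2 * h f) = (\<Sum>x\<in>W. (c x)\<^sup>2) * mean h"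
proof -
  let ?S = "{x\<in>W. c x \<noteq> 0}"
  have "mean (\<lambda>f. (\<Sum>x\<in>?S. c x * f x)\<^sup>2 * h f) = (\<Sum>x\<in>?S. (c x)\<^sup>2) * mean h"
  proof (rule mean_square_orthogonal)
    show "finite ?S" by (rule finite_subset[of _ W]) auto
  next
    fix s t assume st: "s \<in> ?S" "t \<in> ?S" "s \<noteq> t"
    show "mean (\<lambda>f. f s * f t * h f) = 0"
      by (rule mean_odd[of _ s]) (use st h[of s] in \<open>auto simp: flip_window\<close>)
  qed (auto simp: sq_sign)
  moreover have "lin c f = (\<Sum>x\<in>?S. c x * f x)" for f
    unfolding lin_def by (rule sum.mono_neutral_right) auto
  moreover have "(\<Sum>x\<in>W. (c x)\<^sup>2) = (\<Sum>x\<in>?S. (c x)\<^sup>2)"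
    by (rule sum.mono_neutral_right) auto
  ultimately show ?thesis by simp
qed

lemma mean_square_lin1: "mean (\<lambda>f. (lin c f)\<^sup>2) = (\<Sum>x\<in>W. (c x)\<^sup>2)"
  using mean_square_lin[of c "\<lambda>_. 1"] by simp

text \<open>For \<open>j\<close> of one sign the monomials \<open>f a * f (a + j)\<close> are pairwise different. With both signs each one can occur
  twice, whence the factor 2 in \<open>mean_square_pairs_le\<close>.\<close>

lemma mean_square_pairs:
  assumes fin: "finite A" "finite J"
    and sgn: "J \<subseteq> {0<..} \<or> J \<subseteq> {..<0}"
    and AJ: "\<And>a. a \<in> A \<Longrightarrow> a \<in> W" "\<And>a j. a \<in> A \<Longrightarrow> j \<in> J \<Longrightarrow> a + j \<in> W"
  shows "mean (\<lambda>f. (\<Sum>a\<in>A. \<Sum>j\<in>J. p a j * (f a * f (a + j)))\<^sup>2) = (\<Sum>a\<in>A. \<Sum>j\<in>J. (p a j)\<^sup>2)"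
proof -
  have "mean (\<lambda>f. (\<Sum>s\<in>A \<times> J. p (fst s) (snd s) * (f (fst s) * f (fst s + snd s)))\<^sup>2 * 1)
      = (\<Sum>s\<in>A \<times> J. (p (fst s) (snd s))\<^sup>2) * mean (\<lambda>_. 1)"
  proof (rule mean_square_orthogonal)
    fix s t assume st: "s \<in> A \<times> J" "t \<in> A \<times> J" "s \<noteq> t"
    obtain a j a' j' where s: "s = (a, j)" and t: "t = (a', j')" by (metis surj_pair)
    have mem: "a \<in> W" "a + j \<in> W" "a' \<in> W" "a' + j' \<in> W" "j \<noteq> 0" "j' \<noteq> 0"
      using st AJ sgn by (auto simp: s t)
    have signs: "(if P then -1 else 1) * b1 * ((if P' then -1 else 1) * b2) *
        ((if R then -1 else 1) * b3 * ((if R' then -1 else 1) * b4)) * 1 = - (b1 * b2 * (b3 * b4) * (1::real))"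
      if "P \<noteq> (P' \<noteq> (R \<noteq> R'))" for P P' R R' and b1 b2 b3 b4 :: real
      using that by (cases P; cases P'; cases R; cases R') simp_all
    \<comment> \<open>The condition says that \<open>x\<close> occurs an odd number of times among
      the four indices; then the product changes sign under the flip at \<open>x\<close>.\<close>
    have odd1: "mean (\<lambda>f. f a * f (a + j) * (f a' * f (a' + j')) * 1) = 0"
      if "x \<in> W" "(x = a) \<noteq> ((x = a + j) \<noteq> ((x = a') \<noteq> (x = a' + j')))" for x
    proof (rule mean_odd[of _ x])
      fix f
      have fl: "flip x f y = (if x = y then -1 else 1) * f y" if "y \<in> W" for y
        using flip_window[OF \<open>x \<in> W\<close> that] by simp
      show "flip x f a * flip x f (a + j) * (flip x f a' * flip x f (a' + j')) * 1 = - (f a * f (a + j) * (f a' * f (a' + j')) * 1)"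
        unfolding fl[OF mem(1)] fl[OF mem(2)] fl[OF mem(3)] fl[OF mem(4)] using that(2) by (rule signs)
    qed
    \<comment> \<open>Each case has an unmatched index: the smaller base point for positive shifts,
      the larger one for negative shifts, and \<open>a + j\<close> if the base points agree.\<close>
    consider "a < a'" "j > 0" "j' > 0" | "a' < a" "j > 0" "j' > 0" | "a < a'" "j < 0" "j' < 0" | "a' < a" "j < 0" "j' < 0"
      | "a = a'" "j \<noteq> j'"
      using st sgn unfolding s t by (simp add: subset_iff) (metis linorder_neqE)
    then show "mean (\<lambda>f. f (fst s) * f (fst s + snd s) * (f (fst t) * f (fst t + snd t)) * 1) = 0"
    proof cases
      case 1 then show ?thesis using odd1[of a] mem by (simp add: s t)
    next
      case 2 then show ?thesis using odd1[of a'] mem by (simp add: s t)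
    next
      case 3 then show ?thesis using odd1[of a'] mem by (simp add: s t)
    next
      case 4 then show ?thesis using odd1[of a] mem by (simp add: s t)
    next
      case 5 then show ?thesis using odd1[of "a + j"] mem by (simp add: s t)
    qed
  qed (use fin in \<open>auto simp: sq_sign power_mult_distrib\<close>)
  then show ?thesis by (simp add: sum.cartesian_product case_prod_beta)
qed

lemma sum_sq_le: "(x + y)\<^sup>2 \<le> 2 * x\<^sup>2 + 2 * (y::real)\<^sup>2"
  using zero_le_power2[of "x - y"] by (simp add: power2_eq_square algebra_simps)

lemma mean_square_pairs_le:
  assumes fin: "finite A" "finite J" and nz: "0 \<notin> J"
    and AJ: "\<And>a. a \<in> A \<Longrightarrow> a \<in> W" "\<And>a j. a \<in> A \<Longrightarrow> j \<in> J \<Longrightarrow> a + j \<in> W"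
  shows "mean (\<lambda>f. (\<Sum>a\<in>A. \<Sum>j\<in>J. p a j * (f a * f (a + j)))\<^sup>2) \<le> 2 * (\<Sum>a\<in>A. \<Sum>j\<in>J. (p a j)\<^sup>2)"
proof -
  let ?P = "J \<inter> {0<..}" and ?M = "J \<inter> {..<0}"
  have J: "J = ?P \<union> ?M" using nz by (auto, metis linorder_neqE)
  have split: "(\<Sum>j\<in>J. F j) = (\<Sum>j\<in>?P. F j) + (\<Sum>j\<in>?M. F j)" for F :: "int \<Rightarrow> real"
    using fin by (subst J, subst sum.union_disjoint) auto
  have "mean (\<lambda>f. (\<Sum>a\<in>A. \<Sum>j\<in>J. p a j * (f a * f (a + j)))\<^sup>2)
     \<le> mean (\<lambda>f. 2 * (\<Sum>a\<in>A. \<Sum>j\<in>?P. p a j * (f a * f (a + j)))\<^sup>2 + 2 * (\<Sum>a\<in>A. \<Sum>j\<in>?M. p a j * (f a * f (a + j)))\<^sup>2)"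
    unfolding split sum.distrib by (rule mean_mono) (rule sum_sq_le)
  also have "\<dots> = 2 * (\<Sum>a\<in>A. \<Sum>j\<in>?P. (p a j)\<^sup>2) + 2 * (\<Sum>a\<in>A. \<Sum>j\<in>?M. (p a j)\<^sup>2)"
    unfolding mean_add mean_cmult using fin AJ by (subst (1 2) mean_square_pairs) auto
  also have "\<dots> = 2 * (\<Sum>a\<in>A. \<Sum>j\<in>J. (p a j)\<^sup>2)"
    unfolding split sum.distrib by simp
  finally show ?thesis .
qed

abbreviation form :: "(int \<Rightarrow> int \<Rightarrow> real) \<Rightarrow> (int \<Rightarrow> real) \<Rightarrow> (int \<Rightarrow> real) \<Rightarrow> real" where
  "form c \<xi> \<zeta> \<equiv> \<Sum>j\<in>W. \<xi> j * lin (c j) \<zeta>"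

abbreviation square_sum :: "(int \<Rightarrow> int \<Rightarrow> real) \<Rightarrow> real" where
  "square_sum c \<equiv> \<Sum>j\<in>W. \<Sum>x\<in>W. (c j x)\<^sup>2"

definition mean2 :: "(lines \<Rightarrow> real) \<Rightarrow> real" where
  "mean2 F = mean (\<lambda>\<zeta>. mean (\<lambda>\<xi>. F (\<xi>, \<zeta>)))"

definition nrm :: "(lines \<Rightarrow> real) \<Rightarrow> real" where
  "nrm F = sqrt (mean2 (\<lambda>\<omega>. (F \<omega>)\<^sup>2))"

lemma mean2_eq: "mean2 F = (\<Sum>\<omega>\<in>Or \<times> Or. F \<omega>) / (card Or)\<^sup>2"
proof -
  have "mean2 F = (\<Sum>\<zeta>\<in>Or. \<Sum>\<xi>\<in>Or. F (\<xi>, \<zeta>)) / (card Or)\<^sup>2"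
    by (simp add: mean2_def mean_def sum_divide_distrib power2_eq_square)
  also have "(\<Sum>\<zeta>\<in>Or. \<Sum>\<xi>\<in>Or. F (\<xi>, \<zeta>)) = (\<Sum>\<omega>\<in>Or \<times> Or. F \<omega>)"
    by (subst sum.swap) (simp only: sum.cartesian_product case_prod_eta)
  finally show ?thesis .
qed

end

section \<open>Logarithmic cutoffs\<close>

definition log_mass :: "int \<Rightarrow> int \<Rightarrow> real" where
  "log_mass lo hi = (\<Sum>t\<in>{lo<..hi}. 1 / of_int t)"

definition log_step :: "int \<Rightarrow> int \<Rightarrow> int \<Rightarrow> real" where
  "log_step lo hi t = (if lo < t \<and> t \<le> hi then 1 / (of_int t * log_mass lo hi) else 0)"

text \<open>Between \<open>lo\<close> and \<open>hi\<close> this is approximately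
  \<open>ln (hi / n) / ln (hi / lo)\<close>, the radial potential of least Dirichlet energy between
  two circles in the plane.\<close>

definition log_profile :: "int \<Rightarrow> int \<Rightarrow> int \<Rightarrow> real" where
  "log_profile lo hi n = (\<Sum>t\<in>{n<..hi}. log_step lo hi t)"

text \<open>The level set of \<open>a + \<bar>x\<bar>\<close> at height \<open>t\<close> has at most
  \<open>2 * t - 1\<close> points with \<open>a \<ge> 1\<close>. This reduces planar sums to radial
  ones with weight \<open>t\<close>.\<close>

lemma sum_cone_le:
  fixes F :: "int \<Rightarrow> real"
  assumes F0: "\<And>t. F t \<ge> 0" and Fhi: "\<And>t. t > hi \<Longrightarrow> F t = 0"
    and A: "finite A" "A \<subseteq> {1..}" and X: "finite X"
  shows "(\<Sum>a\<in>A. \<Sum>x\<in>X. F (a + \<bar>x\<bar>)) \<le> (\<Sum>t\<in>{1..hi}. 2 * of_int t * F t)"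
proof -
  let ?S = "{s \<in> A \<times> X. fst s + \<bar>snd s\<bar> \<in> {1..hi}}"
  have "(\<Sum>a\<in>A. \<Sum>x\<in>X. F (a + \<bar>x\<bar>)) = (\<Sum>s\<in>A \<times> X. F (fst s + \<bar>snd s\<bar>))"
    by (simp add: sum.cartesian_product case_prod_beta)
  also have "\<dots> = (\<Sum>s\<in>?S. F (fst s + \<bar>snd s\<bar>))"
    using A X by (intro sum.mono_neutral_right) (force simp: not_le intro: Fhi)+
  also have "\<dots> = (\<Sum>t\<in>{1..hi}. \<Sum>s\<in>{s\<in>?S. fst s + \<bar>snd s\<bar> = t}. F (fst s + \<bar>snd s\<bar>))"
    using A X by (intro sum.group[symmetric]) auto
  also have "\<dots> = (\<Sum>t\<in>{1..hi}. of_nat (card {s\<in>?S. fst s + \<bar>snd s\<bar> = t}) * F t)"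
    by (intro sum.cong refl) (simp add: sum_constant[symmetric] del: sum_constant)
  also have "\<dots> \<le> (\<Sum>t\<in>{1..hi}. 2 * of_int t * F t)"
  proof (intro sum_mono mult_right_mono F0)
    fix t assume t: "t \<in> {1..hi}"
    have "card {s\<in>?S. fst s + \<bar>snd s\<bar> = t} \<le> card {-(t-1)..t-1}"
    proof (rule card_inj_on_le[of snd])
      show "inj_on snd {s\<in>?S. fst s + \<bar>snd s\<bar> = t}" by (auto simp: inj_on_def)
      show "snd ` {s\<in>?S. fst s + \<bar>snd s\<bar> = t} \<subseteq> {-(t-1)..t-1}" using A(2) by force
    qed simp
    also have "\<dots> \<le> nat (2 * t)" using t by simp
    finally have "real (card {s\<in>?S. fst s + \<bar>snd s\<bar> = t}) \<le> real (nat (2 * t))" by (rule of_nat_mono)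
    also have "\<dots> = 2 * of_int t" using t by simp
    finally show "real (card {s\<in>?S. fst s + \<bar>snd s\<bar> = t}) \<le> 2 * of_int t" .
  qed
  finally show ?thesis .
qed

text \<open>On a level set of \<open>K * a + x + 1\<close> the value of \<open>a\<close> determines
  \<open>x\<close>, and at most \<open>t div K + 1\<close> values of \<open>a\<close> occur. This
  count is the origin of the factor \<open>1 / K\<close> in the cheap direction.\<close>

lemma sum_scaled_cone_le:
  fixes F :: "int \<Rightarrow> real"
  assumes F0: "\<And>t. F t \<ge> 0" and Fhi: "\<And>t. t > hi \<Longrightarrow> F t = 0" and K: "K \<ge> 1"
    and A: "finite A" "A \<subseteq> {0..}" and X: "finite X" "X \<subseteq> {0..}"
  shows "(\<Sum>a\<in>A. \<Sum>x\<in>X. F (K * a + x + 1)) \<le> (\<Sum>t\<in>{1..hi}. (of_int t / of_int K + 1) * F t)"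
proof -
  let ?k = "\<lambda>s. K * fst s + snd s + 1"
  let ?S = "{s \<in> A \<times> X. ?k s \<in> {1..hi}}"
  have "(\<Sum>a\<in>A. \<Sum>x\<in>X. F (K * a + x + 1)) = (\<Sum>s\<in>A \<times> X. F (?k s))"
    by (simp add: sum.cartesian_product case_prod_beta)
  also have "\<dots> = (\<Sum>s\<in>?S. F (?k s))"
  proof (intro sum.mono_neutral_right ballI)
    fix s assume s: "s \<in> A \<times> X - ?S"
    then have "K * fst s \<ge> 0" "snd s \<ge> 0" using K A X by (force intro: mult_nonneg_nonneg)+
    then have "?k s > hi" using s by auto
    then show "F (?k s) = 0" by (rule Fhi)
  qed (use A X in auto)
  also have "\<dots> = (\<Sum>t\<in>{1..hi}. \<Sum>s\<in>{s\<in>?S. ?k s = t}. F (?k s))"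
    using A X by (intro sum.group[symmetric]) auto
  also have "\<dots> = (\<Sum>t\<in>{1..hi}. of_nat (card {s\<in>?S. ?k s = t}) * F t)"
    by (intro sum.cong refl) (simp add: sum_constant[symmetric] del: sum_constant)
  also have "\<dots> \<le> (\<Sum>t\<in>{1..hi}. (of_int t / of_int K + 1) * F t)"
  proof (intro sum_mono mult_right_mono F0)
    fix t assume t: "t \<in> {1..hi}"
    have "card {s\<in>?S. ?k s = t} \<le> card {0..t div K}"
    proof (rule card_inj_on_le[of fst])
      show "inj_on fst {s\<in>?S. ?k s = t}" by (auto simp: inj_on_def)
      show "fst ` {s\<in>?S. ?k s = t} \<subseteq> {0..t div K}"
      proof clarsimp
        fix a b assume s: "a \<in> A" "b \<in> X" "t = K * a + b + 1"
        then have "K * a div K \<le> (K * a + b + 1) div K" using X K by (intro zdiv_mono1) auto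
        then show "0 \<le> a \<and> a \<le> (K * a + b + 1) div K" using K s A by auto
      qed
    qed simp
    also have "\<dots> = nat (t div K + 1)" by simp
    finally have "real (card {s\<in>?S. ?k s = t}) \<le> real (nat (t div K + 1))" by (rule of_nat_mono)
    also have "\<dots> = of_int (t div K) + 1" using t K by (simp add: pos_imp_zdiv_nonneg_iff)
    also have "of_int (t div K) \<le> of_int t / (of_int K :: real)" by (rule real_of_int_div4)
    finally show "real (card {s\<in>?S. ?k s = t}) \<le> of_int t / of_int K + 1" by simp
  qed
  finally show ?thesis .
qed

locale log_cutoff =
  fixes lo hi :: int
  assumes lo: "lo \<ge> 0" and lo_hi: "lo < hi"
begin

abbreviation "H \<equiv> log_mass lo hi"
abbreviation "\<delta> \<equiv> log_step lo hi"
abbreviation "v \<equiv> log_profile lo hi"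

lemma mass_pos: "H > 0"
  unfolding log_mass_def using lo lo_hi by (intro sum_pos) auto

lemma step_nonneg: "\<delta> t \<ge> 0"
  using lo mass_pos by (auto simp: log_step_def)

lemma step_eq_0: "t > hi \<Longrightarrow> \<delta> t = 0" "t \<le> lo \<Longrightarrow> \<delta> t = 0" by (auto simp: log_step_def)

lemma sum_step: "(\<Sum>t\<in>{lo<..hi}. \<delta> t) = 1"
proof -
  have "(\<Sum>t\<in>{lo<..hi}. \<delta> t) = (\<Sum>t\<in>{lo<..hi}. (1 / of_int t) / H)"
    by (intro sum.cong) (auto simp: log_step_def)
  also have "\<dots> = H / H" by (simp only: log_mass_def sum_divide_distrib)
  finally show ?thesis using mass_pos by simp
qed

lemma sum_step_from_1: "(\<Sum>t\<in>{1..hi}. \<delta> t) = 1"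
  unfolding sum_step[symmetric] using lo by (intro sum.mono_neutral_right) (auto simp: step_eq_0)

lemma profile_nonneg: "v n \<ge> 0"
  unfolding log_profile_def by (intro sum_nonneg step_nonneg)

lemma profile_eq_0: "n \<ge> hi \<Longrightarrow> v n = 0" by (simp add: log_profile_def)

lemma profile_eq_1: "n \<le> lo \<Longrightarrow> v n = 1"
  unfolding log_profile_def sum_step[symmetric] by (intro sum.mono_neutral_right) (auto simp: step_eq_0)

lemma profile_step: "v (n - 1) = v n + \<delta> n"
proof (cases "n \<le> hi")
  case True
  then have "{n-1<..hi} = insert n {n<..hi}" by auto
  then show ?thesis by (simp add: log_profile_def)
qed (auto simp: profile_eq_0 step_eq_0)

lemma profile_step': "v n - v (n + 1) = \<delta> (n + 1)"
  using profile_step[of "n + 1"] by simp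

lemma profile_le_1: "v n \<le> 1"
proof -
  have "v n \<le> (\<Sum>t\<in>{min n lo<..hi}. \<delta> t)"
    unfolding log_profile_def by (intro sum_mono2 step_nonneg) auto
  also have "\<dots> = 1" using profile_eq_1[of "min n lo"] by (simp add: log_profile_def)
  finally show ?thesis .
qed

lemma profile_square_le_1: "(v n)\<^sup>2 \<le> 1"
  using profile_nonneg profile_le_1 by (simp add: power_le_one)

lemma profile_diff: "v n - v (n + int k) = (\<Sum>s\<in>{1..k}. \<delta> (n + int s))"
proof (induction k)
  case (Suc k)
  then show ?case using profile_step'[of "n + int k"] by (simp add: ac_simps)
qed simp

lemma mult_step: "of_int t * (\<delta> t)\<^sup>2 = \<delta> t / H"
  using lo mass_pos by (auto simp: log_step_def power2_eq_square)

text \<open>The planar Dirichlet energy of the cutoff: \<open>t * \<delta> t\<close> is constant on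
  the support and \<open>\<delta>\<close> has total mass 1. Every logarithmic gain goes back to this
  identity.\<close>

lemma sum_mult_step: "(\<Sum>t\<in>{1..hi}. of_int t * (\<delta> t)\<^sup>2) = 1 / H"
  by (simp add: mult_step sum_divide_distrib[symmetric] sum_step_from_1)

lemma step_le: "\<delta> t \<le> 1 / (of_int (lo + 1) * H)"
proof (cases "lo < t \<and> t \<le> hi")
  case True
  then show ?thesis using lo mass_pos unfolding log_step_def
    by (auto intro!: divide_left_mono mult_right_mono mult_pos_pos)
qed (use lo mass_pos in \<open>auto simp: log_step_def\<close>)

lemma sum_step_square: "(\<Sum>t\<in>{1..hi}. (\<delta> t)\<^sup>2) \<le> 1 / (of_int (lo + 1) * H)"
proof -
  have "(\<Sum>t\<in>{1..hi}. (\<delta> t)\<^sup>2) \<le> (\<Sum>t\<in>{1..hi}. 1 / (of_int (lo + 1) * H) * \<delta> t)"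
    unfolding power2_eq_square by (intro sum_mono mult_right_mono step_le step_nonneg)
  then show ?thesis by (simp only: sum_distrib_left[symmetric] sum_step_from_1 mult_1_right)
qed

lemma step_antimono: "lo < s \<Longrightarrow> s \<le> t \<Longrightarrow> \<delta> t \<le> \<delta> s"
  using lo mass_pos by (auto simp: log_step_def intro!: divide_left_mono mult_right_mono mult_pos_pos)

lemma mult_step_le: "t \<ge> 0 \<Longrightarrow> t \<le> s \<Longrightarrow> of_int t * \<delta> s \<le> 1 / H"
  using lo mass_pos by (auto simp: log_step_def divide_simps mult_right_mono)

text \<open>\<open>\<delta>\<close> jumps up once, after \<open>lo\<close>, and decreases from then
  on, so its variation is twice its maximum \<open>\<delta> (lo + 1)\<close>.\<close>

lemma total_variation_step: "(\<Sum>t\<in>{1..hi}. \<bar>\<delta> t - \<delta> (t + 1)\<bar>) \<le> 2 / (of_int (lo + 1) * H)"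
proof -
  \<comment> \<open>Starting at 0 keeps the jump inside the range also when
    \<open>lo = 0\<close>.\<close>
  have "(\<Sum>t\<in>{1..hi}. \<bar>\<delta> t - \<delta> (t + 1)\<bar>) \<le> (\<Sum>t\<in>{0..hi}. \<bar>\<delta> t - \<delta> (t + 1)\<bar>)"
    by (intro sum_mono2) auto
  also have "{0..hi} = {0..lo} \<union> {lo<..hi}" using lo lo_hi by auto
  also have "(\<Sum>t\<in>{0..lo} \<union> {lo<..hi}. \<bar>\<delta> t - \<delta> (t + 1)\<bar>) = (\<Sum>t\<in>{0..lo}. \<bar>\<delta> t - \<delta> (t + 1)\<bar>) + (\<Sum>t\<in>{lo<..hi}. \<bar>\<delta> t - \<delta> (t + 1)\<bar>)"
    by (intro sum.union_disjoint) auto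
  also have "(\<Sum>t\<in>{0..lo}. \<bar>\<delta> t - \<delta> (t + 1)\<bar>) = (\<Sum>t\<in>{lo}. \<bar>\<delta> t - \<delta> (t + 1)\<bar>)"
    using lo by (intro sum.mono_neutral_right) (auto simp: step_eq_0)
  also have "(\<Sum>t\<in>{lo<..hi}. \<bar>\<delta> t - \<delta> (t + 1)\<bar>) = (\<Sum>t\<in>{lo<..hi}. \<delta> t - \<delta> (t + 1))"
    by (intro sum.cong refl) (simp add: step_antimono)
  also have "(\<Sum>t\<in>{lo<..hi}. \<delta> t - \<delta> (t + 1)) = \<delta> (lo + 1)"
  proof -
    have "(\<Sum>t\<in>{lo<..hi}. \<delta> (t + 1)) = (\<Sum>t\<in>{lo+1<..hi+1}. \<delta> t)"
      by (rule sum.reindex_bij_witness[of _ "\<lambda>t. t - 1" "\<lambda>t. t + 1"]) auto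
    also have "\<dots> = (\<Sum>t\<in>{lo+1<..hi}. \<delta> t)"
      by (intro sum.mono_neutral_right) (auto simp: step_eq_0)
    moreover have "{lo<..hi} = insert (lo+1) {lo+1<..hi}" using lo_hi by auto
    ultimately show ?thesis by (simp add: sum_subtractf)
  qed
  finally show ?thesis using step_le[of "lo + 1"] step_nonneg[of "lo+1"] by (simp add: step_eq_0)
qed

lemma sum_abs_step_diff: "(\<Sum>t\<in>{1..hi}. \<bar>\<delta> t - \<delta> (t + int k)\<bar>) \<le> real k * (2 / (of_int (lo + 1) * H))"
proof (induction k)
  case (Suc k)
  have "(\<Sum>t\<in>{1..hi}. \<bar>\<delta> t - \<delta> (t + int (Suc k))\<bar>)
     \<le> (\<Sum>t\<in>{1..hi}. \<bar>\<delta> t - \<delta> (t + int k)\<bar> + \<bar>\<delta> (t + int k) - \<delta> (t + int k + 1)\<bar>)"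
    by (intro sum_mono) (simp add: ac_simps)
  also have "\<dots> = (\<Sum>t\<in>{1..hi}. \<bar>\<delta> t - \<delta> (t + int k)\<bar>) + (\<Sum>t\<in>{1..hi}. \<bar>\<delta> (t + int k) - \<delta> (t + int k + 1)\<bar>)"
    by (rule sum.distrib)
  also have "(\<Sum>t\<in>{1..hi}. \<bar>\<delta> (t + int k) - \<delta> (t + int k + 1)\<bar>) = (\<Sum>t\<in>{1+int k..hi+int k}. \<bar>\<delta> t - \<delta> (t + 1)\<bar>)"
    by (rule sum.reindex_bij_witness[of _ "\<lambda>t. t - int k" "\<lambda>t. t + int k"]) auto
  also have "\<dots> \<le> (\<Sum>t\<in>{1..hi+int k}. \<bar>\<delta> t - \<delta> (t + 1)\<bar>)" by (intro sum_mono2) auto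
  also have "\<dots> = (\<Sum>t\<in>{1..hi}. \<bar>\<delta> t - \<delta> (t + 1)\<bar>)"
    by (intro sum.mono_neutral_right) (auto simp: step_eq_0)
  also have "\<dots> \<le> 2 / (of_int (lo + 1) * H)" by (rule total_variation_step)
  finally show ?case using Suc by (simp add: algebra_simps add_divide_distrib)
qed simp

text \<open>One of the two factors is bounded pointwise by \<open>1 / H\<close> after multiplication
  by \<open>t\<close>, the other one is summed through the variation. The extra factor
  \<open>1 / (lo + 1)\<close> makes second differences of the profile negligible against first
  ones.\<close>

lemma sum_step_diff_square:
  "(\<Sum>t\<in>{1..hi}. of_int t * (\<delta> t - \<delta> (t + int k))\<^sup>2) \<le> 2 * real k / (of_int (lo + 1) * H\<^sup>2)"
proof -
  have "(\<Sum>t\<in>{1..hi}. of_int t * (\<delta> t - \<delta> (t + int k))\<^sup>2) \<le> (\<Sum>t\<in>{1..hi}. 1 / H * \<bar>\<delta> t - \<delta> (t + int k)\<bar>)"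
  proof (intro sum_mono)
    fix t assume t: "t \<in> {1..hi}"
    have "of_int t * \<bar>\<delta> t - \<delta> (t + int k)\<bar> = \<bar>of_int t * \<delta> t - of_int t * \<delta> (t + int k)\<bar>"
      using t by (simp add: right_diff_distrib[symmetric] abs_mult)
    also have "\<dots> \<le> 1 / H"
      using mult_step_le[of t t] mult_step_le[of t "t + int k"] t step_nonneg[of t] step_nonneg[of "t + int k"]
      by (auto simp: abs_le_iff intro: order_trans[OF _ order_trans])
        (smt (verit) mult_nonneg_nonneg of_int_nonneg)+
    finally have "of_int t * \<bar>\<delta> t - \<delta> (t + int k)\<bar> * \<bar>\<delta> t - \<delta> (t + int k)\<bar> \<le> 1 / H * \<bar>\<delta> t - \<delta> (t + int k)\<bar>"
      by (rule mult_right_mono) simp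
    then show "of_int t * (\<delta> t - \<delta> (t + int k))\<^sup>2 \<le> 1 / H * \<bar>\<delta> t - \<delta> (t + int k)\<bar>"
      by (simp add: power2_eq_square mult.assoc abs_mult_self_eq)
  qed
  also have "\<dots> \<le> 1 / H * (real k * (2 / (of_int (lo + 1) * H)))"
    unfolding sum_distrib_left[symmetric] using mass_pos by (intro mult_left_mono sum_abs_step_diff) simp
  also have "\<dots> = 2 * real k / (of_int (lo + 1) * H\<^sup>2)" by (simp add: power2_eq_square mult_ac)
  finally show ?thesis .
qed

lemma sum_cone_step_square:
  assumes "finite A" "A \<subseteq> {1..}" "finite X"
  shows "(\<Sum>a\<in>A. \<Sum>x\<in>X. (\<delta> (a + \<bar>x\<bar>))\<^sup>2) \<le> 2 / H"
proof -
  have "(\<Sum>a\<in>A. \<Sum>x\<in>X. (\<delta> (a + \<bar>x\<bar>))\<^sup>2) \<le> (\<Sum>t\<in>{1..hi}. 2 * of_int t * (\<delta> t)\<^sup>2)"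
    by (rule sum_cone_le) (use assms in \<open>auto simp: step_eq_0\<close>)
  also have "\<dots> = 2 / H"
    unfolding mult.assoc sum_distrib_left[symmetric] sum_mult_step by simp
  finally show ?thesis .
qed

end

lemma sum_by_parts_int:
  fixes c F :: "int \<Rightarrow> real"
  shows "(\<Sum>a\<in>{1..int n}. c a * (F a - F (a - 1)))
    = (\<Sum>a\<in>{1..int n}. (c a - c (a + 1)) * F a) - c 1 * F 0 + c (int n + 1) * F (int n)"
proof (induction n)
  case (Suc n)
  have "{1..int (Suc n)} = insert (int n + 1) {1..int n}" by auto
  then show ?case using Suc by (simp add: algebra_simps)
qed simp

section \<open>Translations of linear forms and primitives of pair products\<close>

context window
begin

lemma sum_window_shift:
  fixes c f :: "int \<Rightarrow> real"
  assumes "c (-N) = 0" "c (N + 1) = 0"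
  shows "(\<Sum>x\<in>W. c x * f (x - 1)) = (\<Sum>x\<in>W. c (x + 1) * f x)"
proof -
  have "(\<Sum>x\<in>W. c x * f (x - 1)) = (\<Sum>x\<in>{-N-1..N-1}. c (x + 1) * f x)"
    by (rule sum.reindex_bij_witness[of _ "\<lambda>x. x + 1" "\<lambda>x. x - 1"]) auto
  also have "\<dots> = (\<Sum>x\<in>{-N..N-1}. c (x + 1) * f x)"
  proof (rule sum.mono_neutral_right)
    show "\<forall>x\<in>{-N-1..N-1} - {-N..N-1}. c (x + 1) * f x = 0"
    proof
      fix x assume "x \<in> {-N-1..N-1} - {-N..N-1}"
      then have "x + 1 = - N" by auto
      then show "c (x + 1) * f x = 0" using assms by simp
    qed
  qed auto
  also have "\<dots> = (\<Sum>x\<in>W. c (x + 1) * f x)"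
  proof (rule sum.mono_neutral_left)
    show "\<forall>x\<in>W - {-N..N-1}. c (x + 1) * f x = 0"
    proof
      fix x assume "x \<in> W - {-N..N-1}"
      then have "x = N" by auto
      then show "c (x + 1) * f x = 0" using assms by simp
    qed
  qed auto
  finally show ?thesis .
qed

lemma lin_shift:
  assumes "c (-N) = 0" "c (N + 1) = 0"
  shows "lin c (\<lambda>x. f (x - 1)) = lin (\<lambda>x. c (x + 1)) f"
  unfolding lin_def using assms by (rule sum_window_shift)

lemma lin_diff: "lin (\<lambda>x. c x - d x) f = lin c f - lin d f"
  by (simp add: lin_def left_diff_distrib sum_subtractf)

lemma lin_single: "lin (\<lambda>x. if x = 0 then c else 0) f = c * f 0"
proof -
  have "lin (\<lambda>x. if x = 0 then c else 0) f = (\<Sum>x\<in>W. if x = 0 then c * f 0 else 0)"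
    unfolding lin_def by (intro sum.cong) auto
  then show ?thesis using N_nonneg by simp
qed

definition avg :: "int set \<Rightarrow> (int \<Rightarrow> real) \<Rightarrow> nat \<Rightarrow> (int \<Rightarrow> real) \<Rightarrow> real" where
  "avg J c n f = (\<Sum>a\<in>{1..int n}. \<Sum>j\<in>J. c j / n * (f a * f (a + j)))"

definition smear :: "int set \<Rightarrow> (int \<Rightarrow> real) \<Rightarrow> nat \<Rightarrow> (int \<Rightarrow> real) \<Rightarrow> real" where
  "smear J c n f = (\<Sum>a\<in>{1..int n}. \<Sum>j\<in>J. ((of_int a - 1) / n - 1) * c j * (f a * f (a + j)))"

text \<open>The coefficients of \<open>smear\<close> form a ramp from -1 at \<open>a = 1\<close> to
  0 at \<open>a = n + 1\<close>. In the summation by parts its slope \<open>1 / n\<close> produces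
  the average, and its value at the left end produces the products at the origin. These are so
  traded for an average of small variance.\<close>

lemma smear_diff:
  assumes n: "n \<ge> 1"
  shows "smear J c n f - smear J c n (\<lambda>x. f (x - 1)) = (\<Sum>j\<in>J. c j * (f 0 * f j)) - avg J c n f"
proof -
  let ?k = "\<lambda>a. (of_int a - 1) / real n - 1"
  have k: "?k a - ?k (a + 1) = - (1 / n)" for a by (simp add: diff_divide_distrib[symmetric])
  have "smear J c n f - smear J c n (\<lambda>x. f (x - 1))
      = (\<Sum>a\<in>{1..int n}. \<Sum>j\<in>J. c j * (?k a * (f a * f (a + j) - f (a - 1) * f (a - 1 + j))))"
    unfolding smear_def sum_subtractf[symmetric]
    by (intro sum.cong refl) (simp add: algebra_simps)
  also have "\<dots> = (\<Sum>j\<in>J. c j * (\<Sum>a\<in>{1..int n}. ?k a * (f a * f (a + j) - f (a - 1) * f (a - 1 + j))))"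
    by (subst sum.swap) (simp add: sum_distrib_left)
  also have "\<dots> = (\<Sum>j\<in>J. c j * ((\<Sum>a\<in>{1..int n}. - (1 / n) * (f a * f (a + j))) + f 0 * f j))"
  proof (intro sum.cong refl arg_cong[where f = "\<lambda>x. _ * x"])
    fix j
    show "(\<Sum>a\<in>{1..int n}. ?k a * (f a * f (a + j) - f (a - 1) * f (a - 1 + j)))
      = (\<Sum>a\<in>{1..int n}. - (1 / n) * (f a * f (a + j))) + f 0 * f j"
      using sum_by_parts_int[of ?k "\<lambda>a. f a * f (a + j)" n] n unfolding k by simp
  qed
  also have "\<dots> = (\<Sum>j\<in>J. c j * (f 0 * f j)) - avg J c n f"
  proof -
    have "avg J c n f = (\<Sum>j\<in>J. c j * (\<Sum>a\<in>{1..int n}. 1 / n * (f a * f (a + j))))"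
      unfolding avg_def by (subst sum.swap) (simp add: sum_distrib_left)
    then show ?thesis by (simp add: distrib_left sum.distrib sum_negf right_diff_distrib sum_subtractf)
  qed
  finally show ?thesis .
qed

end

section \<open>The test functions\<close>

locale corrector = window Q N for Q N +
  fixes K r m m' :: nat and R0 R :: int
  assumes K: "K \<ge> 1" and r: "r \<ge> 1" and m: "m \<ge> 1" and m': "m' \<ge> 1"
    and R0: "R0 \<ge> 1" and R0_R: "R0 < R"
    and N_rows: "N \<ge> int m + R + 3 + int r" and N_columns: "N \<ge> R + int m' + 2 * int r + 5"
begin

sublocale outer: log_cutoff R0 R using R0 R0_R by unfold_locales auto
sublocale inner: log_cutoff 0 "int r" using r by unfold_locales auto

abbreviation "v \<equiv> log_profile R0 R"
abbreviation "w \<equiv> log_profile 0 (int r)"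

text \<open>The flow is routed through columns at distance more than \<open>gap\<close>, beyond the range of \<open>M a\<close>, which makes the factors
  \<open>M a\<close> and \<open>b j\<close> independent. The flow of row \<open>j\<close> has the potential \<open>pot j\<close> and is absorbed at column \<open>x\<close> with
  intensity \<open>flux j x\<close>.\<close>

definition gap :: int where "gap = int r + 2"
definition q :: "int \<Rightarrow> int \<Rightarrow> real" where
  "q i j = v (int K * (i - 1) + \<bar>j\<bar>) - v (int K * i + \<bar>j\<bar>)"
definition flux :: "int \<Rightarrow> int \<Rightarrow> real" where
  "flux j x = (if x \<le> - 1 - gap then q (- x - gap) j else 0)"
definition pot :: "int \<Rightarrow> int \<Rightarrow> real" where
  "pot j x = (if x \<le> 0 then v (int K * max (- x - gap) 0 + \<bar>j\<bar>) else 0)"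
text \<open>Raising the level \<open>a\<close> lowers the cutoff, from its full size at
  \<open>a = 0\<close> to zero at \<open>a = r\<close>. As a function of the pair
  \<open>(a, x)\<close> it is a logarithmic cutoff in a half plane, hence cheap to vary in both
  variables.\<close>

definition mu :: "int \<Rightarrow> int \<Rightarrow> real" where "mu a x = w (a + \<bar>x\<bar>)"
definition rows :: "int set" where "rows = {-R..R} - {0}"
definition cols :: "int set" where "cols = {-int r..int r} - {0}"

abbreviation pair_form :: "(int \<Rightarrow> int \<Rightarrow> real) \<Rightarrow> (int \<Rightarrow> int \<Rightarrow> real) \<Rightarrow> (int \<Rightarrow> real) \<Rightarrow> (int \<Rightarrow> real) \<Rightarrow> real" where
  "pair_form d c \<xi> \<zeta> \<equiv> \<Sum>a\<in>{1..int r}. \<Sum>j\<in>rows. lin (d a) \<zeta> * lin (c j) \<zeta> * (\<xi> a * \<xi> (a + j))"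

definition M :: "int \<Rightarrow> (int \<Rightarrow> real) \<Rightarrow> real" where "M a = lin (mu a)"
definition b :: "int \<Rightarrow> (int \<Rightarrow> real) \<Rightarrow> real" where "b j = lin (flux j)"
definition B :: "(int \<Rightarrow> real) \<Rightarrow> (int \<Rightarrow> real) \<Rightarrow> real" where "B \<xi> \<zeta> = (\<Sum>j\<in>W. \<xi> j * b j \<zeta>)"
definition Y :: "(int \<Rightarrow> real) \<Rightarrow> real" where "Y = smear cols (\<lambda>x. w \<bar>x\<bar>) m'"
definition PZ :: "(int \<Rightarrow> real) \<Rightarrow> real" where "PZ = avg cols (\<lambda>x. w \<bar>x\<bar>) m'"
definition Psi1 :: "(int \<Rightarrow> real) \<Rightarrow> real" where "Psi1 = smear rows (\<lambda>j. v \<bar>j\<bar>) m"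
definition PX :: "(int \<Rightarrow> real) \<Rightarrow> real" where "PX = avg rows (\<lambda>j. v \<bar>j\<bar>) m"
definition Psi2 :: "(int \<Rightarrow> real) \<Rightarrow> (int \<Rightarrow> real) \<Rightarrow> real" where
  "Psi2 \<xi> \<zeta> = - form pot \<xi> \<zeta>"
definition Psi4 :: "(int \<Rightarrow> real) \<Rightarrow> (int \<Rightarrow> real) \<Rightarrow> real" where
  "Psi4 \<xi> \<zeta> = (\<Sum>a\<in>{1..int r}. \<Sum>j\<in>rows. M (a - 1) \<zeta> * b j \<zeta> * (\<xi> a * \<xi> (a + j)))"
definition G1 :: "(int \<Rightarrow> real) \<Rightarrow> real" where "G1 \<xi> = (\<Sum>j\<in>W. v \<bar>j\<bar> * \<xi> j)"

text \<open>\<open>Psi1\<close> removes the pair products in \<open>\<xi> 0 * G1 \<xi>\<close>, \<open>Psi2\<close> turns \<open>\<zeta> 0 * G1 \<xi>\<close> into \<open>B \<xi> \<zeta>\<close>, \<open>Y * B\<close>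
  replaces \<open>B\<close> by \<open>\<zeta> 0 * M 0 \<zeta> * B\<close>, which \<open>g\<close> compensates, and \<open>Psi4\<close> repairs the effect of this change of \<open>g\<close> on the
  first residual.\<close>

fun Psi :: "lines \<Rightarrow> real" where
  "Psi (\<xi>, \<zeta>) = Psi1 \<xi> + Psi2 \<xi> \<zeta> + Y \<zeta> * B \<xi> \<zeta> + Psi4 \<xi> \<zeta>"
fun g :: "lines \<Rightarrow> real" where
  "g (\<xi>, \<zeta>) = G1 \<xi> - M 0 \<zeta> * B \<xi> \<zeta>"

lemma q_eq_sum: "q i j = (\<Sum>s\<in>{1..K}. log_step R0 R (int K * (i - 1) + \<bar>j\<bar> + int s))"
  unfolding q_def outer.profile_diff[symmetric] by (simp add: algebra_simps)

lemma mult_ge: "x \<ge> 0 \<Longrightarrow> int K * x \<ge> x"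
  using K mult_right_mono[of 1 "int K" x] by simp

lemma flux_eq_0: "x \<le> - R - gap - 1 \<Longrightarrow> flux j x = 0" "x \<ge> - gap \<Longrightarrow> flux j x = 0" "\<bar>j\<bar> \<ge> R \<Longrightarrow> flux j x = 0"
proof -
  show "x \<ge> - gap \<Longrightarrow> flux j x = 0" by (simp add: flux_def)
  have v0: "v (int K * a + \<bar>j\<bar>) = 0" if "a \<ge> 0" "a \<ge> R \<or> \<bar>j\<bar> \<ge> R" for a
    using mult_ge[of a] that by (intro outer.profile_eq_0) auto
  show "flux j x = 0" if "x \<le> - R - gap - 1"
    using v0[of "- x - gap - 1"] v0[of "- x - gap"] that R0 R0_R by (simp add: flux_def q_def)
  show "flux j x = 0" if "\<bar>j\<bar> \<ge> R"
    using v0[of "- x - gap - 1"] v0[of "- x - gap"] that by (simp add: flux_def q_def)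
qed

lemma pot_eq_0: "x \<le> - R - gap \<Longrightarrow> pot j x = 0" "x \<ge> 1 \<Longrightarrow> pot j x = 0" "\<bar>j\<bar> \<ge> R \<Longrightarrow> pot j x = 0"
proof -
  show "x \<ge> 1 \<Longrightarrow> pot j x = 0" by (simp add: pot_def)
  have "v (int K * max (- x - gap) 0 + \<bar>j\<bar>) = 0" if "x \<le> - R - gap \<or> \<bar>j\<bar> \<ge> R"
    using mult_ge[of "max (- x - gap) 0"] that by (intro outer.profile_eq_0) linarith
  then show "x \<le> - R - gap \<Longrightarrow> pot j x = 0" "\<bar>j\<bar> \<ge> R \<Longrightarrow> pot j x = 0"
    by (simp_all add: pot_def)
qed

lemma mu_eq_0: "a \<ge> 0 \<Longrightarrow> \<bar>x\<bar> \<ge> int r \<Longrightarrow> mu a x = 0"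
  by (simp add: mu_def inner.profile_eq_0)

text \<open>A conservation law: the charge \<open>v \<bar>j\<bar>\<close> placed at column 0 passes
  unchanged through the gap and is deposited beyond it with density \<open>flux j\<close>, whose
  total is \<open>v \<bar>j\<bar>\<close>.\<close>

lemma pot_diff: "pot j x - pot j (x + 1) = (if x = 0 then v \<bar>j\<bar> else 0) - flux j x"
proof -
  have gap: "gap \<ge> 0" by (simp add: gap_def)
  consider "x \<ge> 1" | "x = 0" | "x < 0" "x > - 1 - gap" | "x \<le> - 1 - gap" by linarith
  then show ?thesis
  proof cases
    case 4
    then have "max (- x - gap) 0 = - x - gap" "max (- x - 1 - gap) 0 = - x - 1 - gap" by auto
    then show ?thesis using 4 gap by (simp add: pot_def flux_def q_def) (simp add: algebra_simps)
  qed (use gap in \<open>auto simp: pot_def flux_def max_def\<close>)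
qed

lemma b_shift: "b j (\<lambda>x. \<zeta> (x - 1)) = lin (\<lambda>x. flux j (x + 1)) \<zeta>"
  unfolding b_def
proof (rule lin_shift)
  show "flux j (- N) = 0" "flux j (N + 1) = 0"
    using N_columns R0 R0_R by (intro flux_eq_0(1) flux_eq_0(2), simp add: gap_def)+
qed

lemma M_shift: "a \<ge> 0 \<Longrightarrow> M a (\<lambda>x. \<zeta> (x - 1)) = lin (\<lambda>x. mu a (x + 1)) \<zeta>"
  unfolding M_def using N_columns R0 R0_R by (intro lin_shift mu_eq_0) auto

lemma b_eq_0: "\<bar>j\<bar> \<ge> R \<Longrightarrow> b j \<zeta> = 0"
  by (simp add: b_def lin_def flux_eq_0)

lemma B_row_shift: "B (\<lambda>x. \<xi> (x - 1)) \<zeta> = (\<Sum>j\<in>W. \<xi> j * b (j + 1) \<zeta>)"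
  unfolding B_def using sum_window_shift[of "\<lambda>j. b j \<zeta>" \<xi>] N_rows R0 R0_R
  by (simp add: b_eq_0 mult.commute)

lemma M_top: "M (int r) \<zeta> = 0"
  by (simp add: M_def lin_def mu_def inner.profile_eq_0)

lemma Psi2_column_diff: "Psi2 \<xi> \<zeta> - Psi2 \<xi> (\<lambda>x. \<zeta> (x - 1)) = B \<xi> \<zeta> - \<zeta> 0 * G1 \<xi>"
proof -
  have "lin (pot j) (\<lambda>x. \<zeta> (x - 1)) = lin (\<lambda>x. pot j (x + 1)) \<zeta>" for j
  proof (rule lin_shift)
    show "pot j (- N) = 0" "pot j (N + 1) = 0"
      using N_columns R0 R0_R by (intro pot_eq_0(1) pot_eq_0(2), simp add: gap_def)+
  qed
  then have "lin (pot j) \<zeta> - lin (pot j) (\<lambda>x. \<zeta> (x - 1)) = v \<bar>j\<bar> * \<zeta> 0 - b j \<zeta>" for j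
    unfolding b_def using lin_diff[of "pot j" "\<lambda>x. pot j (x + 1)" \<zeta>] unfolding pot_diff lin_diff lin_single by simp
  then have "(\<Sum>j\<in>W. \<xi> j * (lin (pot j) \<zeta> - lin (pot j) (\<lambda>x. \<zeta> (x - 1)))) = (\<Sum>j\<in>W. \<xi> j * (v \<bar>j\<bar> * \<zeta> 0 - b j \<zeta>))"
    by simp
  then show ?thesis
    by (simp add: Psi2_def B_def G1_def sum_subtractf right_diff_distrib sum_distrib_left mult_ac)
qed

lemma Psi2_row_diff:
  "Psi2 \<xi> \<zeta> - Psi2 (\<lambda>x. \<xi> (x - 1)) \<zeta> = - form (\<lambda>j x. pot j x - pot (j + 1) x) \<xi> \<zeta>"
proof -
  have "lin (pot j) \<zeta> = 0" if "\<bar>j\<bar> \<ge> R" for j using that by (simp add: lin_def pot_eq_0)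
  then have "(\<Sum>j\<in>W. lin (pot j) \<zeta> * \<xi> (j - 1)) = (\<Sum>j\<in>W. lin (pot (j + 1)) \<zeta> * \<xi> j)"
    using N_rows R0 R0_R by (intro sum_window_shift) auto
  then show ?thesis
    by (simp add: Psi2_def lin_diff right_diff_distrib sum_subtractf mult.commute)
qed

text \<open>Summation by parts in the level \<open>a\<close>. The upper boundary term vanishes since
  \<open>M r = 0\<close>. The lower one is the pair part of
  \<open>\<xi> 0 * M 0 \<zeta> * B \<xi> \<zeta>\<close>, and the rest involves only increments of
  \<open>M\<close> between levels.\<close>

lemma Psi4_row_diff:
  "Psi4 \<xi> \<zeta> - Psi4 (\<lambda>x. \<xi> (x - 1)) \<zeta> =
    (\<Sum>a\<in>{1..int r}. \<Sum>j\<in>rows. (M (a - 1) \<zeta> - M a \<zeta>) * b j \<zeta> * (\<xi> a * \<xi> (a + j)))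
    - (\<Sum>j\<in>rows. M 0 \<zeta> * b j \<zeta> * (\<xi> 0 * \<xi> j))"
proof -
  have "Psi4 \<xi> \<zeta> - Psi4 (\<lambda>x. \<xi> (x - 1)) \<zeta> =
    (\<Sum>a\<in>{1..int r}. \<Sum>j\<in>rows. b j \<zeta> * (M (a - 1) \<zeta> * (\<xi> a * \<xi> (a + j) - \<xi> (a - 1) * \<xi> (a - 1 + j))))"
    unfolding Psi4_def sum_subtractf[symmetric] by (intro sum.cong refl) (simp add: algebra_simps)
  also have "\<dots> = (\<Sum>j\<in>rows. b j \<zeta> * (\<Sum>a\<in>{1..int r}. M (a - 1) \<zeta> * (\<xi> a * \<xi> (a + j) - \<xi> (a - 1) * \<xi> (a - 1 + j))))"
    by (subst sum.swap) (simp add: sum_distrib_left)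
  also have "\<dots> = (\<Sum>j\<in>rows. b j \<zeta> * ((\<Sum>a\<in>{1..int r}. (M (a - 1) \<zeta> - M a \<zeta>) * (\<xi> a * \<xi> (a + j))) - M 0 \<zeta> * (\<xi> 0 * \<xi> j)))"
  proof (intro sum.cong refl arg_cong[where f = "\<lambda>x. _ * x"])
    fix j
    show "(\<Sum>a\<in>{1..int r}. M (a - 1) \<zeta> * (\<xi> a * \<xi> (a + j) - \<xi> (a - 1) * \<xi> (a - 1 + j))) =
      (\<Sum>a\<in>{1..int r}. (M (a - 1) \<zeta> - M a \<zeta>) * (\<xi> a * \<xi> (a + j))) - M 0 \<zeta> * (\<xi> 0 * \<xi> j)"
      using sum_by_parts_int[of "\<lambda>a. M (a - 1) \<zeta>" "\<lambda>a. \<xi> a * \<xi> (a + j)" r] by (simp add: M_top)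
  qed
  also have "\<dots> = (\<Sum>j\<in>rows. \<Sum>a\<in>{1..int r}. (M (a - 1) \<zeta> - M a \<zeta>) * b j \<zeta> * (\<xi> a * \<xi> (a + j)))
      - (\<Sum>j\<in>rows. M 0 \<zeta> * b j \<zeta> * (\<xi> 0 * \<xi> j))"
    by (simp add: right_diff_distrib sum_subtractf sum_distrib_left mult_ac)
  also have "(\<Sum>j\<in>rows. \<Sum>a\<in>{1..int r}. (M (a - 1) \<zeta> - M a \<zeta>) * b j \<zeta> * (\<xi> a * \<xi> (a + j))) =
     (\<Sum>a\<in>{1..int r}. \<Sum>j\<in>rows. (M (a - 1) \<zeta> - M a \<zeta>) * b j \<zeta> * (\<xi> a * \<xi> (a + j)))"
    by (rule sum.swap)
  finally show ?thesis .
qed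

lemma sum_rows:
  assumes "\<And>j. \<bar>j\<bar> \<ge> R \<Longrightarrow> f j = (0::real)"
  shows "(\<Sum>j\<in>W. f j) = f 0 + (\<Sum>j\<in>rows. f j)"
proof -
  have "(\<Sum>j\<in>W. f j) = (\<Sum>j\<in>{-R..R}. f j)"
    using N_rows assms by (intro sum.mono_neutral_right) auto
  also have "{-R..R} = insert 0 rows" using R0 R0_R by (auto simp: rows_def)
  also have "(\<Sum>j\<in>insert 0 rows. f j) = f 0 + (\<Sum>j\<in>rows. f j)" by (rule sum.insert) (auto simp: rows_def)
  finally show ?thesis .
qed

text \<open>Singling out the column of the walker, where the weight is 1, shows that
  \<open>\<zeta> 0 * M 0 \<zeta>\<close> is 1 plus pair products, in parallel to
  \<open>\<xi> 0 * G1 \<xi>\<close> for rows.\<close>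

lemma M_zero: "M 0 \<zeta> = \<zeta> 0 + (\<Sum>x\<in>cols. w \<bar>x\<bar> * \<zeta> x)"
proof -
  have "M 0 \<zeta> = (\<Sum>x\<in>{-int r..int r}. w \<bar>x\<bar> * \<zeta> x)"
    unfolding M_def lin_def mu_def using N_columns R0 R0_R
    by (intro sum.mono_neutral_cong_right) (auto simp: inner.profile_eq_0)
  also have "{-int r..int r} = insert 0 cols" by (auto simp: cols_def)
  also have "(\<Sum>x\<in>insert 0 cols. w \<bar>x\<bar> * \<zeta> x) = w \<bar>0\<bar> * \<zeta> 0 + (\<Sum>x\<in>cols. w \<bar>x\<bar> * \<zeta> x)"
    by (rule sum.insert) (auto simp: cols_def)
  finally show ?thesis by (simp add: inner.profile_eq_1)
qed

text \<open>In \<open>\<xi> 0 * G1 \<xi>\<close> the diagonal cancels the constant 1, and the pair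
  products cancel against \<open>Psi1\<close> up to their average \<open>PX\<close>. In
  \<open>\<xi> 0 * M 0 \<zeta> * B \<xi> \<zeta>\<close> the pair products cancel against
  \<open>Psi4\<close>. Its diagonal \<open>M 0 \<zeta> * b 0 \<zeta>\<close> has no row sign left
  and stays.\<close>

lemma residual1:
  assumes "\<xi> \<in> Or"
  shows "1 + Psi (\<xi>, \<zeta>) - Psi (\<lambda>x. \<xi> (x - 1), \<zeta>) - \<xi> 0 * g (\<xi>, \<zeta>) =
    - PX \<xi> + - form (\<lambda>j x. pot j x - pot (j + 1) x) \<xi> \<zeta>
    + Y \<zeta> * form (\<lambda>j x. flux j x - flux (j + 1) x) \<xi> \<zeta>
    + (\<Sum>a\<in>{1..int r}. \<Sum>j\<in>rows. (M (a - 1) \<zeta> - M a \<zeta>) * b j \<zeta> * (\<xi> a * \<xi> (a + j)))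
    + M 0 \<zeta> * b 0 \<zeta>"
proof -
  have sq: "\<xi> 0 * \<xi> 0 = 1" "\<xi> 0 * (\<xi> 0 * x) = x" for x using assms by (simp_all add: sq_sign mult.assoc[symmetric])
  have 1: "Psi1 \<xi> - Psi1 (\<lambda>x. \<xi> (x - 1)) = (\<Sum>j\<in>rows. v \<bar>j\<bar> * (\<xi> 0 * \<xi> j)) - PX \<xi>"
    unfolding Psi1_def PX_def using m by (rule smear_diff)
  have 3: "B \<xi> \<zeta> - B (\<lambda>x. \<xi> (x - 1)) \<zeta> = form (\<lambda>j x. flux j x - flux (j + 1) x) \<xi> \<zeta>"
    unfolding B_row_shift by (simp add: B_def b_def lin_diff right_diff_distrib sum_subtractf)
  have "G1 \<xi> = \<xi> 0 + (\<Sum>j\<in>rows. v \<bar>j\<bar> * \<xi> j)"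
    unfolding G1_def using R0 by (subst sum_rows) (auto simp: outer.profile_eq_0 outer.profile_eq_1)
  then have g1: "\<xi> 0 * G1 \<xi> = 1 + (\<Sum>j\<in>rows. v \<bar>j\<bar> * (\<xi> 0 * \<xi> j))"
    by (simp add: distrib_left sq sum_distrib_left mult_ac)
  have "B \<xi> \<zeta> = \<xi> 0 * b 0 \<zeta> + (\<Sum>j\<in>rows. \<xi> j * b j \<zeta>)"
    unfolding B_def by (subst sum_rows) (auto simp: b_eq_0)
  then have g2: "\<xi> 0 * (M 0 \<zeta> * B \<xi> \<zeta>) = M 0 \<zeta> * b 0 \<zeta> + (\<Sum>j\<in>rows. M 0 \<zeta> * b j \<zeta> * (\<xi> 0 * \<xi> j))"
    using sq(2)[of "M 0 \<zeta> * b 0 \<zeta>"] by (simp add: distrib_left sum_distrib_left mult_ac)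
  show ?thesis
    using 1 Psi2_row_diff[of \<xi> \<zeta>] 3 Psi4_row_diff[of \<xi> \<zeta>] g1 g2
    by (simp add: right_diff_distrib) (simp add: algebra_simps)
qed

lemma Psi4_column_diff:
  "Psi4 \<xi> \<zeta> - Psi4 \<xi> (\<lambda>x. \<zeta> (x - 1)) =
    pair_form (\<lambda>a x. mu (a - 1) x - mu (a - 1) (x + 1)) flux \<xi> \<zeta>
    + pair_form (\<lambda>a x. mu (a - 1) (x + 1)) (\<lambda>j x. flux j x - flux j (x + 1)) \<xi> \<zeta>"
  unfolding Psi4_def sum_subtractf[symmetric] sum.distrib[symmetric]
  by (intro sum.cong refl) (simp add: M_shift b_shift lin_diff, simp add: M_def b_def algebra_simps)

text \<open>Up to \<open>PZ\<close>, the column difference of \<open>Y\<close> is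
  \<open>\<zeta> 0 * M 0 \<zeta> - 1\<close>. The product rule for \<open>Y * B\<close> therefore
  cancels both the \<open>B\<close> left by \<open>Psi2\<close> and the term
  \<open>\<zeta> 0 * M 0 \<zeta> * B\<close> of \<open>g\<close>. What remains contains
  \<open>PZ\<close>, an increment of the flux, or an increment of \<open>mu\<close>.\<close>

lemma residual2:
  assumes "\<zeta> \<in> Or"
  shows "Psi (\<xi>, \<zeta>) - Psi (\<xi>, \<lambda>x. \<zeta> (x - 1)) + \<zeta> 0 * g (\<xi>, \<zeta>) =
    - (PZ \<zeta> * form flux \<xi> \<zeta>)
    + Y (\<lambda>x. \<zeta> (x - 1)) * form (\<lambda>j x. flux j x - flux j (x + 1)) \<xi> \<zeta>
    + pair_form (\<lambda>a x. mu (a - 1) x - mu (a - 1) (x + 1)) flux \<xi> \<zeta>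
    + pair_form (\<lambda>a x. mu (a - 1) (x + 1)) (\<lambda>j x. flux j x - flux j (x + 1)) \<xi> \<zeta>"
proof -
  have sq: "\<zeta> 0 * \<zeta> 0 = 1" using assms by (simp add: sq_sign)
  have "Y \<zeta> - Y (\<lambda>x. \<zeta> (x - 1)) = (\<Sum>x\<in>cols. w \<bar>x\<bar> * (\<zeta> 0 * \<zeta> x)) - PZ \<zeta>"
    unfolding Y_def PZ_def using m' by (rule smear_diff)
  also have "(\<Sum>x\<in>cols. w \<bar>x\<bar> * (\<zeta> 0 * \<zeta> x)) = \<zeta> 0 * M 0 \<zeta> - 1"
    by (simp add: M_zero distrib_left sq sum_distrib_left mult_ac)
  finally have y: "Y \<zeta> = Y (\<lambda>x. \<zeta> (x - 1)) + \<zeta> 0 * M 0 \<zeta> - 1 - PZ \<zeta>" by simp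
  have B': "B \<xi> (\<lambda>x. \<zeta> (x - 1)) = B \<xi> \<zeta> - form (\<lambda>j x. flux j x - flux j (x + 1)) \<xi> \<zeta>"
    by (simp add: B_def b_shift lin_diff right_diff_distrib sum_subtractf) (simp add: b_def)
  have "Y \<zeta> * B \<xi> \<zeta> - Y (\<lambda>x. \<zeta> (x - 1)) * B \<xi> (\<lambda>x. \<zeta> (x - 1)) =
    Y (\<lambda>x. \<zeta> (x - 1)) * form (\<lambda>j x. flux j x - flux j (x + 1)) \<xi> \<zeta>
    + \<zeta> 0 * (M 0 \<zeta> * B \<xi> \<zeta>) - B \<xi> \<zeta> - PZ \<zeta> * B \<xi> \<zeta>"
    unfolding y B' by (simp add: algebra_simps)
  moreover have "B \<xi> \<zeta> = form flux \<xi> \<zeta>" by (simp add: B_def b_def)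
  ultimately show ?thesis
    using Psi2_column_diff[of \<xi> \<zeta>] Psi4_column_diff[of \<xi> \<zeta>]
    by (simp add: right_diff_distrib)
qed

lemma g_column_diff:
  "g (\<xi>, \<zeta>) - g (\<xi>, \<lambda>x. \<zeta> (x - 1)) =
    - (lin (\<lambda>x. mu 0 x - mu 0 (x + 1)) \<zeta> * form flux \<xi> \<zeta>)
    + - (lin (\<lambda>x. mu 0 (x + 1)) \<zeta> * form (\<lambda>j x. flux j x - flux j (x + 1)) \<xi> \<zeta>)"
  by (simp add: B_def b_shift M_shift lin_diff right_diff_distrib sum_subtractf)
     (simp add: M_def b_def algebra_simps)

lemma g_row_diff:
  "g (\<xi>, \<zeta>) - g (\<lambda>x. \<xi> (x - 1), \<zeta>) =
    (\<Sum>j\<in>W. (v \<bar>j\<bar> - v \<bar>j + 1\<bar>) * \<xi> j)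
    + - (M 0 \<zeta> * form (\<lambda>j x. flux j x - flux (j + 1) x) \<xi> \<zeta>)"
proof -
  have "G1 (\<lambda>x. \<xi> (x - 1)) = (\<Sum>j\<in>W. v \<bar>j + 1\<bar> * \<xi> j)"
    unfolding G1_def using N_rows R0 R0_R by (intro sum_window_shift outer.profile_eq_0) auto
  then show ?thesis
    by (simp add: B_row_shift lin_diff right_diff_distrib left_diff_distrib sum_subtractf)
       (simp add: G1_def B_def b_def algebra_simps)
qed

end

section \<open>Norms of the residuals\<close>

context periodic
begin

lemma shift_in_orientations:
  assumes "f \<in> Or" shows "(\<lambda>x. f (x + k)) \<in> Or"
proof -
  have "f (a + Q + k) = f (a + k)" for a
    using assms by (simp add: orientations_def) (metis add.assoc add.commute)
  then show ?thesis using assms by (auto simp: orientations_def)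
qed

lemma mean_shift: "mean (\<lambda>f. h (\<lambda>x. f (x - 1))) = mean h"
proof -
  have "(\<Sum>f\<in>Or. h (\<lambda>x. f (x - 1))) = sum h Or"
    by (rule sum.reindex_bij_witness[of _ "\<lambda>f x. f (x + 1)" "\<lambda>f x. f (x - 1)"])
       (use shift_in_orientations[of _ "-1"] shift_in_orientations[of _ 1] in auto)
  then show ?thesis by (simp add: mean_def)
qed

end

context window
begin

lemma L2_set_eq_nrm: "L2_set F (Or \<times> Or) = card Or * nrm F"
proof -
  have "sqrt (\<Sum>\<omega>\<in>Or \<times> Or. (F \<omega>)\<^sup>2) = sqrt ((card Or)\<^sup>2 * mean2 (\<lambda>\<omega>. (F \<omega>)\<^sup>2))"
    using card_orientations_pos by (simp add: mean2_eq)
  then show ?thesis by (simp add: L2_set_def nrm_def real_sqrt_mult)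
qed

lemma nrm_eq_L2_set: "nrm F = L2_set F (Or \<times> Or) / card Or"
  using card_orientations_pos by (simp add: L2_set_eq_nrm)

lemma nrm_triangle: "nrm (\<lambda>\<omega>. F \<omega> + G \<omega>) \<le> nrm F + nrm G"
  unfolding nrm_eq_L2_set add_divide_distrib[symmetric]
  by (intro divide_right_mono L2_set_triangle_ineq) simp

lemma nrm_minus: "nrm (\<lambda>\<omega>. - F \<omega>) = nrm F" by (simp add: nrm_def)

lemma nrm_cong: "(\<And>\<xi> \<zeta>. \<xi> \<in> Or \<Longrightarrow> \<zeta> \<in> Or \<Longrightarrow> F (\<xi>, \<zeta>) = G (\<xi>, \<zeta>)) \<Longrightarrow> nrm F = nrm G"
  unfolding nrm_def mean2_def by (intro arg_cong[where f = sqrt] mean_cong) simp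

text \<open>Averaging over the rows first removes the cross terms in \<open>j\<close>. The weight
  then factors out, provided it does not read the columns where \<open>c\<close> lives.\<close>

lemma mean_square_form:
  assumes h: "\<And>a j f. a \<in> W \<Longrightarrow> j \<in> W \<Longrightarrow> c j a \<noteq> 0 \<Longrightarrow> f \<in> Or \<Longrightarrow> h (flip a f) = h f"
  shows "mean2 (\<lambda>\<omega>. (h (snd \<omega>) * form c (fst \<omega>) (snd \<omega>))\<^sup>2)
    = mean (\<lambda>\<zeta>. (h \<zeta>)\<^sup>2) * square_sum c"
proof -
  have "mean (\<lambda>\<xi>. (h \<zeta> * form c \<xi> \<zeta>)\<^sup>2) = (\<Sum>j\<in>W. (lin (c j) \<zeta>)\<^sup>2 * (h \<zeta>)\<^sup>2)" for \<zeta>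
    using mean_square_lin1[of "\<lambda>j. h \<zeta> * lin (c j) \<zeta>"]
    by (simp add: lin_def[of "\<lambda>j. h \<zeta> * lin (c j) \<zeta>"] sum_distrib_left power_mult_distrib mult_ac)
  then have "mean2 (\<lambda>\<omega>. (h (snd \<omega>) * form c (fst \<omega>) (snd \<omega>))\<^sup>2)
    = (\<Sum>j\<in>W. mean (\<lambda>\<zeta>. (lin (c j) \<zeta>)\<^sup>2 * (h \<zeta>)\<^sup>2))"
    by (simp add: mean2_def mean_sum)
  also have "\<dots> = (\<Sum>j\<in>W. (\<Sum>x\<in>W. (c j x)\<^sup>2) * mean (\<lambda>\<zeta>. (h \<zeta>)\<^sup>2))"
    by (intro sum.cong refl mean_square_lin) (use h in auto)
  finally show ?thesis unfolding sum_distrib_right[symmetric] by (simp add: mult.commute)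
qed

text \<open>For fixed columns this is a sum of row pairs, orthogonal up to the factor 2. The
  coefficients then factorise because the two linear forms read disjoint columns.\<close>

lemma mean_square_pair_form:
  assumes fin: "finite A" "finite J" and nz: "0 \<notin> J"
    and AJ: "\<And>a. a \<in> A \<Longrightarrow> a \<in> W" "\<And>a j. a \<in> A \<Longrightarrow> j \<in> J \<Longrightarrow> a + j \<in> W"
    and disj: "\<And>a j x. a \<in> A \<Longrightarrow> j \<in> J \<Longrightarrow> x \<in> W \<Longrightarrow> c a x \<noteq> 0 \<Longrightarrow> d j x = 0"
  shows "mean2 (\<lambda>\<omega>. (\<Sum>a\<in>A. \<Sum>j\<in>J. lin (c a) (snd \<omega>) * lin (d j) (snd \<omega>) * (fst \<omega> a * fst \<omega> (a + j)))\<^sup>2)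
    \<le> 2 * (\<Sum>a\<in>A. \<Sum>x\<in>W. (c a x)\<^sup>2) * (\<Sum>j\<in>J. \<Sum>x\<in>W. (d j x)\<^sup>2)"
proof -
  have "mean2 (\<lambda>\<omega>. (\<Sum>a\<in>A. \<Sum>j\<in>J. lin (c a) (snd \<omega>) * lin (d j) (snd \<omega>) * (fst \<omega> a * fst \<omega> (a + j)))\<^sup>2)
    \<le> mean (\<lambda>\<zeta>. 2 * (\<Sum>a\<in>A. \<Sum>j\<in>J. (lin (c a) \<zeta> * lin (d j) \<zeta>)\<^sup>2))"
    unfolding mean2_def fst_conv snd_conv
    by (intro mean_mono mean_square_pairs_le fin nz AJ)
  also have "\<dots> = 2 * (\<Sum>a\<in>A. \<Sum>j\<in>J. mean (\<lambda>\<zeta>. (lin (c a) \<zeta>)\<^sup>2 * (lin (d j) \<zeta>)\<^sup>2))"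
    by (simp add: mean_cmult mean_sum power_mult_distrib)
  also have "\<dots> = 2 * (\<Sum>a\<in>A. \<Sum>j\<in>J. (\<Sum>x\<in>W. (c a x)\<^sup>2) * (\<Sum>x\<in>W. (d j x)\<^sup>2))"
    unfolding mean_square_lin1[symmetric, of "d _"]
    by (intro arg_cong[where f = "\<lambda>x. 2 * x"] sum.cong refl mean_square_lin arg_cong[where f = "\<lambda>x. x\<^sup>2"] lin_flip)
       (use disj in auto)
  also have "\<dots> = 2 * (\<Sum>a\<in>A. \<Sum>x\<in>W. (c a x)\<^sup>2) * (\<Sum>j\<in>J. \<Sum>x\<in>W. (d j x)\<^sup>2)"
    by (simp add: sum_product)
  finally show ?thesis .
qed

text \<open>There are \<open>n * card J\<close> nearly orthogonal terms, of square at most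
  \<open>n ^ (-2)\<close> in \<open>avg\<close> and at most 1 in \<open>smear\<close>. A long smear
  buys a small average at the price of a large primitive.\<close>

lemma mean_square_avg_le:
  assumes J: "finite J" "0 \<notin> J" "\<And>j. j \<in> J \<Longrightarrow> \<bar>j\<bar> \<le> k" and n: "int n + k \<le> N" "n \<ge> 1" "k \<ge> 0"
    and c: "\<And>j. (c j)\<^sup>2 \<le> 1"
  shows "mean (\<lambda>f. (avg J c n f)\<^sup>2) \<le> 2 * card J / n" "mean (\<lambda>f. (smear J c n f)\<^sup>2) \<le> 2 * (n * card J)"
proof -
  have W: "a \<in> W" "a + j \<in> W" if "a \<in> {1..int n}" "j \<in> J" for a j
    using that J(3)[of j] n by auto
  have W': "a \<in> W" if "a \<in> {1..int n}" for a using that n by auto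
  have "mean (\<lambda>f. (avg J c n f)\<^sup>2) \<le> 2 * (\<Sum>a\<in>{1..int n}. \<Sum>j\<in>J. (c j / n)\<^sup>2)"
    unfolding avg_def by (intro mean_square_pairs_le J W W') auto
  also have "\<dots> \<le> 2 * (\<Sum>a\<in>{1..int n}. \<Sum>j\<in>J. (1 / n)\<^sup>2)"
    using c by (intro mult_left_mono sum_mono) (auto simp: power_divide divide_right_mono)
  also have "\<dots> = 2 * card J / n" using n by (simp add: power2_eq_square field_simps)
  finally show "mean (\<lambda>f. (avg J c n f)\<^sup>2) \<le> 2 * card J / n" .
  have "mean (\<lambda>f. (smear J c n f)\<^sup>2) \<le> 2 * (\<Sum>a\<in>{1..int n}. \<Sum>j\<in>J. (((of_int a - 1) / n - 1) * c j)\<^sup>2)"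
    unfolding smear_def by (intro mean_square_pairs_le J W W') auto
  also have "\<dots> \<le> 2 * (\<Sum>a\<in>{1..int n}. \<Sum>j\<in>J. 1)"
  proof (intro mult_left_mono sum_mono)
    fix a j assume a: "a \<in> {1..int n}"
    then have "0 \<le> (of_int a - 1) / real n" "(of_int a - 1) / real n \<le> 1" using n by auto
    then have "\<bar>(of_int a - 1) / real n - 1\<bar> \<le> 1" by (simp add: abs_le_iff)
    then have "((of_int a - 1) / real n - 1)\<^sup>2 \<le> 1" by (simp add: abs_square_le_1)
    then show "(((of_int a - 1) / n - 1) * c j)\<^sup>2 \<le> 1"
      using mult_mono[of "((of_int a - 1) / real n - 1)\<^sup>2" 1 "(c j)\<^sup>2" 1] c[of j] by (simp add: power_mult_distrib)
  qed simp
  also have "\<dots> = 2 * (n * card J)" by simp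
  finally show "mean (\<lambda>f. (smear J c n f)\<^sup>2) \<le> 2 * (n * card J)" by simp
qed

text \<open>The reflection \<open>j \<mapsto> - j - 1\<close> exchanges \<open>\<bar>j\<bar>\<close>
  and \<open>\<bar>j + 1\<bar>\<close> and folds the negative half onto the other one.\<close>

lemma sum_reflected_diff_le:
  fixes f :: "int \<Rightarrow> real"
  shows "(\<Sum>j\<in>W. (f \<bar>j\<bar> - f \<bar>j + 1\<bar>)\<^sup>2) \<le> 2 * (\<Sum>j\<in>{0..N}. (f j - f (j + 1))\<^sup>2)"
proof -
  have "W = {0..N} \<union> {-N..-1}" using N_nonneg by auto
  then have "(\<Sum>j\<in>W. (f \<bar>j\<bar> - f \<bar>j + 1\<bar>)\<^sup>2) = (\<Sum>j\<in>{0..N}. (f \<bar>j\<bar> - f \<bar>j + 1\<bar>)\<^sup>2) + (\<Sum>j\<in>{-N..-1}. (f \<bar>j\<bar> - f \<bar>j + 1\<bar>)\<^sup>2)"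
    by (simp add: sum.union_disjoint)
  also have "(\<Sum>j\<in>{-N..-1}. (f \<bar>j\<bar> - f \<bar>j + 1\<bar>)\<^sup>2) = (\<Sum>j\<in>{0..N-1}. (f j - f (j + 1))\<^sup>2)"
    by (rule sum.reindex_bij_witness[of _ "\<lambda>j. - j - 1" "\<lambda>j. - j - 1"]) (auto simp: power2_commute)
  also have "\<dots> \<le> (\<Sum>j\<in>{0..N}. (f j - f (j + 1))\<^sup>2)" by (intro sum_mono2) auto
  finally show ?thesis by simp
qed

end

section \<open>Energies of the flux, the potential and the column cutoff\<close>

context corrector
begin

abbreviation "\<delta> \<equiv> log_step R0 R"
abbreviation "H \<equiv> log_mass R0 R"
abbreviation "\<epsilon> \<equiv> log_step 0 (int r)"
abbreviation "L \<equiv> log_mass 0 (int r)"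

text \<open>The columns beyond the gap correspond to consecutive blocks of \<open>K\<close> positive
  integers, so that column and position in the block together form a single unstretched radial
  variable.\<close>

lemma sum_blocks_le:
  fixes F :: "int \<Rightarrow> real"
  assumes F: "\<And>t. F t \<ge> 0" "\<And>t. t > R \<Longrightarrow> F t = 0"
  shows "(\<Sum>j\<in>W. \<Sum>x\<in>{-N..-1-gap}. \<Sum>s\<in>{1..K}. F (int K * (- x - gap - 1) + \<bar>j\<bar> + int s)) \<le> (\<Sum>t\<in>{1..R}. 2 * of_int t * F t)"
proof -
  let ?k = "\<lambda>p. int K * (- fst p - gap - 1) + int (snd p)"
  let ?S = "{-N..-1-gap} \<times> {1..K}"
  have inj: "inj_on ?k ?S"
  proof (rule inj_onI)
    fix p p' assume p: "p \<in> ?S" "p' \<in> ?S" "?k p = ?k p'"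
    have d: "\<bar>int (snd p) - int (snd p')\<bar> < int K" using p by auto
    have e: "int (snd p) - int (snd p') = int K * (fst p - fst p')" using p(3) by (simp add: algebra_simps)
    then have "\<bar>int K\<bar> * \<bar>fst p - fst p'\<bar> < int K * 1" using d unfolding e by (simp add: abs_mult)
    then have "fst p = fst p'" using K by (subst (asm) abs_of_nat) (simp add: mult_less_cancel_left)
    then show "p = p'" using e by (auto simp: prod_eq_iff)
  qed
  have "(\<Sum>j\<in>W. \<Sum>x\<in>{-N..-1-gap}. \<Sum>s\<in>{1..K}. F (int K * (- x - gap - 1) + \<bar>j\<bar> + int s))
      = (\<Sum>j\<in>W. \<Sum>p\<in>?S. F (?k p + \<bar>j\<bar>))"
    by (simp add: sum.cartesian_product case_prod_beta algebra_simps)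
  also have "\<dots> = (\<Sum>j\<in>W. \<Sum>a\<in>?k ` ?S. F (a + \<bar>j\<bar>))"
    by (intro sum.cong refl) (subst sum.reindex[OF inj], simp)
  also have "\<dots> = (\<Sum>a\<in>?k ` ?S. \<Sum>j\<in>W. F (a + \<bar>j\<bar>))" by (rule sum.swap)
  also have "\<dots> \<le> (\<Sum>t\<in>{1..R}. 2 * of_int t * F t)"
  proof (rule sum_cone_le)
    have "int K * y + int s \<ge> 1" if "y \<ge> 0" "s \<ge> 1" for y s using mult_ge[OF that(1)] that by linarith
    then show "?k ` ?S \<subseteq> {1..}" by force
  qed (use F in auto)
  finally show ?thesis .
qed

text \<open>Cauchy-Schwarz inside each block of \<open>K\<close> steps costs a factor
  \<open>K\<close>: the price of the dear component.\<close>

lemma sum_square_blocks_le: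
  fixes D :: "int \<Rightarrow> real" and S :: real
  assumes D: "\<And>t. t > R \<Longrightarrow> D t = 0" and S: "(\<Sum>t\<in>{1..R}. of_int t * (D t)\<^sup>2) \<le> S"
  shows "square_sum (\<lambda>j x. if x \<le> -1-gap then \<Sum>s\<in>{1..K}. D (int K * (- x - gap - 1) + \<bar>j\<bar> + int s) else 0) \<le> 2 * K * S"
proof -
  have "square_sum (\<lambda>j x. if x \<le> -1-gap then \<Sum>s\<in>{1..K}. D (int K * (- x - gap - 1) + \<bar>j\<bar> + int s) else 0)
     = (\<Sum>j\<in>W. \<Sum>x\<in>{-N..-1-gap}. (\<Sum>s\<in>{1..K}. D (int K * (- x - gap - 1) + \<bar>j\<bar> + int s))\<^sup>2)"
    by (intro sum.cong refl sum.mono_neutral_cong_right) (auto simp: gap_def)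
  also have "\<dots> \<le> (\<Sum>j\<in>W. \<Sum>x\<in>{-N..-1-gap}. K * (\<Sum>s\<in>{1..K}. (D (int K * (- x - gap - 1) + \<bar>j\<bar> + int s))\<^sup>2))"
  proof (intro sum_mono)
    fix j x
    show "(\<Sum>s\<in>{1..K}. D (int K * (- x - gap - 1) + \<bar>j\<bar> + int s))\<^sup>2 \<le> K * (\<Sum>s\<in>{1..K}. (D (int K * (- x - gap - 1) + \<bar>j\<bar> + int s))\<^sup>2)"
      using sum_squared_le_sum_of_squares[of "\<lambda>s. D (int K * (- x - gap - 1) + \<bar>j\<bar> + int s)" "{1..K}"] by (simp add: mult.commute)
  qed
  also have "\<dots> = K * (\<Sum>j\<in>W. \<Sum>x\<in>{-N..-1-gap}. \<Sum>s\<in>{1..K}. (D (int K * (- x - gap - 1) + \<bar>j\<bar> + int s))\<^sup>2)"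
    by (simp add: sum_distrib_left)
  also have "\<dots> \<le> K * (\<Sum>t\<in>{1..R}. 2 * of_int t * (D t)\<^sup>2)"
    by (intro mult_left_mono sum_blocks_le) (auto simp: D)
  also have "\<dots> = 2 * K * (\<Sum>t\<in>{1..R}. of_int t * (D t)\<^sup>2)"
    by (simp add: sum_distrib_left mult_ac)
  also have "\<dots> \<le> 2 * K * S" using S by (intro mult_left_mono) auto
  finally show ?thesis .
qed

lemma flux_square: "square_sum flux \<le> 2 * K / H"
proof -
  have "square_sum flux \<le> 2 * K * (1 / H)"
    unfolding flux_def q_eq_sum by (rule sum_square_blocks_le) (auto simp: outer.step_eq_0 outer.sum_mult_step)
  then show ?thesis by simp
qed

text \<open>On a single line the radial sum lacks the planar weight \<open>t\<close>, and this
  leaves a gain of order \<open>1 / R0\<close>.\<close>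

lemma sum_step_rows: "s \<ge> 1 \<Longrightarrow> (\<Sum>j\<in>W. (\<delta> (s + \<bar>j\<bar>))\<^sup>2) \<le> 2 / (of_int (R0 + 1) * H)"
proof -
  assume s: "s \<ge> 1"
  have half: "(\<Sum>j\<in>{0..N}. (\<delta> (s + j))\<^sup>2) \<le> 1 / (of_int (R0 + 1) * H)"
  proof -
    have "(\<Sum>j\<in>{0..N}. (\<delta> (s + j))\<^sup>2) = (\<Sum>t\<in>{s..N+s}. (\<delta> t)\<^sup>2)"
      by (rule sum.reindex_bij_witness[of _ "\<lambda>t. t - s" "\<lambda>t. t + s"]) (auto simp: add.commute)
    also have "\<dots> \<le> (\<Sum>t\<in>{1..max R (N + s)}. (\<delta> t)\<^sup>2)" using s by (intro sum_mono2) auto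
    also have "\<dots> = (\<Sum>t\<in>{1..R}. (\<delta> t)\<^sup>2)" by (intro sum.mono_neutral_right) (auto simp: outer.step_eq_0)
    also have "\<dots> \<le> 1 / (of_int (R0 + 1) * H)" by (rule outer.sum_step_square)
    finally show ?thesis .
  qed
  have "W = {0..N} \<union> {-N..-1}" using N_nonneg by auto
  then have "(\<Sum>j\<in>W. (\<delta> (s + \<bar>j\<bar>))\<^sup>2) = (\<Sum>j\<in>{0..N}. (\<delta> (s + \<bar>j\<bar>))\<^sup>2) + (\<Sum>j\<in>{-N..-1}. (\<delta> (s + \<bar>j\<bar>))\<^sup>2)"
    by (simp add: sum.union_disjoint)
  also have "(\<Sum>j\<in>{-N..-1}. (\<delta> (s + \<bar>j\<bar>))\<^sup>2) = (\<Sum>j\<in>{1..N}. (\<delta> (s + j))\<^sup>2)"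
    by (rule sum.reindex_bij_witness[of _ "\<lambda>j. - j" "\<lambda>j. - j"]) auto
  also have "\<dots> \<le> (\<Sum>j\<in>{0..N}. (\<delta> (s + j))\<^sup>2)" by (intro sum_mono2) auto
  finally show ?thesis using half by simp
qed

text \<open>The flux switches on abruptly at column \<open>- 1 - gap\<close>, with values
  \<open>q 1 j\<close>; in the columns beyond, its increments are sums of second differences of
  \<open>v\<close> with lag \<open>K\<close>. The onset lives on one column only, the second
  differences are small by themselves, so both gain a factor \<open>1 / R0\<close>.\<close>

lemma flux_column_diff_square:
  assumes "H \<ge> 1"
  shows "square_sum (\<lambda>j x. flux j x - flux j (x + 1)) \<le> 12 * (real K)\<^sup>2 / of_int R0"
proof -
  let ?D = "\<lambda>t. \<delta> t - \<delta> (t + int K)"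
  let ?e = "\<lambda>j x. if x \<le> -1-gap then \<Sum>s\<in>{1..K}. ?D (int K * (- x - gap - 1) + \<bar>j\<bar> + int s) else 0"
  let ?f = "\<lambda>j x. if x = -1-gap then q 1 j else 0"
  have eq: "flux j x - flux j (x + 1) = ?f j x - ?e j (x + 1)" for j x
  proof -
    consider "x \<ge> - gap" | "x = -1-gap" | "x \<le> -2-gap" by linarith
    then show ?thesis
    proof cases
      case 3
      have "int K * (- x - gap - 1) + \<bar>j\<bar> + int s = int K * (- (x + 1) - gap - 1) + \<bar>j\<bar> + int s + int K" for s
        by (simp add: algebra_simps)
      then show ?thesis using 3 by (simp add: flux_def q_eq_sum sum_subtractf) (simp add: algebra_simps)
    qed (auto simp: flux_def)
  qed
  have f: "square_sum (\<lambda>j x. ?f j x) \<le> K * K * (2 / (of_int (R0 + 1) * H))"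
  proof -
    have "square_sum (\<lambda>j x. ?f j x) = (\<Sum>j\<in>W. \<Sum>x\<in>W. if x = -1-gap then (q 1 j)\<^sup>2 else 0)"
      by (intro sum.cong refl) auto
    also have "\<dots> \<le> (\<Sum>j\<in>W. (q 1 j)\<^sup>2)" by (intro sum_mono) simp
    also have "\<dots> \<le> (\<Sum>j\<in>W. K * (\<Sum>s\<in>{1..K}. (\<delta> (int s + \<bar>j\<bar>))\<^sup>2))"
    proof (rule sum_mono)
      fix j
      show "(q 1 j)\<^sup>2 \<le> K * (\<Sum>s\<in>{1..K}. (\<delta> (int s + \<bar>j\<bar>))\<^sup>2)"
        using sum_squared_le_sum_of_squares[of "\<lambda>s. \<delta> (int s + \<bar>j\<bar>)" "{1..K}"]
        by (simp add: q_eq_sum add.commute mult.commute)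
    qed
    also have "\<dots> = K * (\<Sum>s\<in>{1..K}. \<Sum>j\<in>W. (\<delta> (int s + \<bar>j\<bar>))\<^sup>2)"
      unfolding sum_distrib_left[symmetric] by (subst sum.swap) simp
    also have "\<dots> \<le> K * (\<Sum>s\<in>{1..K}. 2 / (of_int (R0 + 1) * H))"
      by (intro mult_left_mono sum_mono sum_step_rows) auto
    finally show ?thesis by simp
  qed
  have e: "square_sum (\<lambda>j x. ?e j (x + 1)) \<le> 2 * K * (2 * K / (of_int (R0 + 1) * H\<^sup>2))"
  proof -
    have "(\<Sum>x\<in>W. (?e j (x + 1))\<^sup>2) \<le> (\<Sum>x\<in>W. (?e j x)\<^sup>2)" for j
    proof -
      have "(\<Sum>x\<in>W. (?e j (x + 1))\<^sup>2) = (\<Sum>x\<in>{-N+1..N+1}. (?e j x)\<^sup>2)"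
        by (rule sum.reindex_bij_witness[of _ "\<lambda>x. x - 1" "\<lambda>x. x + 1"]) auto
      also have "\<dots> = (\<Sum>x\<in>{-N+1..N}. (?e j x)\<^sup>2)"
        using N_nonneg by (intro sum.mono_neutral_right) (auto simp: gap_def)
      also have "\<dots> \<le> (\<Sum>x\<in>W. (?e j x)\<^sup>2)" by (intro sum_mono2) auto
      finally show ?thesis .
    qed
    then have "square_sum (\<lambda>j x. ?e j (x + 1)) \<le> square_sum (\<lambda>j x. ?e j x)" by (rule sum_mono)
    also have "\<dots> \<le> 2 * K * (2 * K / (of_int (R0 + 1) * H\<^sup>2))"
      by (rule sum_square_blocks_le) (use outer.sum_step_diff_square[of K] in \<open>auto simp: outer.step_eq_0\<close>)
    finally show ?thesis .
  qed
  have "square_sum (\<lambda>j x. flux j x - flux j (x + 1)) \<le> (\<Sum>j\<in>W. \<Sum>x\<in>W. 2 * (?f j x)\<^sup>2 + 2 * (?e j (x + 1))\<^sup>2)"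
    unfolding eq by (intro sum_mono) (use sum_sq_le[of _ "- _"] in simp)
  also have "\<dots> = 2 * square_sum (\<lambda>j x. ?f j x) + 2 * square_sum (\<lambda>j x. ?e j (x + 1))"
    by (simp only: sum.distrib sum_distrib_left)
  also have "\<dots> \<le> 2 * (K * K * (2 / (of_int (R0 + 1) * H))) + 2 * (2 * K * (2 * K / (of_int (R0 + 1) * H\<^sup>2)))"
    using f e by linarith
  also have "\<dots> \<le> 2 * (K * K * (2 / of_int R0)) + 2 * (2 * K * (2 * K / of_int R0))"
  proof -
    have "of_int R0 \<le> of_int (R0 + 1) * H" using assms R0 mult_mono[of "of_int R0" "of_int (R0 + 1)" 1 H] by simp
    moreover have "of_int R0 \<le> of_int (R0 + 1) * H\<^sup>2"
      using assms R0 mult_mono[of "of_int R0" "of_int (R0 + 1)" 1 "H\<^sup>2"] by (simp add: one_le_power)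
    ultimately show ?thesis using R0
      by (intro add_mono mult_left_mono divide_left_mono mult_pos_pos) (auto simp: outer.mass_pos zero_less_power)
  qed
  \<comment> \<open>4 from the onset and 8 from the second differences.\<close>
  also have "\<dots> = 12 * (real K)\<^sup>2 / of_int R0" by (simp add: power2_eq_square)
  finally show ?thesis .
qed

text \<open>A row increment of a whole block telescopes to the difference of two steps with lag
  \<open>K\<close>, so no Cauchy-Schwarz over the block is needed here.\<close>

lemma flux_row_diff_square:
  assumes "H \<ge> 1"
  shows "square_sum (\<lambda>j x. flux j x - flux (j + 1) x) \<le> 12 * (real K)\<^sup>2 / of_int R0"
proof -
  let ?F = "\<lambda>t. (\<delta> t - \<delta> (t + int K))\<^sup>2"
  let ?q = "\<lambda>x n. v (int K * (- x - gap - 1) + n) - v (int K * (- x - gap) + n)"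
  have "square_sum (\<lambda>j x. flux j x - flux (j + 1) x) = (\<Sum>x\<in>W. \<Sum>j\<in>W. (flux j x - flux (j + 1) x)\<^sup>2)"
    by (rule sum.swap)
  also have "\<dots> = (\<Sum>x\<in>{-N..-1-gap}. \<Sum>j\<in>W. (?q x \<bar>j\<bar> - ?q x \<bar>j + 1\<bar>)\<^sup>2)"
    by (rule sum.mono_neutral_cong_right) (auto simp: gap_def flux_def q_def)
  also have "\<dots> \<le> (\<Sum>x\<in>{-N..-1-gap}. 2 * (\<Sum>j\<in>{0..N}. (?q x j - ?q x (j + 1))\<^sup>2))"
    by (intro sum_mono sum_reflected_diff_le)
  also have "\<dots> = 2 * (\<Sum>x\<in>{-N..-1-gap}. \<Sum>j\<in>{0..N}. ?F (int K * (- x - gap - 1) + j + 1))"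
  proof -
    have "?q x j - ?q x (j + 1) = \<delta> (int K * (- x - gap - 1) + j + 1) - \<delta> (int K * (- x - gap - 1) + j + 1 + int K)" for x j
      using outer.profile_step'[of "int K * (- x - gap - 1) + j"] outer.profile_step'[of "int K * (- x - gap) + j"]
      by (simp add: algebra_simps)
    then show ?thesis by (simp add: sum_distrib_left)
  qed
  also have "(\<Sum>x\<in>{-N..-1-gap}. \<Sum>j\<in>{0..N}. ?F (int K * (- x - gap - 1) + j + 1)) = (\<Sum>a\<in>{0..N-gap-1}. \<Sum>j\<in>{0..N}. ?F (int K * a + j + 1))"
    by (rule sum.reindex_bij_witness[of _ "\<lambda>a. - a - gap - 1" "\<lambda>x. - x - gap - 1"]) auto
  also have "\<dots> \<le> (\<Sum>t\<in>{1..R}. (of_int t / of_int (int K) + 1) * ?F t)"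
    using K by (intro sum_scaled_cone_le) (auto simp: outer.step_eq_0)
  also have "\<dots> \<le> (\<Sum>t\<in>{1..R}. 2 * (of_int t * ?F t))"
  proof (intro sum_mono)
    fix t assume t: "t \<in> {1..R}"
    have "of_int t / real K \<le> of_int t" using K t by (simp add: divide_le_eq)
    then have "(of_int t / of_int (int K) + 1) * ?F t \<le> (2 * of_int t) * ?F t" using t by (intro mult_right_mono) auto
    then show "(of_int t / of_int (int K) + 1) * ?F t \<le> 2 * (of_int t * ?F t)" by simp
  qed
  also have "\<dots> \<le> 2 * (2 * K / (of_int (R0 + 1) * H\<^sup>2))"
    unfolding sum_distrib_left[symmetric] using outer.sum_step_diff_square[of K] by simp
  also have "\<dots> \<le> 2 * (2 * (real K)\<^sup>2 / of_int R0)"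
  proof -
    have "of_int R0 \<le> of_int (R0 + 1) * H\<^sup>2"
      using assms R0 mult_mono[of "of_int R0" "of_int (R0 + 1)" 1 "H\<^sup>2"] by (simp add: one_le_power)
    moreover have "real K \<le> (real K)\<^sup>2" using K by (simp add: power2_eq_square)
    ultimately show ?thesis using R0 by (intro mult_left_mono frac_le) auto
  qed
  finally have "square_sum (\<lambda>j x. flux j x - flux (j + 1) x) \<le> 2 * (2 * (2 * (real K)\<^sup>2 / of_int R0))" by simp
  \<comment> \<open>The 8 is raised to 12, the constant of the column increments.\<close>
  also have "\<dots> \<le> 12 * (real K)\<^sup>2 / of_int R0" using R0 by (simp add: divide_right_mono)
  finally show ?thesis .
qed

text \<open>The cheap component: the stretched cone gives the main term \<open>2 / (K * H)\<close>.
  The rounding in the count of the cone, and the columns of the gap where the potential is constant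
  along each row, contribute one-dimensional sums, small through \<open>R0\<close>.\<close>

lemma pot_row_diff_square:
  "square_sum (\<lambda>j x. pot j x - pot (j + 1) x) \<le> 2 / (K * H) + 2 * (2 * real_of_int gap + 1) / (of_int (R0 + 1) * H)"
proof -
  let ?F = "\<lambda>t. (\<delta> t)\<^sup>2"
  let ?p = "\<lambda>x n. v (int K * max (- x - gap) 0 + n)"
  have F1: "(\<Sum>t\<in>{1..R}. ?F t) \<le> 1 / (of_int (R0 + 1) * H)" by (rule outer.sum_step_square)
  have "square_sum (\<lambda>j x. pot j x - pot (j + 1) x) = (\<Sum>x\<in>W. \<Sum>j\<in>W. (pot j x - pot (j + 1) x)\<^sup>2)"
    by (rule sum.swap)
  also have "\<dots> = (\<Sum>x\<in>{-N..0}. \<Sum>j\<in>W. (?p x \<bar>j\<bar> - ?p x \<bar>j + 1\<bar>)\<^sup>2)"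
    by (rule sum.mono_neutral_cong_right) (use N_nonneg in \<open>auto simp: pot_def\<close>)
  also have "\<dots> \<le> (\<Sum>x\<in>{-N..0}. 2 * (\<Sum>j\<in>{0..N}. (?p x j - ?p x (j + 1))\<^sup>2))"
    by (intro sum_mono sum_reflected_diff_le)
  also have "\<dots> = 2 * (\<Sum>x\<in>{-N..0}. \<Sum>j\<in>{0..N}. ?F (int K * max (- x - gap) 0 + j + 1))"
    unfolding sum_distrib_left by (intro sum.cong refl) (simp add: outer.profile_step' add.assoc[symmetric])
  also have "{-N..0} = {-N..-gap} \<union> {-gap+1..0}" using N_columns R0 R0_R by (auto simp: gap_def)
  also have "(\<Sum>x\<in>{-N..-gap} \<union> {-gap+1..0}. \<Sum>j\<in>{0..N}. ?F (int K * max (- x - gap) 0 + j + 1)) =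
    (\<Sum>x\<in>{-N..-gap}. \<Sum>j\<in>{0..N}. ?F (int K * max (- x - gap) 0 + j + 1)) + (\<Sum>x\<in>{-gap+1..0}. \<Sum>j\<in>{0..N}. ?F (int K * max (- x - gap) 0 + j + 1))"
    by (rule sum.union_disjoint) auto
  also have "(\<Sum>x\<in>{-N..-gap}. \<Sum>j\<in>{0..N}. ?F (int K * max (- x - gap) 0 + j + 1)) = (\<Sum>a\<in>{0..N-gap}. \<Sum>j\<in>{0..N}. ?F (int K * a + j + 1))"
    by (rule sum.reindex_bij_witness[of _ "\<lambda>a. - a - gap" "\<lambda>x. - x - gap"]) auto
  also have "(\<Sum>x\<in>{-gap+1..0}. \<Sum>j\<in>{0..N}. ?F (int K * max (- x - gap) 0 + j + 1)) = of_int gap * (\<Sum>j\<in>{0..N}. ?F (R * 0 + j + 1))"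
  proof -
    have "(\<Sum>x\<in>{-gap+1..0}. \<Sum>j\<in>{0..N}. ?F (int K * max (- x - gap) 0 + j + 1)) = (\<Sum>x\<in>{-gap+1..0}. \<Sum>j\<in>{0..N}. ?F (R * 0 + j + 1))"
      by (intro sum.cong refl) (auto simp: max_def)
    then show ?thesis by (simp add: gap_def)
  qed
  finally have 0: "square_sum (\<lambda>j x. pot j x - pot (j + 1) x) \<le>
    2 * ((\<Sum>a\<in>{0..N-gap}. \<Sum>j\<in>{0..N}. ?F (int K * a + j + 1)) + of_int gap * (\<Sum>j\<in>{0..N}. ?F (R * 0 + j + 1)))" .
  have 1: "(\<Sum>a\<in>{0..N-gap}. \<Sum>j\<in>{0..N}. ?F (int K * a + j + 1)) \<le> 1 / (K * H) + 1 / (of_int (R0 + 1) * H)"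
  proof -
    have "(\<Sum>a\<in>{0..N-gap}. \<Sum>j\<in>{0..N}. ?F (int K * a + j + 1)) \<le> (\<Sum>t\<in>{1..R}. (of_int t / of_int (int K) + 1) * ?F t)"
      using K by (intro sum_scaled_cone_le) (auto simp: outer.step_eq_0)
    also have "\<dots> = (\<Sum>t\<in>{1..R}. of_int t * ?F t) / K + (\<Sum>t\<in>{1..R}. ?F t)"
      by (simp add: distrib_right sum.distrib sum_divide_distrib)
    finally show ?thesis using F1 unfolding outer.sum_mult_step by (simp add: mult.commute)
  qed
  have 2: "(\<Sum>j\<in>{0..N}. ?F (R * 0 + j + 1)) \<le> 2 / (of_int (R0 + 1) * H)"
  proof -
    \<comment> \<open>A single column is a cone with stretch \<open>R\<close> cut down to
      \<open>a = 0\<close>, for which \<open>t / R + 1 \<le> 2\<close>.\<close>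
    have "(\<Sum>a\<in>{0}. \<Sum>j\<in>{0..N}. ?F (R * a + j + 1)) \<le> (\<Sum>t\<in>{1..R}. (of_int t / of_int R + 1) * ?F t)"
      using R0 R0_R by (intro sum_scaled_cone_le) (auto simp: outer.step_eq_0)
    also have "\<dots> \<le> (\<Sum>t\<in>{1..R}. 2 * ?F t)" by (intro sum_mono mult_right_mono) auto
    also have "\<dots> \<le> 2 / (of_int (R0 + 1) * H)" unfolding sum_distrib_left[symmetric] using F1 by simp
    finally show ?thesis by simp
  qed
  have "of_int gap * (\<Sum>j\<in>{0..N}. ?F (R * 0 + j + 1)) \<le> of_int gap * (2 / (of_int (R0 + 1) * H))"
    by (rule mult_left_mono[OF 2]) (simp add: gap_def)
  with 0 1 show ?thesis by (simp add: add_divide_distrib)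
qed

text \<open>The planar energy of the cutoff in the half plane of pairs \<open>(a, x)\<close>. This
  \<open>1 / L\<close> is the second logarithm.\<close>

lemma mu_level_diff_square: "(\<Sum>a\<in>{1..int r}. \<Sum>x\<in>W. (mu (a - 1) x - mu a x)\<^sup>2) \<le> 2 / L"
proof -
  have "mu (a - 1) x - mu a x = \<epsilon> (a + \<bar>x\<bar>)" for a x
    using inner.profile_step[of "a + \<bar>x\<bar>"] by (simp add: mu_def algebra_simps)
  then show ?thesis using inner.sum_cone_step_square[of "{1..int r}" W] by simp
qed

lemma mu_column_diff_square: "(\<Sum>a\<in>{1..int r}. \<Sum>x\<in>W. (mu (a - 1) x - mu (a - 1) (x + 1))\<^sup>2) \<le> 4 / L"
proof -
  have "(\<Sum>a\<in>{1..int r}. \<Sum>x\<in>W. (mu (a - 1) x - mu (a - 1) (x + 1))\<^sup>2)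
    \<le> (\<Sum>a\<in>{1..int r}. 2 * (\<Sum>x\<in>{0..N}. (\<epsilon> (1 * (a - 1) + x + 1))\<^sup>2))"
  proof (rule sum_mono)
    fix a
    show "(\<Sum>x\<in>W. (mu (a - 1) x - mu (a - 1) (x + 1))\<^sup>2) \<le> 2 * (\<Sum>x\<in>{0..N}. (\<epsilon> (1 * (a - 1) + x + 1))\<^sup>2)"
      using sum_reflected_diff_le[of "\<lambda>n. w (a - 1 + n)"] inner.profile_step'[of "a - 1 + _"]
      by (simp add: mu_def add.assoc[symmetric] del: add_diff_cancel_left' diff_add_cancel)
  qed
  also have "\<dots> = 2 * (\<Sum>a\<in>{0..int r - 1}. \<Sum>x\<in>{0..N}. (\<epsilon> (1 * a + x + 1))\<^sup>2)"
    unfolding sum_distrib_left[symmetric]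
    by (rule arg_cong[where f = "\<lambda>x. 2 * x"], rule sum.reindex_bij_witness[of _ "\<lambda>a. a + 1" "\<lambda>a. a - 1"]) auto
  also have "\<dots> \<le> 2 * (\<Sum>t\<in>{1..int r}. (of_int t / of_int 1 + 1) * (\<epsilon> t)\<^sup>2)"
    by (intro mult_left_mono sum_scaled_cone_le) (auto simp: inner.step_eq_0)
  also have "\<dots> = 2 * ((\<Sum>t\<in>{1..int r}. of_int t * (\<epsilon> t)\<^sup>2) + (\<Sum>t\<in>{1..int r}. (\<epsilon> t)\<^sup>2))"
    by (simp add: distrib_right sum.distrib)
  also have "\<dots> \<le> 4 / L" using inner.sum_step_square unfolding inner.sum_mult_step by simp
  finally show ?thesis .
qed

lemma mu_zero_diff_square: "(\<Sum>x\<in>W. (mu 0 x - mu 0 (x + 1))\<^sup>2) \<le> 2 / L"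
proof -
  have "(\<Sum>x\<in>W. (mu 0 x - mu 0 (x + 1))\<^sup>2) \<le> 2 * (\<Sum>x\<in>{0..N}. (\<epsilon> (x + 1))\<^sup>2)"
    using sum_reflected_diff_le[of w] by (simp add: mu_def inner.profile_step')
  also have "(\<Sum>x\<in>{0..N}. (\<epsilon> (x + 1))\<^sup>2) = (\<Sum>x\<in>{1..N+1}. (\<epsilon> x)\<^sup>2)"
    by (rule sum.reindex_bij_witness[of _ "\<lambda>x. x - 1" "\<lambda>x. x + 1"]) auto
  also have "\<dots> = (\<Sum>x\<in>{1..int r}. (\<epsilon> x)\<^sup>2)"
    using N_columns R0 R0_R by (intro sum.mono_neutral_right) (auto simp: inner.step_eq_0)
  also have "\<dots> \<le> 1 / L" using inner.sum_step_square by simp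
  finally show ?thesis by simp
qed

lemma mu_square: "a \<ge> 0 \<Longrightarrow> (\<Sum>x\<in>W. (mu a x)\<^sup>2) \<le> 2 * r + 1" "a \<ge> 0 \<Longrightarrow> (\<Sum>x\<in>W. (mu a (x + 1))\<^sup>2) \<le> 2 * r + 1"
proof -
  have le1: "(mu a y)\<^sup>2 \<le> 1" for y by (simp add: mu_def inner.profile_square_le_1)
  assume a: "a \<ge> 0"
  have "(\<Sum>x\<in>W. (mu a x)\<^sup>2) = (\<Sum>x\<in>{-int r..int r}. (mu a x)\<^sup>2)"
    using N_columns R0 R0_R mu_eq_0[OF a] by (intro sum.mono_neutral_right) auto
  also have "\<dots> \<le> (\<Sum>x\<in>{-int r..int r}. 1)" by (intro sum_mono le1)
  finally show "(\<Sum>x\<in>W. (mu a x)\<^sup>2) \<le> 2 * r + 1" by simp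
  have "(\<Sum>x\<in>W. (mu a (x + 1))\<^sup>2) = (\<Sum>x\<in>{-int r-1..int r-1}. (mu a (x + 1))\<^sup>2)"
    using N_columns R0 R0_R mu_eq_0[OF a] by (intro sum.mono_neutral_right) auto
  also have "\<dots> \<le> (\<Sum>x\<in>{-int r-1..int r-1}. 1)" by (intro sum_mono le1)
  finally show "(\<Sum>x\<in>W. (mu a (x + 1))\<^sup>2) \<le> 2 * r + 1" by simp
qed

lemma pot_square: "square_sum pot \<le> (2 * R + 1) * (R + gap + 1)"
proof -
  have "square_sum pot = (\<Sum>j\<in>{-R..R}. \<Sum>x\<in>{-R-gap..0}. (pot j x)\<^sup>2)"
    using N_rows N_columns by (intro sum.mono_neutral_cong_right) (auto simp: pot_eq_0 gap_def)
  also have "\<dots> \<le> (\<Sum>j\<in>{-R..R}. \<Sum>x\<in>{-R-gap..0}. 1)"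
    by (intro sum_mono) (auto simp: pot_def outer.profile_square_le_1)
  also have "\<dots> = of_int ((2 * R + 1) * (R + gap + 1))" using R0 R0_R by (simp add: gap_def)
  finally show ?thesis .
qed

end

section \<open>Size of the logarithms and norms of the test functions\<close>

lemma log_mass_dyadic: "log_mass (2 ^ a) (2 ^ (a + n)) \<ge> real n / 2"
proof (induction n)
  case (Suc n)
  let ?p = "2 ^ (a + n) :: int"
  have "{A<..2 * P} = {A<..P} \<union> {P<..2 * P}" if "0 < A" "A \<le> P" for A P :: int
    using that by auto
  from this[of "2 ^ a" ?p] have "{2 ^ a<..2 ^ (a + Suc n)} = {2 ^ a<..?p} \<union> {?p<..2 * ?p}"
    by simp
  then have "log_mass (2 ^ a) (2 ^ (a + Suc n)) = log_mass (2 ^ a) ?p + (\<Sum>t\<in>{?p<..2 * ?p}. 1 / of_int t)"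
    unfolding log_mass_def by (simp add: sum.union_disjoint)
  moreover have "(\<Sum>t\<in>{?p<..2 * ?p}. 1 / of_int t) \<ge> (\<Sum>t\<in>{?p<..2 * ?p}. 1 / (2 * of_int ?p :: real))"
  proof (intro sum_mono divide_left_mono)
    fix t assume t: "t \<in> {?p<..2 * ?p}"
    then have "of_int t \<le> (of_int (2 * ?p) :: real)" unfolding of_int_le_iff by simp
    then show "real_of_int t \<le> 2 * of_int ?p" by simp
    have "0 < ?p" by simp
    then have "0 < t" using t by (simp del: zero_less_power)
    then show "0 < 2 * of_int ?p * real_of_int t" by simp
  qed simp
  moreover have "(\<Sum>t\<in>{?p<..2 * ?p}. 1 / (2 * of_int ?p :: real)) = 1 / 2" by simp
  ultimately show ?case using Suc by (simp add: add_divide_distrib)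
qed (simp add: log_mass_def)

lemma log_mass_0_ge: "log_mass 0 hi \<ge> log_mass 1 hi"
  unfolding log_mass_def by (intro sum_mono2) auto

text \<open>\<open>7200 * K ^ 5\<close> is what makes an error \<open>72 * K ^ 2 / r\<close> at most
  \<open>K ^ (-3) / 100\<close>. The comparison passes through \<open>64 ^ K\<close>: from
  \<open>K\<close> to \<open>K + 1\<close> the left side grows by at most 32, and
  \<open>6 * K \<le> K ^ 2\<close>.\<close>

lemma dominating_power: "K \<ge> 6 \<Longrightarrow> 7200 * real K ^ 5 \<le> 2 ^ (K\<^sup>2)"
proof -
  assume K: "K \<ge> 6"
  have "7200 * real K ^ 5 \<le> 64 ^ K"
    using K
  proof (induction K rule: dec_induct)
    case (step k)
    have "real (Suc k) ^ 5 \<le> (2 * real k) ^ 5" using step by (intro power_mono) auto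
    then have "7200 * real (Suc k) ^ 5 \<le> 32 * (7200 * real k ^ 5)" by (simp add: power_mult_distrib)
    also have "\<dots> \<le> 32 * 64 ^ k" using step by linarith
    also have "\<dots> \<le> 64 ^ Suc k" by simp
    finally show ?case .
  qed simp
  also have "(64::real) ^ K = 2 ^ (6 * K)" by (simp add: power_mult)
  also have "\<dots> \<le> 2 ^ (K\<^sup>2)" using K by (intro power_increasing) (auto simp: power2_eq_square)
  finally show ?thesis .
qed

context window
begin

lemma nrm_le: "mean2 (\<lambda>\<omega>. (F \<omega>)\<^sup>2) \<le> B\<^sup>2 \<Longrightarrow> B \<ge> 0 \<Longrightarrow> nrm F \<le> B"
  unfolding nrm_def by (rule real_le_lsqrt)

lemma nrm_nonneg: "nrm F \<ge> 0" unfolding nrm_eq_L2_set by simp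

lemma mean2_rows_only: "mean2 (\<lambda>\<omega>. h (fst \<omega>)) = mean h" by (simp add: mean2_def)

lemma nrm_column_shift:
  "nrm (\<lambda>\<omega>. F (fst \<omega>, \<lambda>x. snd \<omega> (x + 1)) - F \<omega>) = nrm (\<lambda>\<omega>. F \<omega> - F (fst \<omega>, \<lambda>x. snd \<omega> (x - 1)))"
  unfolding nrm_def mean2_def
  using mean_shift[of "\<lambda>\<zeta>. mean (\<lambda>\<xi>. (F (\<xi>, \<lambda>x. \<zeta> (x + 1)) - F (\<xi>, \<zeta>))\<^sup>2)"] by simp

lemma nrm_row_shift:
  "nrm (\<lambda>\<omega>. F (\<lambda>x. fst \<omega> (x + 1), snd \<omega>) - F \<omega>) = nrm (\<lambda>\<omega>. F \<omega> - F (\<lambda>x. fst \<omega> (x - 1), snd \<omega>))"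
proof -
  have "mean (\<lambda>\<xi>. (F (\<lambda>x. \<xi> (x + 1), \<zeta>) - F (\<xi>, \<zeta>))\<^sup>2) = mean (\<lambda>\<xi>. (F (\<xi>, \<zeta>) - F (\<lambda>x. \<xi> (x - 1), \<zeta>))\<^sup>2)" for \<zeta>
    using mean_shift[of "\<lambda>\<xi>. (F (\<lambda>x. \<xi> (x + 1), \<zeta>) - F (\<xi>, \<zeta>))\<^sup>2"] by simp
  then show ?thesis by (simp add: nrm_def mean2_def)
qed

lemma nrm_sum5: "nrm (\<lambda>\<omega>. F1 \<omega> + F2 \<omega> + F3 \<omega> + F4 \<omega> + F5 \<omega>) \<le> nrm F1 + nrm F2 + nrm F3 + nrm F4 + nrm F5"
  by (intro order_trans[OF nrm_triangle] add_mono order_refl)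

lemma nrm_sum4: "nrm (\<lambda>\<omega>. F1 \<omega> + F2 \<omega> + F3 \<omega> + F4 \<omega>) \<le> nrm F1 + nrm F2 + nrm F3 + nrm F4"
  by (intro order_trans[OF nrm_triangle] add_mono order_refl)

end

context corrector
begin

text \<open>The row \<open>flux 0\<close> is a probability vector, since \<open>pot 0\<close>
  transports a unit charge, and its entries are at most \<open>K / R0\<close>.\<close>

lemma flux_zero_row_square: "H \<ge> 1 \<Longrightarrow> (\<Sum>x\<in>W. (flux 0 x)\<^sup>2) \<le> K / of_int R0"
proof -
  assume H: "H \<ge> 1"
  have nonneg: "flux 0 x \<ge> 0" for x
    by (auto simp: flux_def q_eq_sum intro!: sum_nonneg outer.step_nonneg)
  have le: "flux 0 x \<le> K / of_int R0" for x
  proof -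
    have "1 / (of_int (R0 + 1) * H) \<le> 1 / of_int R0"
      using H R0 mult_mono[of "of_int R0" "of_int (R0 + 1)" 1 H] by (intro divide_left_mono) auto
    then have "\<delta> t \<le> 1 / of_int R0" for t using outer.step_le[of t] by linarith
    then have "(\<Sum>s\<in>{1..K}. \<delta> (a + int s)) \<le> (\<Sum>s\<in>{1..K}. 1 / of_int R0)" for a by (intro sum_mono)
    then show ?thesis using R0 by (auto simp: flux_def q_eq_sum)
  qed
  have "(\<Sum>x\<in>W. pot 0 x * 1) = (\<Sum>x\<in>W. pot 0 (x + 1) * 1)"
  proof (rule sum_window_shift)
    show "pot 0 (- N) = 0" "pot 0 (N + 1) = 0"
      using N_columns R0 R0_R by (intro pot_eq_0(1) pot_eq_0(2), simp add: gap_def)+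
  qed
  moreover have "(\<Sum>x\<in>W. flux 0 x) = (\<Sum>x\<in>W. (if x = 0 then v \<bar>0\<bar> else 0) - (pot 0 x - pot 0 (x + 1)))"
    by (simp add: pot_diff)
  ultimately have sum1: "(\<Sum>x\<in>W. flux 0 x) = 1"
    using N_nonneg R0 by (simp add: sum_subtractf outer.profile_eq_1)
  have "(\<Sum>x\<in>W. (flux 0 x)\<^sup>2) \<le> (\<Sum>x\<in>W. K / of_int R0 * flux 0 x)"
    unfolding power2_eq_square by (intro sum_mono mult_right_mono le nonneg)
  also have "\<dots> = K / of_int R0" unfolding sum_distrib_left[symmetric] sum1 by simp
  finally show ?thesis .
qed

lemma finite_rows: "finite rows" "0 \<notin> rows" and card_rows: "card rows = nat (2 * R)"
  and abs_rows: "j \<in> rows \<Longrightarrow> \<bar>j\<bar> \<le> R"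
  using R0 R0_R by (auto simp: rows_def card_Diff_subset)

lemma finite_cols: "finite cols" "0 \<notin> cols" and card_cols: "card cols = 2 * r"
  and abs_cols: "j \<in> cols \<Longrightarrow> \<bar>j\<bar> \<le> int r"
  by (auto simp: cols_def card_Diff_subset)

lemma mean_PX: "mean (\<lambda>\<xi>. (PX \<xi>)\<^sup>2) \<le> 4 * of_int R / m" "mean (\<lambda>\<xi>. (Psi1 \<xi>)\<^sup>2) \<le> 4 * (m * of_int R)"
proof -
  have "int m + R \<le> N" "R \<ge> 0" using N_rows R0 R0_R by auto
  then show "mean (\<lambda>\<xi>. (PX \<xi>)\<^sup>2) \<le> 4 * of_int R / m" "mean (\<lambda>\<xi>. (Psi1 \<xi>)\<^sup>2) \<le> 4 * (m * of_int R)"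
    using mean_square_avg_le[OF finite_rows abs_rows _ m, of "\<lambda>j. v \<bar>j\<bar>"]
    by (simp_all add: PX_def Psi1_def outer.profile_square_le_1 card_rows)
qed

lemma mean_PZ: "mean (\<lambda>\<zeta>. (PZ \<zeta>)\<^sup>2) \<le> 4 * r / m'" "mean (\<lambda>\<zeta>. (Y \<zeta>)\<^sup>2) \<le> 4 * (m' * r)"
proof -
  have "int m' + int r \<le> N" "int r \<ge> 0" using N_columns R0 R0_R by auto
  then show "mean (\<lambda>\<zeta>. (PZ \<zeta>)\<^sup>2) \<le> 4 * r / m'" "mean (\<lambda>\<zeta>. (Y \<zeta>)\<^sup>2) \<le> 4 * (m' * r)"
    using mean_square_avg_le[OF finite_cols abs_cols _ m', of "\<lambda>j. w \<bar>j\<bar>"]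
    by (simp_all add: PZ_def Y_def inner.profile_square_le_1 card_cols)
qed

text \<open>\<open>PZ\<close>, \<open>Y\<close> and the translated \<open>Y\<close> read only
  columns from \<open>- r\<close> on, whereas the flux lives on columns up to
  \<open>- r - 3\<close>. The gap makes them independent.\<close>

lemma flip_cols:
  assumes a: "a \<in> W" "a \<le> -1-gap"
  shows "PZ (flip a f) = PZ f" "Y (flip a f) = Y f" "Y (\<lambda>x. flip a f (x - 1)) = Y (\<lambda>x. f (x - 1))"
proof -
  have fl: "flip a f y = f y" if "y > -1-gap" "y \<le> N" for y
    using flip_window[OF a(1), of y f] that a by auto
  have in_range: "c > -1-gap" "c \<le> N" "c + j > -1-gap" "c + j \<le> N" "c - 1 > -1-gap" "c - 1 \<le> N" "c + j - 1 > -1-gap" "c + j - 1 \<le> N"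
     "c - 1 + j > -1-gap" "c - 1 + j \<le> N"
    if "c \<in> {1..int m'}" "j \<in> cols" for c j
    using that N_columns R0 R0_R by (auto simp: cols_def gap_def)
  show "PZ (flip a f) = PZ f" "Y (flip a f) = Y f" "Y (\<lambda>x. flip a f (x - 1)) = Y (\<lambda>x. f (x - 1))"
    unfolding PZ_def Y_def avg_def smear_def
    by (intro sum.cong refl; simp only: fl in_range)+
qed

lemma flux_support: "flux j x \<noteq> 0 \<Longrightarrow> x \<le> -1-gap" "flux j x - flux j (x + 1) \<noteq> 0 \<Longrightarrow> x \<le> -1-gap"
  "flux j x - flux (j + 1) x \<noteq> 0 \<Longrightarrow> x \<le> -1-gap"
  by (auto simp: flux_def split: if_splits)

lemma mu_far: "x \<le> -1-gap \<Longrightarrow> a \<ge> 0 \<Longrightarrow> mu a x = 0" "x \<le> -1-gap \<Longrightarrow> a \<ge> 0 \<Longrightarrow> mu a (x + 1) = 0"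
  by (auto intro!: mu_eq_0 simp: gap_def)

lemma mean_M_times_form:
  assumes c: "\<And>j x. c j x \<noteq> 0 \<Longrightarrow> x \<le> -1-gap" and d: "\<And>x. x \<le> -1-gap \<Longrightarrow> d x = 0"
  shows "mean2 (\<lambda>\<omega>. (lin d (snd \<omega>) * form c (fst \<omega>) (snd \<omega>))\<^sup>2)
     = (\<Sum>x\<in>W. (d x)\<^sup>2) * square_sum c"
  using mean_square_form[of c "lin d"] c d lin_flip by (simp add: mean_square_lin1)

lemma row_window: "a \<in> {1..int r} \<Longrightarrow> a \<in> W" "a \<in> {1..int r} \<Longrightarrow> j \<in> rows \<Longrightarrow> a + j \<in> W"
  using N_rows R0 R0_R by (auto simp: rows_def)

lemma sum_rows_le: "(\<And>j. f j \<ge> (0::real)) \<Longrightarrow> (\<Sum>j\<in>rows. f j) \<le> (\<Sum>j\<in>W. f j)"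
  using N_rows by (intro sum_mono2) (auto simp: rows_def)

lemma mean_pair_form_le:
  assumes c: "\<And>j x. c j x \<noteq> 0 \<Longrightarrow> x \<le> -1-gap" and d: "\<And>a x. a \<ge> 1 \<Longrightarrow> x \<le> -1-gap \<Longrightarrow> d a x = 0"
    and S: "(\<Sum>a\<in>{1..int r}. \<Sum>x\<in>W. (d a x)\<^sup>2) \<le> S" "square_sum c \<le> S'"
  shows "mean2 (\<lambda>\<omega>. (pair_form d c (fst \<omega>) (snd \<omega>))\<^sup>2)
     \<le> 2 * S * S'"
proof -
  have "mean2 (\<lambda>\<omega>. (pair_form d c (fst \<omega>) (snd \<omega>))\<^sup>2)
    \<le> 2 * (\<Sum>a\<in>{1..int r}. \<Sum>x\<in>W. (d a x)\<^sup>2) * (\<Sum>j\<in>rows. \<Sum>x\<in>W. (c j x)\<^sup>2)"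
  proof (rule mean_square_pair_form[OF finite_atLeastAtMost_int finite_rows row_window])
    fix a j x assume "a \<in> {1..int r}" "d a x \<noteq> 0"
    then show "c j x = 0" using c[of j x] d[of a x] by auto
  qed
  also have "\<dots> \<le> 2 * S * S'"
  proof (intro mult_mono mult_left_mono S)
    show "(\<Sum>j\<in>rows. \<Sum>x\<in>W. (c j x)\<^sup>2) \<le> S'"
      using sum_rows_le[of "\<lambda>j. \<Sum>x\<in>W. (c j x)\<^sup>2"] S(2) by (simp add: sum_nonneg)
    have "0 \<le> (\<Sum>a\<in>{1..int r}. \<Sum>x\<in>W. (d a x)\<^sup>2)" by (intro sum_nonneg) auto
    then show "0 \<le> 2 * S" using S(1) by linarith
  qed (auto intro!: sum_nonneg)
  finally show ?thesis .
qed

text \<open>\<open>g\<close> is linear in the row signs, and each of these has mean zero.\<close>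

lemma sum_g: "(\<Sum>\<omega>\<in>Or \<times> Or. g \<omega>) = 0"
proof -
  have "mean (\<lambda>\<xi>. \<xi> j) = 0" if "j \<in> W" for j
    by (rule mean_odd[of _ j]) (simp add: flip_same)
  then have z: "mean (\<lambda>\<xi>. \<Sum>j\<in>W. \<xi> j * c j) = 0" for c
    by (simp add: mean_sum mean_multc)
  have "mean (\<lambda>\<xi>. g (\<xi>, \<zeta>)) = 0" for \<zeta>
    using z[of "\<lambda>j. v \<bar>j\<bar> - M 0 \<zeta> * b j \<zeta>"]
    by (simp add: G1_def B_def sum_distrib_left sum_subtractf[symmetric] algebra_simps)
  then have "mean2 g = 0" by (simp add: mean2_def)
  then show ?thesis using card_orientations_pos by (simp add: mean2_eq)
qed

end

text \<open>Origin of the exponents: \<open>R0 = r ^ 8\<close> beats the powers of \<open>r\<close>,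
  at most the third, that multiply increments of the flux; \<open>R / R0 = r ^ 10\<close> gives
  \<open>H \<ge> 5 * K ^ 2\<close>; the smear lengths \<open>r ^ 19\<close> and \<open>r ^ 2\<close>
  exceed the ranges \<open>R\<close> and \<open>r\<close> of the pairs by one power of
  \<open>r\<close>, so that the averages have variance of order \<open>1 / r\<close>.\<close>

locale scaled_corrector = corrector Q N K r "r ^ 19" "r\<^sup>2" "int r ^ 8" "int r ^ 18"
  for Q N and K r :: nat +
  assumes K6: "K \<ge> 6" and r_eq: "r = 2 ^ (K\<^sup>2)"
begin

abbreviation "\<rho> \<equiv> real r"

text \<open>The target size \<open>K ^ (-3/2)\<close> of the residuals; its square is the order of
  both \<open>1 / (K * H)\<close> and \<open>K / (L * H)\<close>.\<close>

definition \<tau> :: real where "\<tau> = 1 / sqrt (real K ^ 3)"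

lemma rho_ge: "7200 * real K ^ 5 \<le> \<rho>"
  using dominating_power[OF K6] by (simp add: r_eq)

lemma rho_bounds: "\<rho> \<ge> 1" "\<rho> \<ge> real K" "\<rho> \<ge> 8"
proof -
  have "real K \<le> real K ^ 5" using K6 by (intro self_le_power) auto
  then have "7200 * real K \<le> \<rho>" using rho_ge by linarith
  then show "\<rho> \<ge> 1" "\<rho> \<ge> real K" "\<rho> \<ge> 8" using K6 by auto
qed

lemma H_ge: "H \<ge> 5 * (real K)\<^sup>2" and H_ge_1: "H \<ge> 1"
proof -
  have "log_mass (2 ^ (8 * K\<^sup>2)) (2 ^ (8 * K\<^sup>2 + 10 * K\<^sup>2)) \<ge> real (10 * K\<^sup>2) / 2" by (rule log_mass_dyadic)
  moreover have "int r ^ 8 = 2 ^ (8 * K\<^sup>2)" "int r ^ 18 = 2 ^ (8 * K\<^sup>2 + 10 * K\<^sup>2)"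
    by (simp_all add: r_eq power_mult[symmetric] mult.commute)
  ultimately show H: "H \<ge> 5 * (real K)\<^sup>2" by simp
  have "(real K)\<^sup>2 \<ge> 1" using K6 by (intro one_le_power) auto
  then show "H \<ge> 1" using H by linarith
qed

lemma L_ge: "L \<ge> (real K)\<^sup>2 / 2"
proof -
  have "log_mass 1 (int r) \<ge> real (K\<^sup>2) / 2" using log_mass_dyadic[of "K\<^sup>2" 0] by (simp add: r_eq)
  then show ?thesis using log_mass_0_ge[of "int r"] by simp
qed

lemma tau_pos: "\<tau> > 0" using K6 by (simp add: \<tau>_def)

lemma tau_square: "\<tau>\<^sup>2 = 1 / real K ^ 3" by (simp add: \<tau>_def power_divide)

lemma tau_le_1: "\<tau> \<le> 1"
proof -
  have "real K ^ 3 \<ge> 1" using K6 by (intro one_le_power) auto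
  then have "sqrt (real K ^ 3) \<ge> 1" by (rule real_sqrt_ge_one)
  then show ?thesis by (simp add: \<tau>_def divide_le_eq)
qed

text \<open>A common threshold for all secondary errors, which are of order
  \<open>K ^ 2 / \<rho>\<close> while \<open>\<rho>\<close> is exponential in
  \<open>K ^ 2\<close>.\<close>

lemma le_tau_square: "x \<le> 72 * (real K)\<^sup>2 / \<rho> \<Longrightarrow> x \<le> (\<tau> / 10)\<^sup>2"
proof -
  assume "x \<le> 72 * (real K)\<^sup>2 / \<rho>"
  also have "\<dots> \<le> 72 * (real K)\<^sup>2 / (7200 * real K ^ 5)"
    using rho_ge rho_bounds K6 by (intro divide_left_mono mult_pos_pos) auto
  also have "\<dots> = (\<tau> / 10)\<^sup>2"
    unfolding power_divide tau_square using K6 by (simp add: field_simps power_numeral_reduce)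
  finally show ?thesis .
qed

lemma pow_ratio: "i < j \<Longrightarrow> \<rho> ^ i / \<rho> ^ j \<le> 1 / \<rho>"
proof -
  assume "i < j"
  then have "\<rho> ^ Suc i \<le> \<rho> ^ j" using rho_bounds by (intro power_increasing) auto
  then show ?thesis using rho_bounds by (simp add: divide_le_eq mult.commute field_simps)
qed

text \<open>The two logarithms multiply to \<open>L * H \<ge> 5 / 2 * K ^ 4\<close>, which turns the
  dear factor \<open>K\<close> into \<open>K ^ (-3)\<close>.\<close>

lemma over_LH: "(c::real) \<ge> 0 \<Longrightarrow> c * K / (L * H) \<le> c * 2 / 5 * \<tau>\<^sup>2"
proof -
  assume c: "c \<ge> 0"
  have "(real K)\<^sup>2 / 2 * (5 * (real K)\<^sup>2) \<le> L * H"
    using L_ge H_ge H_ge_1 K6 by (intro mult_mono) (auto intro: order_trans[OF _ L_ge])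
  then have "c * K / (L * H) \<le> c * K / ((real K)\<^sup>2 / 2 * (5 * (real K)\<^sup>2))"
    using K6 c by (intro divide_left_mono mult_pos_pos inner.mass_pos outer.mass_pos) auto
  also have "\<dots> = c * 2 / 5 * \<tau>\<^sup>2"
    unfolding tau_square using K6 by (simp add: field_simps power_numeral_reduce)
  finally show ?thesis .
qed

text \<open>This is the source of \<open>72 = 6 * 12\<close>: the 12 comes from the increments of
  the flux, and 6 is the largest prefactor with which they occur.\<close>

lemma flux_diff_le: "c \<ge> 0 \<Longrightarrow> c \<le> 6 \<Longrightarrow> i < 8 \<Longrightarrow> c * \<rho> ^ i * (12 * (real K)\<^sup>2 / of_int (int r ^ 8)) \<le> (\<tau> / 10)\<^sup>2"
proof (rule le_tau_square)
  assume c: "c \<ge> 0" "c \<le> 6" and i: "i < 8"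
  have "c * \<rho> ^ i * (12 * (real K)\<^sup>2 / of_int (int r ^ 8)) = 12 * c * (real K)\<^sup>2 * (\<rho> ^ i / \<rho> ^ 8)" by simp
  also have "\<dots> \<le> 12 * c * (real K)\<^sup>2 * (1 / \<rho>)" using c pow_ratio[OF i] by (intro mult_left_mono) auto
  also have "\<dots> \<le> 12 * 6 * (real K)\<^sup>2 * (1 / \<rho>)" using c by (intro mult_right_mono) auto
  finally show "c * \<rho> ^ i * (12 * (real K)\<^sup>2 / of_int (int r ^ 8)) \<le> 72 * (real K)\<^sup>2 / \<rho>" by simp
qed

lemma two_K_over_H_le: "2 * K / H \<le> 2 * real K"
  using H_ge_1 by (simp add: divide_le_eq mult_left_mono[of 1 H "2 * real K", simplified])

lemma K_le_square: "real K \<le> (real K)\<^sup>2" "1 \<le> (real K)\<^sup>2"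
proof -
  have "real K \<ge> 1" using K6 by simp
  then show "real K \<le> (real K)\<^sup>2" "1 \<le> (real K)\<^sup>2" by (auto simp: power2_eq_square intro: one_le_power[of _ 2, unfolded power2_eq_square])
qed

lemma over_rho_le: "x \<le> 72 * (real K)\<^sup>2 \<Longrightarrow> x * (1 / \<rho>) \<le> (\<tau> / 10)\<^sup>2"
  by (rule le_tau_square) (simp add: divide_right_mono)

lemma two_r: "2 * \<rho> + 1 \<le> 3 * \<rho>" using rho_bounds by simp

lemma nrm_PX: "nrm (\<lambda>\<omega>. - PX (fst \<omega>)) \<le> \<tau> / 10"
  unfolding nrm_minus
proof (rule nrm_le)
  have "mean (\<lambda>\<xi>. (PX \<xi>)\<^sup>2) \<le> 4 * (\<rho> ^ 18 / \<rho> ^ 19)" using mean_PX(1) by simp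
  also have "\<dots> \<le> 4 * (1 / \<rho>)" by (intro mult_left_mono pow_ratio) auto
  also have "\<dots> \<le> (\<tau> / 10)\<^sup>2" by (rule over_rho_le) (use K_le_square in linarith)
  finally show "mean2 (\<lambda>\<omega>. (PX (fst \<omega>))\<^sup>2) \<le> (\<tau> / 10)\<^sup>2"
    using mean2_rows_only[of "\<lambda>\<xi>. (PX \<xi>)\<^sup>2"] by simp
qed (use tau_pos in simp)

text \<open>For the cheap component the bound \<open>H \<ge> 5 * K ^ 2\<close> already gives
  \<open>2 / (K * H)\<close> the order \<open>K ^ (-3)\<close>, without the second
  logarithm.\<close>

lemma nrm_pot_row_diff: "nrm (\<lambda>\<omega>. - form (\<lambda>j x. pot j x - pot (j + 1) x) (fst \<omega>) (snd \<omega>)) \<le> \<tau>"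
  unfolding nrm_minus
proof (rule nrm_le)
  have "mean2 (\<lambda>\<omega>. (form (\<lambda>j x. pot j x - pot (j + 1) x) (fst \<omega>) (snd \<omega>))\<^sup>2)
     \<le> 2 / (K * H) + 2 * (2 * real_of_int gap + 1) / (of_int (int r ^ 8 + 1) * H)"
    using mean_square_form[of "\<lambda>j x. pot j x - pot (j + 1) x" "\<lambda>_. 1"] pot_row_diff_square by simp
  also have "2 / (K * H) \<le> 2 / (K * (5 * (real K)\<^sup>2))"
    using H_ge K6 outer.mass_pos by (intro divide_left_mono mult_left_mono mult_pos_pos) auto
  also have "\<dots> = 2 / 5 * \<tau>\<^sup>2" unfolding tau_square by (simp add: power_numeral_reduce)
  also have "2 * (2 * real_of_int gap + 1) / (of_int (int r ^ 8 + 1) * H) \<le> 14 * \<rho> / \<rho> ^ 8"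
  proof (rule frac_le)
    show "\<rho> ^ 8 \<le> of_int (int r ^ 8 + 1) * H"
      using H_ge_1 mult_mono[of "\<rho> ^ 8" "\<rho> ^ 8 + 1" 1 H] by simp
  qed (use rho_bounds in \<open>auto simp: gap_def\<close>)
  also have "14 * \<rho> / \<rho> ^ 8 \<le> (\<tau> / 10)\<^sup>2"
  proof -
    have "14 * \<rho> / \<rho> ^ 8 = 14 * (\<rho> ^ 1 / \<rho> ^ 8)" by simp
    also have "\<dots> \<le> 14 * (1 / \<rho>)" by (intro mult_left_mono pow_ratio) auto
    also have "\<dots> \<le> (\<tau> / 10)\<^sup>2" by (rule over_rho_le) (use K_le_square in linarith)
    finally show "14 * \<rho> / \<rho> ^ 8 \<le> (\<tau> / 10)\<^sup>2" .
  qed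
  also have "2 / 5 * \<tau>\<^sup>2 + (\<tau> / 10)\<^sup>2 \<le> \<tau>\<^sup>2" by (simp add: power_divide)
  finally show "mean2 (\<lambda>\<omega>. (form (\<lambda>j x. pot j x - pot (j + 1) x) (fst \<omega>) (snd \<omega>))\<^sup>2) \<le> \<tau>\<^sup>2" by simp
qed (use tau_pos in simp)

lemma nrm_Y_form:
  assumes c: "\<And>j x. c j x \<noteq> 0 \<Longrightarrow> x \<le> -1-gap"
    and S: "square_sum c \<le> 12 * (real K)\<^sup>2 / of_int (int r ^ 8)"
  shows "nrm (\<lambda>\<omega>. Y (snd \<omega>) * form c (fst \<omega>) (snd \<omega>)) \<le> \<tau> / 10"
    "nrm (\<lambda>\<omega>. Y (\<lambda>x. snd \<omega> (x - 1)) * form c (fst \<omega>) (snd \<omega>)) \<le> \<tau> / 10"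
proof -
  have *: "mean (\<lambda>\<zeta>. (Y \<zeta>)\<^sup>2) * square_sum c \<le> (\<tau> / 10)\<^sup>2"
  proof -
    have "mean (\<lambda>\<zeta>. (Y \<zeta>)\<^sup>2) * square_sum c \<le> 4 * \<rho> ^ 3 * (12 * (real K)\<^sup>2 / of_int (int r ^ 8))"
      using mean_PZ(2) by (intro mult_mono S sum_nonneg) (auto simp: power_numeral_reduce)
    also have "\<dots> \<le> (\<tau> / 10)\<^sup>2" by (rule flux_diff_le) auto
    finally show ?thesis .
  qed
  show "nrm (\<lambda>\<omega>. Y (snd \<omega>) * form c (fst \<omega>) (snd \<omega>)) \<le> \<tau> / 10"
    using * tau_pos by (intro nrm_le) (subst mean_square_form, auto dest: c simp: flip_cols)
  show "nrm (\<lambda>\<omega>. Y (\<lambda>x. snd \<omega> (x - 1)) * form c (fst \<omega>) (snd \<omega>)) \<le> \<tau> / 10"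
    using * tau_pos mean_shift[of "\<lambda>\<zeta>. (Y \<zeta>)\<^sup>2"]
    by (intro nrm_le) (subst mean_square_form[where h = "\<lambda>\<zeta>. Y (\<lambda>x. \<zeta> (x - 1))"], auto dest: c simp: flip_cols)
qed

text \<open>The dear component after the correction: the energy \<open>2 * K / H\<close> of the flux
  is multiplied by the energy \<open>2 / L\<close> of the level increments.\<close>

lemma nrm_mu_level_diff: "nrm (\<lambda>\<omega>. \<Sum>a\<in>{1..int r}. \<Sum>j\<in>rows. (M (a - 1) (snd \<omega>) - M a (snd \<omega>)) * b j (snd \<omega>) * (fst \<omega> a * fst \<omega> (a + j))) \<le> 2 * \<tau>"
proof (rule nrm_le)
  have "mean2 (\<lambda>\<omega>. (pair_form (\<lambda>a x. mu (a - 1) x - mu a x) flux (fst \<omega>) (snd \<omega>))\<^sup>2)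
    \<le> 2 * (2 / L) * (2 * K / H)"
    by (rule mean_pair_form_le[OF _ _ mu_level_diff_square flux_square]) (auto dest: flux_support simp: mu_far)
  also have "\<dots> = 8 * real K / (L * H)" by simp
  also have "\<dots> \<le> 8 * 2 / 5 * \<tau>\<^sup>2" by (rule over_LH) simp
  also have "\<dots> \<le> (2 * \<tau>)\<^sup>2" by (simp add: power_mult_distrib)
  finally show "mean2 (\<lambda>\<omega>. (\<Sum>a\<in>{1..int r}. \<Sum>j\<in>rows. (M (a - 1) (snd \<omega>) - M a (snd \<omega>)) * b j (snd \<omega>) * (fst \<omega> a * fst \<omega> (a + j)))\<^sup>2) \<le> (2 * \<tau>)\<^sup>2"
    by (simp add: M_def b_def lin_diff)
qed (use tau_pos in simp)

text \<open>The diagonal term gains nothing from row signs, but the flux of a single row is spread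
  over many columns.\<close>

lemma nrm_M_flux_zero: "nrm (\<lambda>\<omega>. M 0 (snd \<omega>) * b 0 (snd \<omega>)) \<le> \<tau> / 10"
proof (rule nrm_le)
  have "mean2 (\<lambda>\<omega>. (M 0 (snd \<omega>) * b 0 (snd \<omega>))\<^sup>2) = mean (\<lambda>\<zeta>. (lin (mu 0) \<zeta>)\<^sup>2 * (lin (flux 0) \<zeta>)\<^sup>2)"
    by (simp add: mean2_def M_def b_def power_mult_distrib)
  also have "\<dots> = (\<Sum>x\<in>W. (mu 0 x)\<^sup>2) * (\<Sum>x\<in>W. (flux 0 x)\<^sup>2)"
    unfolding mean_square_lin1[of "flux 0", symmetric]
    by (rule mean_square_lin) (metis flux_support(1) lin_flip mu_far(1) order_refl)
  also have "\<dots> \<le> (3 * \<rho>) * (K / of_int (int r ^ 8))"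
    using mu_square(1)[of 0] two_r by (intro mult_mono flux_zero_row_square H_ge_1 sum_nonneg) auto
  also have "\<dots> = 3 * K * (\<rho> ^ 1 / \<rho> ^ 8)" by simp
  also have "\<dots> \<le> 3 * K * (1 / \<rho>)" by (intro mult_left_mono pow_ratio) auto
  also have "\<dots> \<le> (\<tau> / 10)\<^sup>2" by (rule over_rho_le) (use K_le_square in linarith)
  finally show "mean2 (\<lambda>\<omega>. (M 0 (snd \<omega>) * b 0 (snd \<omega>))\<^sup>2) \<le> (\<tau> / 10)\<^sup>2" .
qed (use tau_pos in simp)

text \<open>Here the full energy of the flux, of order at most \<open>K\<close>, is paid, and the
  smear of length \<open>r ^ 2\<close> compensates it by \<open>4 / \<rho>\<close>.\<close>

lemma nrm_PZ_flux: "nrm (\<lambda>\<omega>. - (PZ (snd \<omega>) * form flux (fst \<omega>) (snd \<omega>))) \<le> \<tau> / 10"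
  unfolding nrm_minus
proof (rule nrm_le)
  have "mean2 (\<lambda>\<omega>. (PZ (snd \<omega>) * form flux (fst \<omega>) (snd \<omega>))\<^sup>2)
     = mean (\<lambda>\<zeta>. (PZ \<zeta>)\<^sup>2) * square_sum flux"
    by (rule mean_square_form) (auto dest: flux_support simp: flip_cols)
  also have "\<dots> \<le> (4 / \<rho>) * (2 * real K)"
  proof (rule mult_mono)
    have "4 * \<rho> / real (r\<^sup>2) = 4 / \<rho>" using rho_bounds by (simp add: power2_eq_square)
    then show "mean (\<lambda>\<zeta>. (PZ \<zeta>)\<^sup>2) \<le> 4 / \<rho>" using mean_PZ(1) by simp
    show "square_sum flux \<le> 2 * real K" using flux_square two_K_over_H_le by linarith
  qed (auto intro!: sum_nonneg)
  also have "\<dots> = 8 * real K * (1 / \<rho>)" by simp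
  also have "\<dots> \<le> (\<tau> / 10)\<^sup>2" by (rule over_rho_le) (use K_le_square in linarith)
  finally show "mean2 (\<lambda>\<omega>. (PZ (snd \<omega>) * form flux (fst \<omega>) (snd \<omega>))\<^sup>2) \<le> (\<tau> / 10)\<^sup>2" .
qed (use tau_pos in simp)

lemma nrm_mu_column_diff: "nrm (\<lambda>\<omega>. pair_form (\<lambda>a x. mu (a - 1) x - mu (a - 1) (x + 1)) flux (fst \<omega>) (snd \<omega>)) \<le> 3 * \<tau>"
proof (rule nrm_le)
  have "mean2 (\<lambda>\<omega>. (pair_form (\<lambda>a x. mu (a - 1) x - mu (a - 1) (x + 1)) flux (fst \<omega>) (snd \<omega>))\<^sup>2)
    \<le> 2 * (4 / L) * (2 * K / H)"
    by (rule mean_pair_form_le[OF _ _ mu_column_diff_square flux_square]) (auto dest: flux_support simp: mu_far)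
  also have "\<dots> = 16 * real K / (L * H)" by simp
  also have "\<dots> \<le> 16 * 2 / 5 * \<tau>\<^sup>2" by (rule over_LH) simp
  also have "\<dots> \<le> (3 * \<tau>)\<^sup>2" by (simp add: power_mult_distrib)
  finally show "mean2 (\<lambda>\<omega>. (pair_form (\<lambda>a x. mu (a - 1) x - mu (a - 1) (x + 1)) flux (fst \<omega>) (snd \<omega>))\<^sup>2) \<le> (3 * \<tau>)\<^sup>2" .
qed (use tau_pos in simp)

lemma sum_mu_shift: "(\<Sum>a\<in>{1..int r}. \<Sum>x\<in>W. (mu (a - 1) (x + 1))\<^sup>2) \<le> 3 * \<rho>\<^sup>2"
  and sum_mu: "(\<Sum>a\<in>{1..int r}. \<Sum>x\<in>W. (mu (a - 1) x)\<^sup>2) \<le> 3 * \<rho>\<^sup>2"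
proof -
  have "(\<Sum>a\<in>{1..int r}. \<Sum>x\<in>W. (mu (a - 1) (x + 1))\<^sup>2) \<le> (\<Sum>a\<in>{1..int r}. 3 * \<rho>)"
    "(\<Sum>a\<in>{1..int r}. \<Sum>x\<in>W. (mu (a - 1) x)\<^sup>2) \<le> (\<Sum>a\<in>{1..int r}. 3 * \<rho>)"
    using two_r by (intro sum_mono order_trans[OF mu_square(2)] order_trans[OF mu_square(1)]; simp)+
  then show "(\<Sum>a\<in>{1..int r}. \<Sum>x\<in>W. (mu (a - 1) (x + 1))\<^sup>2) \<le> 3 * \<rho>\<^sup>2"
    "(\<Sum>a\<in>{1..int r}. \<Sum>x\<in>W. (mu (a - 1) x)\<^sup>2) \<le> 3 * \<rho>\<^sup>2"
    by (simp_all add: power2_eq_square)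
qed

lemma nrm_flux_column_diff: "nrm (\<lambda>\<omega>. pair_form (\<lambda>a x. mu (a - 1) (x + 1)) (\<lambda>j x. flux j x - flux j (x + 1)) (fst \<omega>) (snd \<omega>)) \<le> \<tau> / 10"
proof (rule nrm_le)
  have "mean2 (\<lambda>\<omega>. (pair_form (\<lambda>a x. mu (a - 1) (x + 1)) (\<lambda>j x. flux j x - flux j (x + 1)) (fst \<omega>) (snd \<omega>))\<^sup>2)
    \<le> 2 * (3 * \<rho>\<^sup>2) * (12 * (real K)\<^sup>2 / of_int (int r ^ 8))"
    by (rule mean_pair_form_le[OF _ _ sum_mu_shift flux_column_diff_square[OF H_ge_1]]) (erule flux_support(2), simp add: mu_far)
  also have "\<dots> = 6 * \<rho> ^ 2 * (12 * (real K)\<^sup>2 / of_int (int r ^ 8))" by simp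
  also have "\<dots> \<le> (\<tau> / 10)\<^sup>2" by (rule flux_diff_le) auto
  finally show "mean2 (\<lambda>\<omega>. (pair_form (\<lambda>a x. mu (a - 1) (x + 1)) (\<lambda>j x. flux j x - flux j (x + 1)) (fst \<omega>) (snd \<omega>))\<^sup>2) \<le> (\<tau> / 10)\<^sup>2" .
qed (use tau_pos in simp)

lemma nrm_mu_zero_flux: "nrm (\<lambda>\<omega>. - (lin (\<lambda>x. mu 0 x - mu 0 (x + 1)) (snd \<omega>) * form flux (fst \<omega>) (snd \<omega>))) \<le> 2 * \<tau>"
  unfolding nrm_minus
proof (rule nrm_le)
  have "mean2 (\<lambda>\<omega>. (lin (\<lambda>x. mu 0 x - mu 0 (x + 1)) (snd \<omega>) * form flux (fst \<omega>) (snd \<omega>))\<^sup>2)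
     = (\<Sum>x\<in>W. (mu 0 x - mu 0 (x + 1))\<^sup>2) * square_sum flux"
    by (rule mean_M_times_form) (auto dest: flux_support simp: mu_far)
  also have "\<dots> \<le> (2 / L) * (2 * K / H)"
    using inner.mass_pos by (intro mult_mono mu_zero_diff_square flux_square sum_nonneg) auto
  also have "\<dots> = 4 * real K / (L * H)" by simp
  also have "\<dots> \<le> 4 * 2 / 5 * \<tau>\<^sup>2" by (rule over_LH) simp
  also have "\<dots> \<le> (2 * \<tau>)\<^sup>2" by (simp add: power_mult_distrib)
  finally show "mean2 (\<lambda>\<omega>. (lin (\<lambda>x. mu 0 x - mu 0 (x + 1)) (snd \<omega>) * form flux (fst \<omega>) (snd \<omega>))\<^sup>2) \<le> (2 * \<tau>)\<^sup>2" .
qed (use tau_pos in simp)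

lemma nrm_lin_form:
  fixes d :: "int \<Rightarrow> real"
  assumes c: "\<And>j x. c j x \<noteq> 0 \<Longrightarrow> x \<le> -1-gap" and d: "\<And>x. x \<le> -1-gap \<Longrightarrow> d x = 0"
    and S: "square_sum c \<le> 12 * (real K)\<^sup>2 / of_int (int r ^ 8)"
    and D: "(\<Sum>x\<in>W. (d x)\<^sup>2) \<le> 2 * r + 1"
  shows "nrm (\<lambda>\<omega>. - (lin d (snd \<omega>) * form c (fst \<omega>) (snd \<omega>))) \<le> \<tau> / 10"
  unfolding nrm_minus
proof (rule nrm_le)
  have "mean2 (\<lambda>\<omega>. (lin d (snd \<omega>) * form c (fst \<omega>) (snd \<omega>))\<^sup>2)
     = (\<Sum>x\<in>W. (d x)\<^sup>2) * square_sum c"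
    using c d by (rule mean_M_times_form)
  also have "\<dots> \<le> 3 * \<rho> ^ 1 * (12 * (real K)\<^sup>2 / of_int (int r ^ 8))"
    using D two_r by (intro mult_mono S sum_nonneg) auto
  also have "\<dots> \<le> (\<tau> / 10)\<^sup>2" by (rule flux_diff_le) auto
  finally show "mean2 (\<lambda>\<omega>. (lin d (snd \<omega>) * form c (fst \<omega>) (snd \<omega>))\<^sup>2) \<le> (\<tau> / 10)\<^sup>2" .
qed (use tau_pos in simp)

lemma R_le_N: "int r ^ 18 \<le> N"
proof -
  have "0 \<le> int (r ^ 19)" by simp
  then show ?thesis using N_rows by linarith
qed

lemma nrm_profile_diff: "nrm (\<lambda>\<omega>. \<Sum>j\<in>W. (v \<bar>j\<bar> - v \<bar>j + 1\<bar>) * fst \<omega> j) \<le> \<tau> / 10"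
proof (rule nrm_le)
  have "mean2 (\<lambda>\<omega>. (\<Sum>j\<in>W. (v \<bar>j\<bar> - v \<bar>j + 1\<bar>) * fst \<omega> j)\<^sup>2) = (\<Sum>j\<in>W. (v \<bar>j\<bar> - v \<bar>j + 1\<bar>)\<^sup>2)"
    using mean2_rows_only[of "\<lambda>f. (\<Sum>j\<in>W. (v \<bar>j\<bar> - v \<bar>j + 1\<bar>) * f j)\<^sup>2"] mean_square_lin1[of "\<lambda>j. v \<bar>j\<bar> - v \<bar>j + 1\<bar>"]
    by (simp add: lin_def)
  also have "\<dots> \<le> 2 * (\<Sum>j\<in>{0..N}. (\<delta> (j + 1))\<^sup>2)"
    using sum_reflected_diff_le[of v] by (simp add: outer.profile_step')
  also have "(\<Sum>j\<in>{0..N}. (\<delta> (j + 1))\<^sup>2) = (\<Sum>j\<in>{1..N+1}. (\<delta> j)\<^sup>2)"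
    by (rule sum.reindex_bij_witness[of _ "\<lambda>x. x - 1" "\<lambda>x. x + 1"]) auto
  also have "\<dots> = (\<Sum>j\<in>{1..int r ^ 18}. (\<delta> j)\<^sup>2)"
    using R_le_N by (intro sum.mono_neutral_right) (auto simp: outer.step_eq_0)
  also have "\<dots> \<le> 1 / (of_int (int r ^ 8 + 1) * H)" by (rule outer.sum_step_square)
  also have "\<dots> \<le> 1 / \<rho> ^ 8"
    using H_ge_1 mult_mono[of "\<rho> ^ 8" "\<rho> ^ 8 + 1" 1 H] rho_bounds by (intro divide_left_mono mult_pos_pos) (auto intro: add_pos_pos)
  also have "\<dots> \<le> 1 / \<rho>" using pow_ratio[of 0 8] by simp
  finally have "mean2 (\<lambda>\<omega>. (\<Sum>j\<in>W. (v \<bar>j\<bar> - v \<bar>j + 1\<bar>) * fst \<omega> j)\<^sup>2) \<le> 2 * (1 / \<rho>)" by simp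
  also have "\<dots> \<le> (\<tau> / 10)\<^sup>2" by (rule over_rho_le) (use K_le_square in linarith)
  finally show "mean2 (\<lambda>\<omega>. (\<Sum>j\<in>W. (v \<bar>j\<bar> - v \<bar>j + 1\<bar>) * fst \<omega> j)\<^sup>2) \<le> (\<tau> / 10)\<^sup>2" .
qed (use tau_pos in simp)

lemma residual1_nrm: "nrm (\<lambda>\<omega>. 1 + Psi \<omega> - Psi (\<lambda>x. fst \<omega> (x - 1), snd \<omega>) - fst \<omega> 0 * g \<omega>) \<le> 33 / 10 * \<tau>"
proof -
  have "nrm (\<lambda>\<omega>. 1 + Psi \<omega> - Psi (\<lambda>x. fst \<omega> (x - 1), snd \<omega>) - fst \<omega> 0 * g \<omega>) =
    nrm (\<lambda>\<omega>. - PX (fst \<omega>) + - form (\<lambda>j x. pot j x - pot (j + 1) x) (fst \<omega>) (snd \<omega>)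
    + Y (snd \<omega>) * form (\<lambda>j x. flux j x - flux (j + 1) x) (fst \<omega>) (snd \<omega>)
    + (\<Sum>a\<in>{1..int r}. \<Sum>j\<in>rows. (M (a - 1) (snd \<omega>) - M a (snd \<omega>)) * b j (snd \<omega>) * (fst \<omega> a * fst \<omega> (a + j)))
    + M 0 (snd \<omega>) * b 0 (snd \<omega>))"
    by (rule nrm_cong) (simp only: residual1 fst_conv snd_conv)
  also have "\<dots> \<le> \<tau> / 10 + \<tau> + \<tau> / 10 + 2 * \<tau> + \<tau> / 10"
    by (intro order_trans[OF nrm_sum5] add_mono nrm_PX nrm_pot_row_diff nrm_mu_level_diff nrm_M_flux_zero nrm_Y_form(1) flux_row_diff_square[OF H_ge_1])
       (rule flux_support(3))
  finally show ?thesis by simp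
qed

lemma residual2_nrm: "nrm (\<lambda>\<omega>. Psi \<omega> - Psi (fst \<omega>, \<lambda>x. snd \<omega> (x - 1)) + snd \<omega> 0 * g \<omega>) \<le> 33 / 10 * \<tau>"
proof -
  have "nrm (\<lambda>\<omega>. Psi \<omega> - Psi (fst \<omega>, \<lambda>x. snd \<omega> (x - 1)) + snd \<omega> 0 * g \<omega>) =
    nrm (\<lambda>\<omega>. - (PZ (snd \<omega>) * form flux (fst \<omega>) (snd \<omega>))
    + Y (\<lambda>x. snd \<omega> (x - 1)) * form (\<lambda>j x. flux j x - flux j (x + 1)) (fst \<omega>) (snd \<omega>)
    + pair_form (\<lambda>a x. mu (a - 1) x - mu (a - 1) (x + 1)) flux (fst \<omega>) (snd \<omega>)
    + pair_form (\<lambda>a x. mu (a - 1) (x + 1)) (\<lambda>j x. flux j x - flux j (x + 1)) (fst \<omega>) (snd \<omega>))"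
    by (rule nrm_cong) (simp only: residual2 fst_conv snd_conv)
  also have "\<dots> \<le> \<tau> / 10 + \<tau> / 10 + 3 * \<tau> + \<tau> / 10"
    by (intro order_trans[OF nrm_sum4] add_mono nrm_PZ_flux nrm_mu_column_diff nrm_flux_column_diff nrm_Y_form(2) flux_column_diff_square[OF H_ge_1])
       (rule flux_support(2))
  finally show ?thesis by simp
qed

lemma g_column_nrm: "nrm (\<lambda>\<omega>. g \<omega> - g (fst \<omega>, \<lambda>x. snd \<omega> (x - 1))) \<le> 21 / 10 * \<tau>"
proof -
  have "nrm (\<lambda>\<omega>. g \<omega> - g (fst \<omega>, \<lambda>x. snd \<omega> (x - 1))) =
    nrm (\<lambda>\<omega>. - (lin (\<lambda>x. mu 0 x - mu 0 (x + 1)) (snd \<omega>) * form flux (fst \<omega>) (snd \<omega>))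
    + - (lin (\<lambda>x. mu 0 (x + 1)) (snd \<omega>) * form (\<lambda>j x. flux j x - flux j (x + 1)) (fst \<omega>) (snd \<omega>)))"
    by (rule nrm_cong) (simp only: g_column_diff fst_conv snd_conv)
  also have "\<dots> \<le> 2 * \<tau> + \<tau> / 10"
  proof (intro order_trans[OF nrm_triangle] add_mono nrm_mu_zero_flux)
    show "nrm (\<lambda>\<omega>. - (lin (\<lambda>x. mu 0 (x + 1)) (snd \<omega>) * form (\<lambda>j x. flux j x - flux j (x + 1)) (fst \<omega>) (snd \<omega>))) \<le> \<tau> / 10"
      by (rule nrm_lin_form[OF _ _ flux_column_diff_square[OF H_ge_1] mu_square(2)]) (erule flux_support(2), simp_all add: mu_far)
  qed
  finally show ?thesis by simp
qed

lemma g_row_nrm: "nrm (\<lambda>\<omega>. g \<omega> - g (\<lambda>x. fst \<omega> (x - 1), snd \<omega>)) \<le> 2 / 10 * \<tau>"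
proof -
  have "nrm (\<lambda>\<omega>. g \<omega> - g (\<lambda>x. fst \<omega> (x - 1), snd \<omega>)) =
    nrm (\<lambda>\<omega>. (\<Sum>j\<in>W. (v \<bar>j\<bar> - v \<bar>j + 1\<bar>) * fst \<omega> j)
    + - (lin (mu 0) (snd \<omega>) * form (\<lambda>j x. flux j x - flux (j + 1) x) (fst \<omega>) (snd \<omega>)))"
    by (rule nrm_cong) (simp only: g_row_diff fst_conv snd_conv M_def)
  also have "\<dots> \<le> \<tau> / 10 + \<tau> / 10"
  proof (intro order_trans[OF nrm_triangle] add_mono nrm_profile_diff)
    show "nrm (\<lambda>\<omega>. - (lin (mu 0) (snd \<omega>) * form (\<lambda>j x. flux j x - flux (j + 1) x) (fst \<omega>) (snd \<omega>))) \<le> \<tau> / 10"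
      by (rule nrm_lin_form[OF _ _ flux_row_diff_square[OF H_ge_1] mu_square(1)]) (erule flux_support(3), simp_all add: mu_far)
  qed
  finally show ?thesis by simp
qed

lemma rho_pow_le: "c \<le> \<rho> ^ i \<Longrightarrow> i + j \<le> 38 \<Longrightarrow> c * \<rho> ^ j \<le> (\<rho> ^ 19)\<^sup>2"
proof -
  assume c: "c \<le> \<rho> ^ i" and ij: "i + j \<le> 38"
  have "c * \<rho> ^ j \<le> \<rho> ^ (i + j)" unfolding power_add using c by (intro mult_right_mono) auto
  also have "\<dots> \<le> \<rho> ^ 38" using ij rho_bounds by (intro power_increasing) auto
  finally show ?thesis by (simp add: power_mult[symmetric])
qed

lemma flux_square_le_rho: "square_sum flux \<le> 2 * \<rho>"
  using order_trans[OF flux_square two_K_over_H_le] rho_bounds by simp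

text \<open>A crude bound suffices, as \<open>Psi\<close> enters only with a frequency of at most
  \<open>7 / \<rho> ^ 20\<close> in front. The largest exponent comes from \<open>Psi1\<close>,
  whose variance is of order \<open>m * R = \<rho> ^ 37\<close>.\<close>

lemma Psi_nrm: "nrm Psi \<le> 7 * \<rho> ^ 19"
proof -
  have 1: "nrm (\<lambda>\<omega>. Psi1 (fst \<omega>)) \<le> 2 * \<rho> ^ 19"
  proof (rule nrm_le)
    have "mean (\<lambda>\<xi>. (Psi1 \<xi>)\<^sup>2) \<le> 4 * (1 * \<rho> ^ 37)" using mean_PX(2) by (simp add: power_add[symmetric])
    also have "\<dots> \<le> 4 * (\<rho> ^ 19)\<^sup>2" using rho_bounds by (intro mult_left_mono rho_pow_le[of _ 0]) auto
    finally show "mean2 (\<lambda>\<omega>. (Psi1 (fst \<omega>))\<^sup>2) \<le> (2 * \<rho> ^ 19)\<^sup>2"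
      using mean2_rows_only[of "\<lambda>\<xi>. (Psi1 \<xi>)\<^sup>2"] by (simp add: power_mult_distrib)
  qed simp
  have 2: "nrm (\<lambda>\<omega>. Psi2 (fst \<omega>) (snd \<omega>)) \<le> 3 * \<rho> ^ 19"
    unfolding Psi2_def nrm_minus
  proof (rule nrm_le)
    have "mean2 (\<lambda>\<omega>. (form pot (fst \<omega>) (snd \<omega>))\<^sup>2) \<le> of_int ((2 * int r ^ 18 + 1) * (int r ^ 18 + gap + 1))"
      using mean_square_form[of pot "\<lambda>_. 1"] pot_square by simp
    also have "\<dots> \<le> (3 * \<rho> ^ 18) * (3 * \<rho> ^ 18)"
    proof -
      have "\<rho> \<le> \<rho> ^ 18" "1 \<le> \<rho> ^ 18" using rho_bounds by (auto intro: self_le_power one_le_power)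
      then have "2 * \<rho> ^ 18 + 1 \<le> 3 * \<rho> ^ 18" "\<rho> ^ 18 + (\<rho> + 3) \<le> 3 * \<rho> ^ 18" using rho_bounds by linarith+
      then have "(2 * \<rho> ^ 18 + 1) * (\<rho> ^ 18 + (\<rho> + 3)) \<le> (3 * \<rho> ^ 18) * (3 * \<rho> ^ 18)"
        by (intro mult_mono) auto
      then show ?thesis by (simp add: gap_def add_ac)
    qed
    also have "\<dots> = 9 * (1 * \<rho> ^ 36)" by (simp add: power_add[symmetric])
    also have "\<dots> \<le> 9 * (\<rho> ^ 19)\<^sup>2" using rho_bounds by (intro mult_left_mono rho_pow_le[of _ 0]) auto
    finally show "mean2 (\<lambda>\<omega>. (form pot (fst \<omega>) (snd \<omega>))\<^sup>2) \<le> (3 * \<rho> ^ 19)\<^sup>2"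
      by (simp add: power_mult_distrib)
  qed simp
  have 3: "nrm (\<lambda>\<omega>. Y (snd \<omega>) * B (fst \<omega>) (snd \<omega>)) \<le> \<rho> ^ 19"
    unfolding B_def b_def
  proof (rule nrm_le)
    have "mean2 (\<lambda>\<omega>. (Y (snd \<omega>) * form flux (fst \<omega>) (snd \<omega>))\<^sup>2)
      = mean (\<lambda>\<zeta>. (Y \<zeta>)\<^sup>2) * square_sum flux"
      by (rule mean_square_form) (auto dest: flux_support simp: flip_cols)
    also have "\<dots> \<le> (4 * \<rho> ^ 3) * (2 * \<rho>)"
      using mean_PZ(2) by (intro mult_mono flux_square_le_rho sum_nonneg) (auto simp: power_numeral_reduce)
    also have "\<dots> = 8 * \<rho> ^ 4" by (simp add: power_numeral_reduce)
    also have "\<dots> \<le> (\<rho> ^ 19)\<^sup>2" using rho_bounds by (intro rho_pow_le[of _ 1]) auto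
    finally show "mean2 (\<lambda>\<omega>. (Y (snd \<omega>) * form flux (fst \<omega>) (snd \<omega>))\<^sup>2) \<le> (\<rho> ^ 19)\<^sup>2" .
  qed simp
  have 4: "nrm (\<lambda>\<omega>. Psi4 (fst \<omega>) (snd \<omega>)) \<le> \<rho> ^ 19"
    unfolding Psi4_def M_def b_def
  proof (rule nrm_le)
    have "mean2 (\<lambda>\<omega>. (pair_form (\<lambda>a. mu (a - 1)) flux (fst \<omega>) (snd \<omega>))\<^sup>2)
      \<le> 2 * (3 * \<rho>\<^sup>2) * (2 * \<rho>)"
      by (rule mean_pair_form_le[OF _ _ sum_mu flux_square_le_rho]) (auto dest: flux_support(1) simp: mu_far)
    also have "\<dots> = 12 * \<rho> ^ 3" by (simp add: power_numeral_reduce)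
    also have "\<dots> \<le> (\<rho> ^ 19)\<^sup>2"
    proof (rule rho_pow_le[of _ 2])
      have "8 * 8 \<le> \<rho> * \<rho>" using rho_bounds by (intro mult_mono) auto
      then show "12 \<le> \<rho>\<^sup>2" by (simp add: power2_eq_square)
    qed simp
    finally show "mean2 (\<lambda>\<omega>. (pair_form (\<lambda>a. mu (a - 1)) flux (fst \<omega>) (snd \<omega>))\<^sup>2) \<le> (\<rho> ^ 19)\<^sup>2" .
  qed simp
  have "nrm Psi = nrm (\<lambda>\<omega>. Psi1 (fst \<omega>) + Psi2 (fst \<omega>) (snd \<omega>) + Y (snd \<omega>) * B (fst \<omega>) (snd \<omega>) + Psi4 (fst \<omega>) (snd \<omega>))"
    by (rule nrm_cong) simp
  also have "\<dots> \<le> 2 * \<rho> ^ 19 + 3 * \<rho> ^ 19 + \<rho> ^ 19 + \<rho> ^ 19"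
    by (intro order_trans[OF nrm_sum4] add_mono 1 2 3 4)
  finally show ?thesis by simp
qed

lemma g_nrm: "nrm g \<le> 2 * \<rho> ^ 19"
proof -
  have 1: "nrm (\<lambda>\<omega>. G1 (fst \<omega>)) \<le> \<rho> ^ 19"
  proof (rule nrm_le)
    have "mean (\<lambda>\<xi>. (G1 \<xi>)\<^sup>2) = (\<Sum>j\<in>W. (v \<bar>j\<bar>)\<^sup>2)"
      using mean_square_lin1[of "\<lambda>j. v \<bar>j\<bar>"] by (simp add: lin_def G1_def)
    also have "\<dots> = (\<Sum>j\<in>{-(int r ^ 18)..int r ^ 18}. (v \<bar>j\<bar>)\<^sup>2)"
      using R_le_N by (intro sum.mono_neutral_right) (auto simp: outer.profile_eq_0)
    also have "\<dots> \<le> (\<Sum>j\<in>{-(int r ^ 18)..int r ^ 18}. 1)" by (intro sum_mono outer.profile_square_le_1)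
    also have "\<dots> = 2 * \<rho> ^ 18 + 1" by (simp add: nat_add_distrib)
    also have "\<dots> \<le> 3 * \<rho> ^ 18" using one_le_power[OF rho_bounds(1), of 18] by simp
    also have "\<dots> \<le> (\<rho> ^ 19)\<^sup>2" using rho_bounds by (intro rho_pow_le[of _ 1]) auto
    finally show "mean2 (\<lambda>\<omega>. (G1 (fst \<omega>))\<^sup>2) \<le> (\<rho> ^ 19)\<^sup>2" using mean2_rows_only[of "\<lambda>\<xi>. (G1 \<xi>)\<^sup>2"] by simp
  qed simp
  have 2: "nrm (\<lambda>\<omega>. - (M 0 (snd \<omega>) * B (fst \<omega>) (snd \<omega>))) \<le> \<rho> ^ 19"
    unfolding nrm_minus M_def B_def b_def
  proof (rule nrm_le)
    have "mean2 (\<lambda>\<omega>. (lin (mu 0) (snd \<omega>) * form flux (fst \<omega>) (snd \<omega>))\<^sup>2)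
      = (\<Sum>x\<in>W. (mu 0 x)\<^sup>2) * square_sum flux"
      by (rule mean_M_times_form) (auto dest: flux_support simp: mu_far)
    also have "\<dots> \<le> (3 * \<rho>) * (2 * \<rho>)"
      using mu_square(1)[of 0] two_r by (intro mult_mono flux_square_le_rho sum_nonneg) auto
    also have "\<dots> = 6 * \<rho> ^ 2" by (simp add: power_numeral_reduce)
    also have "\<dots> \<le> (\<rho> ^ 19)\<^sup>2" using rho_bounds by (intro rho_pow_le[of _ 1]) auto
    finally show "mean2 (\<lambda>\<omega>. (lin (mu 0) (snd \<omega>) * form flux (fst \<omega>) (snd \<omega>))\<^sup>2) \<le> (\<rho> ^ 19)\<^sup>2" .
  qed simp
  have "nrm g = nrm (\<lambda>\<omega>. G1 (fst \<omega>) + - (M 0 (snd \<omega>) * B (fst \<omega>) (snd \<omega>)))"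
    by (rule nrm_cong) simp
  also have "\<dots> \<le> \<rho> ^ 19 + \<rho> ^ 19"
    by (intro order_trans[OF nrm_triangle] add_mono 1 2)
  finally show ?thesis by simp
qed

text \<open>In units of \<open>\<tau>\<close>, the residuals contribute 33/10, the increments of
  \<open>g\<close> at most 21/10 and each of the two phase errors 1/10. The third estimate serves
  the term of the duality bound in which \<open>l\<close> multiplies the squared norm of
  \<open>g\<close>.\<close>

lemma corrector_cost:
  assumes k: "k1 \<ge> 0" "k2 \<ge> 0" "k1 * \<rho> ^ 20 \<le> 7" "k2 * \<rho> ^ 20 \<le> 7"
  shows "L2_set (\<lambda>\<omega>. 1 + Psi \<omega> - Psi (\<lambda>x. fst \<omega> (x - 1), snd \<omega>) - fst \<omega> 0 * g \<omega>) (Or \<times> Or) + k2 * L2_set Psi (Or \<times> Or)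
      + L2_set (\<lambda>\<omega>. g (fst \<omega>, \<lambda>x. snd \<omega> (x + 1)) - g \<omega>) (Or \<times> Or) + k1 * L2_set g (Or \<times> Or) \<le> card Or * (6 * \<tau>)" (is ?A)
    and "L2_set (\<lambda>\<omega>. Psi \<omega> - Psi (fst \<omega>, \<lambda>x. snd \<omega> (x - 1)) + snd \<omega> 0 * g \<omega>) (Or \<times> Or) + k1 * L2_set Psi (Or \<times> Or)
      + L2_set (\<lambda>\<omega>. g (\<lambda>x. fst \<omega> (x + 1), snd \<omega>) - g \<omega>) (Or \<times> Or) + k2 * L2_set g (Or \<times> Or) \<le> card Or * (6 * \<tau>)" (is ?B)
    and "(k1 * L2_set g (Or \<times> Or))\<^sup>2 \<le> (card Or * \<tau>)\<^sup>2" (is ?C)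
proof -
  \<comment> \<open>49 is the 7 of \<open>Psi_nrm\<close> times the 7 in the bound on the
    frequencies.\<close>
  have s: "49 / \<rho> \<le> \<tau> / 10"
  proof -
    have "49 / \<rho> \<le> 72 * (real K)\<^sup>2 / \<rho>" using K_le_square rho_bounds by (intro divide_right_mono) auto
    then have "49 / \<rho> \<le> (\<tau> / 10)\<^sup>2" by (rule le_tau_square)
    also have "\<dots> \<le> \<tau> / 10" using tau_pos tau_le_1 unfolding power2_eq_square by (intro mult_left_le) auto
    finally show ?thesis .
  qed
  have kP: "k * (7 * \<rho> ^ 19) \<le> \<tau> / 10" if "k * \<rho> ^ 20 \<le> 7" for k
  proof -
    have "k * (7 * \<rho> ^ 19) * \<rho> = 7 * (k * (\<rho> ^ 19 * \<rho>))" by simp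
    also have "\<rho> ^ 19 * \<rho> = \<rho> ^ 20" unfolding power_Suc2[symmetric] by simp
    finally have e: "k * (7 * \<rho> ^ 19) * \<rho> = 7 * (k * \<rho> ^ 20)" .
    have "k * (7 * \<rho> ^ 19) * \<rho> \<le> 49" unfolding e using that by simp
    then have "k * (7 * \<rho> ^ 19) \<le> 49 / \<rho>" using rho_bounds by (simp add: le_divide_eq)
    then show ?thesis using s by simp
  qed
  have kPsi: "k * nrm Psi \<le> \<tau> / 10" and kg: "k * nrm g \<le> \<tau> / 10" if "k \<ge> 0" "k * \<rho> ^ 20 \<le> 7" for k
  proof -
    have "2 * \<rho> ^ 19 \<le> 7 * \<rho> ^ 19" by simp
    then have "nrm g \<le> 7 * \<rho> ^ 19" using g_nrm by linarith
    then show "k * nrm Psi \<le> \<tau> / 10" "k * nrm g \<le> \<tau> / 10"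
      using Psi_nrm kP[OF that(2)] that(1) by (meson mult_left_mono order_trans)+
  qed
  have "nrm (\<lambda>\<omega>. 1 + Psi \<omega> - Psi (\<lambda>x. fst \<omega> (x - 1), snd \<omega>) - fst \<omega> 0 * g \<omega>) + k2 * nrm Psi
     + nrm (\<lambda>\<omega>. g (fst \<omega>, \<lambda>x. snd \<omega> (x + 1)) - g \<omega>) + k1 * nrm g \<le> 6 * \<tau>"
    using residual1_nrm g_column_nrm kPsi[OF k(2,4)] kg[OF k(1,3)] tau_pos unfolding nrm_column_shift by linarith
  from mult_left_mono[OF this, of "real (card Or)"] show ?A
    unfolding L2_set_eq_nrm by (simp add: algebra_simps)
  have "nrm (\<lambda>\<omega>. Psi \<omega> - Psi (fst \<omega>, \<lambda>x. snd \<omega> (x - 1)) + snd \<omega> 0 * g \<omega>) + k1 * nrm Psi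
     + nrm (\<lambda>\<omega>. g (\<lambda>x. fst \<omega> (x + 1), snd \<omega>) - g \<omega>) + k2 * nrm g \<le> 6 * \<tau>"
    using residual2_nrm g_row_nrm kPsi[OF k(1,3)] kg[OF k(2,4)] tau_pos unfolding nrm_row_shift by linarith
  from mult_left_mono[OF this, of "real (card Or)"] show ?B
    unfolding L2_set_eq_nrm by (simp add: algebra_simps)
  have "0 \<le> k1 * nrm g" using k(1) nrm_nonneg[of g] by simp
  moreover have "k1 * nrm g \<le> \<tau>" using kg[OF k(1,3)] tau_pos by simp
  ultimately have "card Or * (k1 * nrm g) \<le> card Or * \<tau>" "0 \<le> card Or * (k1 * nrm g)"
    by (auto intro: mult_left_mono)
  then show ?C unfolding L2_set_eq_nrm by (intro power_mono) (auto simp: mult_ac)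
qed

end

section \<open>Fourier modes of the Green function\<close>

definition walk_op :: "complex \<Rightarrow> complex \<Rightarrow> (lines \<Rightarrow> complex) \<Rightarrow> lines \<Rightarrow> complex" where
  "walk_op z1 z2 f \<omega> =
    (if fst \<omega> 0 = 1 then z1 * f (fst \<omega>, \<lambda>x. snd \<omega> (x + 1)) else cnj z1 * f (fst \<omega>, \<lambda>x. snd \<omega> (x - 1))) +
    (if snd \<omega> 0 = 1 then z2 * f (\<lambda>x. fst \<omega> (x + 1), snd \<omega>) else cnj z2 * f (\<lambda>x. fst \<omega> (x - 1), snd \<omega>))"

primrec walk_sum :: "complex \<Rightarrow> complex \<Rightarrow> nat \<Rightarrow> lines \<Rightarrow> complex" where
  "walk_sum z1 z2 0 = (\<lambda>_. 1)"
| "walk_sum z1 z2 (Suc n) = walk_op z1 z2 (walk_sum z1 z2 n)"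

text \<open>The Neumann series of the resolvent at \<open>2 + l\<close>; one application of
  \<open>walk_op\<close> at most doubles the supremum norm.\<close>

definition green :: "complex \<Rightarrow> complex \<Rightarrow> real \<Rightarrow> lines \<Rightarrow> complex" where
  "green z1 z2 l \<omega> = (\<Sum>n. walk_sum z1 z2 n \<omega> / of_real ((2 + l) ^ Suc n))"

text \<open>Reflection in the diagonal exchanges rows and columns. It permits the larger frequency
  to be taken as the first one.\<close>

lemma walk_sum_swap: "walk_sum z1 z2 n (\<xi>, \<zeta>) = walk_sum z2 z1 n (\<zeta>, \<xi>)"
  by (induction n arbitrary: \<xi> \<zeta>) (simp_all add: walk_op_def add.commute)

lemma green_swap: "green z1 z2 l (\<xi>, \<zeta>) = green z2 z1 l (\<zeta>, \<xi>)"
  by (simp add: green_def walk_sum_swap)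

lemma norm_walk_sum:
  assumes "cmod z1 = 1" "cmod z2 = 1"
  shows "cmod (walk_sum z1 z2 n \<omega>) \<le> 2 ^ n"
proof (induction n arbitrary: \<omega>)
  case (Suc n)
  have 1: "cmod (walk_sum z1 z2 (Suc n) \<omega>) \<le> 2 ^ n + 2 ^ n"
    unfolding walk_sum.simps walk_op_def
    by (rule norm_triangle_le, rule add_mono) (auto simp: norm_mult assms Suc)
  then show ?case by simp
qed simp

lemma sums_half_geometric:
  assumes "l > 0" shows "(\<lambda>n. 2 ^ n / (2 + l) ^ Suc n) sums (1 / (l::real))"
proof -
  have "(\<lambda>n. (1 / (2 + l)) * (2 / (2 + l)) ^ n) sums ((1 / (2 + l)) * (1 / (1 - 2 / (2 + l))))"
    using assms by (intro sums_mult geometric_sums) auto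
  moreover have "(1 / (2 + l)) * (1 / (1 - 2 / (2 + l))) = 1 / l" using assms by (simp add: field_simps)
  ultimately show ?thesis by (simp add: power_divide)
qed

context
  fixes z1 z2 :: complex and l :: real
  assumes z: "cmod z1 = 1" "cmod z2 = 1" and l: "l > 0"
begin

lemma norm_green_term: "cmod (walk_sum z1 z2 n \<omega> / of_real ((2 + l) ^ Suc n)) \<le> 2 ^ n / (2 + l) ^ Suc n"
  using norm_walk_sum[OF z, of n \<omega>] l
  by (simp add: norm_divide norm_mult norm_power divide_right_mono del: of_real_add)

lemma summable_green: "summable (\<lambda>n. walk_sum z1 z2 n \<omega> / of_real ((2 + l) ^ Suc n))"
  by (rule summable_comparison_test'[OF sums_summable[OF sums_half_geometric[OF l]]]) (rule norm_green_term)

lemma green_sums: "(\<lambda>n. walk_sum z1 z2 n \<omega> / of_real ((2 + l) ^ Suc n)) sums green z1 z2 l \<omega>"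
  unfolding green_def using summable_green by (rule summable_sums)

lemma norm_green_le: "cmod (green z1 z2 l \<omega>) \<le> 1 / l"
proof -
  have "cmod (green z1 z2 l \<omega>) \<le> (\<Sum>n. 2 ^ n / (2 + l) ^ Suc n)"
    unfolding green_def by (rule norm_suminf_le[OF norm_green_term sums_summable[OF sums_half_geometric[OF l]]])
  then show ?thesis using sums_half_geometric[OF l] by (simp add: sums_iff)
qed

lemma green_equation: "(2 + of_real l) * green z1 z2 l \<omega> - walk_op z1 z2 (green z1 z2 l) \<omega> = 1"
proof -
  have "(\<lambda>n. walk_op z1 z2 (\<lambda>\<omega>. walk_sum z1 z2 n \<omega> / of_real ((2 + l) ^ Suc n)) \<omega>) sums walk_op z1 z2 (green z1 z2 l) \<omega>"
    unfolding walk_op_def by (cases "fst \<omega> 0 = 1"; cases "snd \<omega> 0 = 1"; simp only: if_True if_False simp_thms) (intro sums_add sums_mult green_sums)+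
  moreover have "walk_op z1 z2 (\<lambda>\<omega>. walk_sum z1 z2 n \<omega> / of_real ((2 + l) ^ Suc n)) \<omega> =
    walk_sum z1 z2 (Suc n) \<omega> / of_real ((2 + l) ^ Suc n)" for n
    by (simp add: walk_op_def add_divide_distrib)
  ultimately have 1: "(\<lambda>n. walk_sum z1 z2 (Suc n) \<omega> / of_real ((2 + l) ^ Suc n)) sums walk_op z1 z2 (green z1 z2 l) \<omega>" by simp
  have "(\<lambda>n. (2 + of_real l) * (walk_sum z1 z2 n \<omega> / of_real ((2 + l) ^ Suc n))) sums ((2 + of_real l) * green z1 z2 l \<omega>)"
    by (intro sums_mult green_sums)
  moreover have "(2 + of_real l) * (w / of_real ((2 + l) ^ Suc n)) = w / of_real ((2 + l) ^ n)" for w :: complex and n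
  proof -
    have "of_real (2 + l) \<noteq> (0::complex)" using l by (simp del: of_real_add)
    then show ?thesis by simp
  qed
  ultimately have "(\<lambda>n. walk_sum z1 z2 n \<omega> / of_real ((2 + l) ^ n)) sums ((2 + of_real l) * green z1 z2 l \<omega>)" by simp
  then have "(\<lambda>n. walk_sum z1 z2 (Suc n) \<omega> / of_real ((2 + l) ^ Suc n)) sums ((2 + of_real l) * green z1 z2 l \<omega> - 1)"
    by (subst sums_Suc_iff) simp
  with 1 have "walk_op z1 z2 (green z1 z2 l) \<omega> = (2 + of_real l) * green z1 z2 l \<omega> - 1" by (rule sums_unique2)
  then show ?thesis by simp
qed

end

context periodic
begin

definition green_mean :: "complex \<Rightarrow> complex \<Rightarrow> real \<Rightarrow> real" where
  "green_mean z1 z2 l = Re (\<Sum>\<omega>\<in>Or \<times> Or. green z1 z2 l \<omega>) / (card Or)\<^sup>2"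

lemma green_mean_swap: "green_mean z1 z2 l = green_mean z2 z1 l"
proof -
  have "(\<Sum>\<omega>\<in>Or \<times> Or. green z1 z2 l \<omega>) = (\<Sum>\<omega>\<in>Or \<times> Or. green z2 z1 l \<omega>)"
    by (rule sum.reindex_bij_witness[of _ prod.swap prod.swap]) (auto simp: green_swap[of z2 z1])
  then show ?thesis by (simp add: green_mean_def)
qed

lemma card_pairs: "real (card (Or \<times> Or)) = (real (card Or))\<^sup>2"
  by (simp add: card_cartesian_product power2_eq_square)

lemma green_mean_le:
  assumes "cmod z1 = 1" "cmod z2 = 1" "l > 0"
  shows "green_mean z1 z2 l \<le> 1 / l"
proof -
  have "Re (\<Sum>\<omega>\<in>Or \<times> Or. green z1 z2 l \<omega>) \<le> (\<Sum>\<omega>\<in>Or \<times> Or. 1 / l)"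
    unfolding Re_sum using norm_green_le[OF assms] complex_Re_le_cmod order_trans by (intro sum_mono) blast
  also have "\<dots> = (real (card Or))\<^sup>2 * (1 / l)" by (simp add: card_cartesian_product power2_eq_square)
  finally show ?thesis using card_orientations_pos unfolding green_mean_def by (simp add: divide_le_eq mult.commute)
qed

lemma sign_or: "f \<in> Or \<Longrightarrow> f a = 1 \<or> f a = -1" by (simp add: orientations_def)

lemma shift_in_pairs:
  assumes "\<omega> \<in> Or \<times> Or"
  shows "(fst \<omega>, \<lambda>x. snd \<omega> (x + 1)) \<in> Or \<times> Or" "(fst \<omega>, \<lambda>x. snd \<omega> (x - 1)) \<in> Or \<times> Or"
    "(\<lambda>x. fst \<omega> (x + 1), snd \<omega>) \<in> Or \<times> Or" "(\<lambda>x. fst \<omega> (x - 1), snd \<omega>) \<in> Or \<times> Or"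
    "fst \<omega> 0 = 1 \<or> fst \<omega> 0 = -1" "snd \<omega> 0 = 1 \<or> snd \<omega> 0 = -1"
proof -
  have 1: "fst \<omega> \<in> Or" "snd \<omega> \<in> Or" using assms by auto
  show "(fst \<omega>, \<lambda>x. snd \<omega> (x + 1)) \<in> Or \<times> Or" "(\<lambda>x. fst \<omega> (x + 1), snd \<omega>) \<in> Or \<times> Or"
    using 1 by (simp_all add: shift_in_orientations)
  have "(\<lambda>x. f (x - 1)) \<in> Or" if "f \<in> Or" for f
    using shift_in_orientations[OF that, of "-1"] by simp
  then show "(fst \<omega>, \<lambda>x. snd \<omega> (x - 1)) \<in> Or \<times> Or" "(\<lambda>x. fst \<omega> (x - 1), snd \<omega>) \<in> Or \<times> Or"
    using 1 by simp_all
  show "fst \<omega> 0 = 1 \<or> fst \<omega> 0 = -1" "snd \<omega> 0 = 1 \<or> snd \<omega> 0 = -1"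
    by (rule sign_or[OF 1(1)], rule sign_or[OF 1(2)])
qed

text \<open>A horizontal step translates the columns and is steered by the sign of the walker's own
  row, which it does not change.\<close>

lemma signed_shift_columns:
  "cmod z = 1 \<Longrightarrow> signed_shift (Or \<times> Or) (\<lambda>\<omega>. (fst \<omega>, \<lambda>x. snd \<omega> (x + 1))) (\<lambda>\<omega>. (fst \<omega>, \<lambda>x. snd \<omega> (x - 1))) (\<lambda>\<omega>. fst \<omega> 0) z"
  by unfold_locales (simp_all only: shift_in_pairs finite_cartesian_product finite_orientations, simp_all)

lemma signed_shift_rows:
  "cmod z = 1 \<Longrightarrow> signed_shift (Or \<times> Or) (\<lambda>\<omega>. (\<lambda>x. fst \<omega> (x + 1), snd \<omega>)) (\<lambda>\<omega>. (\<lambda>x. fst \<omega> (x - 1), snd \<omega>)) (\<lambda>\<omega>. snd \<omega> 0) z"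
  by unfold_locales (simp_all only: shift_in_pairs finite_cartesian_product finite_orientations, simp_all)

lemma green_mean_bound:
  fixes \<Psi> g :: "lines \<Rightarrow> real"
  assumes z: "cmod z1 = 1" "cmod z2 = 1" and l: "l > 0" and z1: "z1 \<noteq> 1"
    and g0: "(\<Sum>\<omega>\<in>Or \<times> Or. g \<omega>) = 0"
    and A1: "L2_set (\<lambda>\<omega>. 1 + \<Psi> \<omega> - \<Psi> (\<lambda>x. fst \<omega> (x - 1), snd \<omega>) - fst \<omega> 0 * g \<omega>) (Or \<times> Or) + cmod (1 - z2) * L2_set \<Psi> (Or \<times> Or)
      + L2_set (\<lambda>\<omega>. g (fst \<omega>, \<lambda>x. snd \<omega> (x + 1)) - g \<omega>) (Or \<times> Or) + cmod (1 - z1) * L2_set g (Or \<times> Or) \<le> A1"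
    and A2: "L2_set (\<lambda>\<omega>. \<Psi> \<omega> - \<Psi> (fst \<omega>, \<lambda>x. snd \<omega> (x - 1)) + snd \<omega> 0 * g \<omega>) (Or \<times> Or) + cmod (1 - z1) * L2_set \<Psi> (Or \<times> Or)
      + L2_set (\<lambda>\<omega>. g (\<lambda>x. fst \<omega> (x + 1), snd \<omega>) - g \<omega>) (Or \<times> Or) + cmod (1 - z2) * L2_set g (Or \<times> Or) \<le> A2"
  shows "(cmod (1 - z1))\<^sup>2 * green_mean z1 z2 l * (card Or)\<^sup>2 \<le> l * (L2_set g (Or \<times> Or))\<^sup>2 + 2 * (A1\<^sup>2 + A2\<^sup>2)"
proof -
  interpret p: signed_shift_pair "Or \<times> Or"
    "\<lambda>\<omega>. (fst \<omega>, \<lambda>x. snd \<omega> (x + 1))" "\<lambda>\<omega>. (fst \<omega>, \<lambda>x. snd \<omega> (x - 1))" "\<lambda>\<omega>. fst \<omega> 0" z1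
    "\<lambda>\<omega>. (\<lambda>x. fst \<omega> (x + 1), snd \<omega>)" "\<lambda>\<omega>. (\<lambda>x. fst \<omega> (x - 1), snd \<omega>)" "\<lambda>\<omega>. snd \<omega> 0" z2
    by (intro signed_shift_pair.intro signed_shift_columns signed_shift_rows z signed_shift_pair_axioms.intro) simp
  have "(cmod (1 - z1))\<^sup>2 * Re (\<Sum>\<omega>\<in>Or \<times> Or. green z1 z2 l \<omega>) \<le> l * (L2_set g (Or \<times> Or))\<^sup>2 + 2 * (A1\<^sup>2 + A2\<^sup>2)"
  proof (rule p.resolvent_bound[where \<Psi> = \<Psi>])
    fix \<omega> assume "\<omega> \<in> Or \<times> Or"
    show "(2 + complex_of_real l) * green z1 z2 l \<omega> - p.h.T (green z1 z2 l) \<omega> - p.v.T (green z1 z2 l) \<omega> = 1"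
      using green_equation[OF z l, of \<omega>] unfolding p.h.T_def p.v.T_def walk_op_def by (simp add: algebra_simps)
  qed (use l z1 g0 A1 A2 in simp_all)
  then show ?thesis using card_orientations_pos by (simp add: green_mean_def)
qed

lemma green_mean_trivial:
  assumes z: "cmod z1 = 1" "cmod z2 = 1" and l: "l > 0" and z1: "z1 \<noteq> 1"
  shows "(cmod (1 - z1))\<^sup>2 * green_mean z1 z2 l \<le> 2"
proof -
  have c: "L2_set (\<lambda>_. 1) (Or \<times> Or) = card Or"
    by (simp add: L2_set_def card_cartesian_product)
  have "(cmod (1 - z1))\<^sup>2 * green_mean z1 z2 l * (card Or)\<^sup>2 \<le> 2 * (card Or)\<^sup>2"
    using green_mean_bound[OF z l z1, of "\<lambda>_. 0" "\<lambda>_. 0" "card Or" 0] c by (simp add: L2_set_def)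
  then show ?thesis using card_orientations_pos by simp
qed

lemma green_mean_corrector:
  assumes z: "cmod z1 = 1" "cmod z2 = 1" and l: "l > 0" "l \<le> (cmod (1 - z1))\<^sup>2"
    and K: "K \<ge> 6" and small: "cmod (1 - z1) * 2 ^ (20 * K\<^sup>2) \<le> 7" "cmod (1 - z2) * 2 ^ (20 * K\<^sup>2) \<le> 7"
    and Q: "2 ^ (20 * K\<^sup>2) \<le> Q"
  shows "(cmod (1 - z1))\<^sup>2 * green_mean z1 z2 l \<le> 145 / real K ^ 3"
proof -
  define r :: nat where "r = 2 ^ (K\<^sup>2)"
  have r20: "int r ^ 20 = 2 ^ (20 * K\<^sup>2)" "real r ^ 20 = 2 ^ (20 * K\<^sup>2)"
    by (simp_all add: r_def power_mult[symmetric] mult.commute)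
  have "36 \<le> K\<^sup>2" using power_mono[OF K, of 2] by simp
  then have "(2::nat) ^ 36 \<le> r" unfolding r_def by (intro power_increasing) auto
  then have r: "r \<ge> 64" by simp
  have rpow: "int r ^ i \<ge> 1" "i < j \<Longrightarrow> 64 * int r ^ i \<le> int r ^ j" for i j
  proof -
    show "int r ^ i \<ge> 1" using r by (intro one_le_power) simp
    assume "i < j"
    then have "int r ^ Suc i \<le> int r ^ j" using r by (intro power_increasing) auto
    moreover have "64 * int r ^ i \<le> int r * int r ^ i" using r by (intro mult_right_mono) auto
    ultimately show "64 * int r ^ i \<le> int r ^ j" by simp
  qed
  \<comment> \<open>The longest object is the row smear, of length \<open>r ^ 19\<close> up to lower
    powers; \<open>Q \<ge> r ^ 20\<close> leaves room for the doubled window since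
    \<open>r \<ge> 64\<close>.\<close>
  interpret s: scaled_corrector Q "2 * int r ^ 19" K r
  proof unfold_locales
    show "2 * (2 * int r ^ 19) < Q" using rpow(2)[of 19 20] rpow(1)[of 19] r20 Q by linarith
    show "int r ^ 8 < int r ^ 18" using rpow(2)[of 8 18] rpow(1)[of 8] by linarith
    show "int (r ^ 19) + int r ^ 18 + 3 + int r \<le> 2 * int r ^ 19"
      using rpow(2)[of 18 19] rpow(2)[of 1 19] rpow(1)[of 1] by simp
    show "int r ^ 18 + int (r\<^sup>2) + 2 * int r + 5 \<le> 2 * int r ^ 19"
      using rpow(2)[of 18 19] rpow(2)[of 1 19] rpow(2)[of 2 19] rpow(1)[of 1] by simp
  qed (use K r rpow(1) in \<open>auto simp: r_def\<close>)
  have z1: "z1 \<noteq> 1" using l by auto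
  have k: "cmod (1 - z1) * real r ^ 20 \<le> 7" "cmod (1 - z2) * real r ^ 20 \<le> 7" using small by (simp_all add: r20)
  note cost = s.corrector_cost[OF norm_ge_zero norm_ge_zero k]
  have "(cmod (1 - z1))\<^sup>2 * green_mean z1 z2 l * (card Or)\<^sup>2
     \<le> l * (L2_set s.g (Or \<times> Or))\<^sup>2 + 2 * ((card Or * (6 * s.\<tau>))\<^sup>2 + (card Or * (6 * s.\<tau>))\<^sup>2)"
    by (rule green_mean_bound[OF z l(1) z1 s.sum_g cost(1,2)])
  \<comment> \<open>The assumption on \<open>l\<close> makes the zero order term another phase
    error.\<close>
  also have "l * (L2_set s.g (Or \<times> Or))\<^sup>2 \<le> (cmod (1 - z1))\<^sup>2 * (L2_set s.g (Or \<times> Or))\<^sup>2"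
    using l by (intro mult_right_mono) auto
  also have "\<dots> \<le> (card Or * s.\<tau>)\<^sup>2" using cost(3) by (simp add: power_mult_distrib)
  \<comment> \<open>\<open>145 = 1 + 2 * (36 + 36)\<close>.\<close>
  also have "(card Or * s.\<tau>)\<^sup>2 + 2 * ((card Or * (6 * s.\<tau>))\<^sup>2 + (card Or * (6 * s.\<tau>))\<^sup>2) = 145 / real K ^ 3 * (card Or)\<^sup>2"
    by (simp add: power_mult_distrib s.tau_square)
  finally have "(cmod (1 - z1))\<^sup>2 * green_mean z1 z2 l * (card Or)\<^sup>2 \<le> 145 / real K ^ 3 * (card Or)\<^sup>2" by simp
  then show ?thesis by (rule mult_right_le_imp_le) (use card_orientations_pos in simp)
qed

end

section \<open>Summation of the bounds over all modes\<close>

lemma sum_dyadic_block: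
  fixes Q :: int
  assumes Q: "Q > 0"
  shows "(\<Sum>s\<in>{1..m}. if s * 2 ^ c \<le> Q \<and> Q < s * 2 ^ Suc c then 1 / of_int s else 0) \<le> (1::real)"
proof -
  \<comment> \<open>The admissible \<open>s\<close> lie between \<open>t + 1\<close> and
    \<open>2 * t + 1\<close>: these are \<open>t + 1\<close> terms of size at most
    \<open>1 / (t + 1)\<close>.\<close>
  define t where "t = Q div 2 ^ Suc c"
  have t0: "t \<ge> 0" using Q by (simp add: t_def pos_imp_zdiv_nonneg_iff)
  have Q_eq: "Q = t * 2 ^ Suc c + Q mod 2 ^ Suc c" unfolding t_def by (rule div_mult_mod_eq[symmetric])
  have mod: "0 \<le> Q mod 2 ^ Suc c" "Q mod 2 ^ Suc c < 2 ^ Suc c" by simp_all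
  have range: "t < s \<and> s < 2 * t + 2" if "s * 2 ^ c \<le> Q" "Q < s * 2 ^ Suc c" for s
  proof
    have "t * 2 ^ Suc c < s * 2 ^ Suc c" using that(2) Q_eq mod(1) by linarith
    then show "t < s" by (simp add: mult_less_cancel_right)
    have "Q < (t + 1) * 2 ^ Suc c" unfolding distrib_right using Q_eq mod(2) by linarith
    then have "s * 2 ^ c < (2 * t + 2) * 2 ^ c" using that(1) by (simp add: algebra_simps)
    then show "s < 2 * t + 2" by (simp only: mult_less_cancel_right) simp
  qed
  have "(\<Sum>s\<in>{1..m}. if s * 2 ^ c \<le> Q \<and> Q < s * 2 ^ Suc c then 1 / of_int s else 0)
     \<le> (\<Sum>s\<in>{1..m}. if s \<in> {t+1..2*t+1} then 1 / (of_int (t + 1) :: real) else 0)"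
  proof (rule sum_mono)
    fix s assume s: "s \<in> {1..m}"
    show "(if s * 2 ^ c \<le> Q \<and> Q < s * 2 ^ Suc c then 1 / of_int s else 0) \<le> (if s \<in> {t+1..2*t+1} then 1 / (of_int (t + 1) :: real) else 0)"
    proof (cases "s * 2 ^ c \<le> Q \<and> Q < s * 2 ^ Suc c")
      case True
      then have "t < s" "s < 2 * t + 2" using range by blast+
      moreover have "1 / of_int s \<le> 1 / (of_int (t + 1) :: real)"
        using \<open>t < s\<close> t0 by (intro divide_left_mono) auto
      ultimately show ?thesis by auto
    qed (use t0 in \<open>simp only: if_False, simp\<close>)
  qed
  also have "\<dots> = (\<Sum>s\<in>{1..m} \<inter> {t+1..2*t+1}. 1 / (of_int (t + 1) :: real))"
    by (rule sum.inter_restrict[symmetric]) simp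
  also have "\<dots> \<le> (\<Sum>s\<in>{t+1..2*t+1}. 1 / (of_int (t + 1) :: real))"
    using t0 by (intro sum_mono2) auto
  also have "\<dots> = 1" using t0 by simp
  finally show ?thesis .
qed

lemma sum_dyadic_range:
  fixes Q :: int
  assumes Q: "Q > 0"
  shows "(\<Sum>s\<in>{1..m}. if s * 2 ^ a \<le> Q \<and> Q < s * 2 ^ (a + n) then 1 / of_int s else 0) \<le> real n"
proof (induction n)
  case 0
  have "(\<Sum>s\<in>{1..m}. if s * 2 ^ a \<le> Q \<and> Q < s * 2 ^ (a + 0) then 1 / of_int s else (0::real)) = (\<Sum>s\<in>{1..m}. 0)"
    by (intro sum.cong) auto
  then show ?case by simp
next
  case (Suc n)
  have "(\<Sum>s\<in>{1..m}. if s * 2 ^ a \<le> Q \<and> Q < s * 2 ^ (a + Suc n) then 1 / of_int s else (0::real)) \<le>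
    (\<Sum>s\<in>{1..m}. (if s * 2 ^ a \<le> Q \<and> Q < s * 2 ^ (a + n) then 1 / of_int s else 0) +
      (if s * 2 ^ (a + n) \<le> Q \<and> Q < s * 2 ^ Suc (a + n) then 1 / of_int s else 0))"
    by (intro sum_mono) (auto simp del: power_Suc)
  also have "\<dots> \<le> real n + 1"
    unfolding sum.distrib using sum_dyadic_block[OF Q, of "a + n" m] Suc by (intro add_mono) auto
  finally show ?case by simp
qed

text \<open>The shell of radius \<open>s\<close> in the maximum norm has
  \<open>(2 * s + 1) ^ 2 - (2 * s - 1) ^ 2 = 8 * s\<close> points.\<close>

lemma sum_max_norm_le:
  fixes f :: "int \<Rightarrow> real"
  assumes f: "\<And>s. f s \<ge> 0" and m: "m \<ge> 0"
  shows "(\<Sum>p\<in>{-m..m} \<times> {-m..m}. f (max \<bar>fst p\<bar> \<bar>snd p\<bar>)) \<le> f 0 + (\<Sum>s\<in>{1..m}. 8 * of_int s * f s)"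
proof -
  let ?S = "{-m..m} \<times> {-m..m}" and ?n = "\<lambda>p::int\<times>int. max \<bar>fst p\<bar> \<bar>snd p\<bar>"
  have "(\<Sum>p\<in>?S. f (?n p)) = (\<Sum>s\<in>{0..m}. \<Sum>p\<in>{p\<in>?S. ?n p = s}. f (?n p))"
    by (intro sum.group[symmetric]) auto
  also have "\<dots> = (\<Sum>s\<in>{0..m}. real (card {p\<in>?S. ?n p = s}) * f s)"
    by (intro sum.cong refl) (simp add: sum_constant[symmetric] del: sum_constant)
  also have "{0..m} = insert 0 {1..m}" using m by auto
  also have "(\<Sum>s\<in>insert 0 {1..m}. real (card {p\<in>?S. ?n p = s}) * f s) =
    real (card {p\<in>?S. ?n p = 0}) * f 0 + (\<Sum>s\<in>{1..m}. real (card {p\<in>?S. ?n p = s}) * f s)"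
    by (rule sum.insert) auto
  also have "{p\<in>?S. ?n p = 0} = {(0, 0)}" using m by (auto simp: max_def split: if_splits)
  also have "(\<Sum>s\<in>{1..m}. real (card {p\<in>?S. ?n p = s}) * f s) \<le> (\<Sum>s\<in>{1..m}. 8 * of_int s * f s)"
  proof (intro sum_mono mult_right_mono f)
    fix s assume s: "s \<in> {1..m}"
    let ?B = "{-s..s} \<times> {-s..s}" and ?I = "{-(s-1)..s-1} \<times> {-(s-1)..s-1}"
    have "card {p\<in>?S. ?n p = s} \<le> card (?B - ?I)"
      by (rule card_mono) (auto simp: max_def split: if_splits)
    also have "\<dots> = card ?B - card ?I" by (rule card_Diff_subset) auto
    finally have "int (card {p\<in>?S. ?n p = s}) \<le> int (card ?B - card ?I)" by simp
    also have "\<dots> = 8 * s"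
    proof -
      obtain k where k: "s = int k + 1" using s by (metis add.commute atLeastAtMost_iff zle_iff_zadd)
      have "nat (s - - s + 1) = 2 * k + 3" "nat (s - 1 - - (s - 1) + 1) = 2 * k + 1" using k by auto
      then have "card ?B = (2 * k + 3) * (2 * k + 3)" "card ?I = (2 * k + 1) * (2 * k + 1)"
        by (simp_all only: card_cartesian_product card_atLeastAtMost_int)
      then have "card ?B = card ?I + 8 * (k + 1)" by (simp add: algebra_simps)
      then show ?thesis using k by simp
    qed
    finally have "real_of_int (int (card {p\<in>?S. ?n p = s})) \<le> real_of_int (8 * s)" by (simp only: of_int_le_iff)
    then show "real (card {p\<in>?S. ?n p = s}) \<le> 8 * of_int s" by simp
  qed
  finally show ?thesis by simp
qed

text \<open>By concavity the sine lies above its chord over the quarter period (Jordan's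
  inequality).\<close>

lemma sin_ge_linear: "0 \<le> x \<Longrightarrow> x \<le> pi / 2 \<Longrightarrow> 2 * x / pi \<le> sin x"
proof -
  assume x: "0 \<le> x" "x \<le> pi / 2"
  have "convex_on {0..pi/2} (\<lambda>x. - sin x)"
    by (rule f''_ge0_imp_convex[where f' = "\<lambda>x. - cos x" and f'' = sin])
       (auto intro!: derivative_eq_intros sin_ge_zero)
  from convex_onD[OF this, of "2 * x / pi" 0 "pi / 2"] show ?thesis
    using x by (simp add: field_simps)
qed

text \<open>Comparison with the telescoping series of \<open>1 / (K - 1) - 1 / K\<close>, which from
  6 on has sum \<open>1 / 5\<close>.\<close>

lemma sum_inverse_squares_le: "(\<Sum>K\<in>{6..n}. 1 / (real K)\<^sup>2) \<le> 1 / 5"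
proof (cases "n \<ge> 6")
  case True
  then have "(\<Sum>K\<in>{6..n}. 1 / (real K)\<^sup>2) \<le> 1 / 5 - 1 / real n"
  proof (induction n rule: dec_induct)
    case (step k)
    have "1 / (real (Suc k))\<^sup>2 \<le> 1 / (real k * real (Suc k))"
      using step by (intro divide_left_mono) (auto simp: power2_eq_square)
    also have "\<dots> = 1 / real k - 1 / real (Suc k)" using step by (simp add: field_simps)
    finally show ?case using step by simp
  qed simp
  moreover have "0 \<le> 1 / real n" by simp
  ultimately show ?thesis by linarith
qed simp

context periodic
begin

definition mode :: "int \<Rightarrow> complex" where "mode j = cis (2 * pi * of_int j / of_int Q)"

lemma norm_mode: "cmod (mode j) = 1" by (simp add: mode_def)

lemma norm_one_minus_mode:
  assumes j: "2 * \<bar>j\<bar> \<le> Q"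
  shows "4 * of_int \<bar>j\<bar> / of_int Q \<le> cmod (1 - mode j)" "cmod (1 - mode j) \<le> 2 * pi * of_int \<bar>j\<bar> / of_int Q"
proof -
  define x where "x = pi * of_int \<bar>j\<bar> / of_int Q"
  have "cmod (1 - mode j) = 2 * \<bar>sin (2 * pi * of_int j / of_int Q / 2)\<bar>"
    using dist_exp_i_1[of "2 * pi * of_int j / of_int Q"] by (simp add: mode_def cis_conv_exp norm_minus_commute)
  also have "\<bar>sin (2 * pi * of_int j / of_int Q / 2)\<bar> = \<bar>sin x\<bar>"
    by (cases "j \<ge> 0") (auto simp: x_def)
  finally have eq: "cmod (1 - mode j) = 2 * \<bar>sin x\<bar>" .
  have "of_int (2 * \<bar>j\<bar>) \<le> (of_int Q :: real)" using j by (simp only: of_int_le_iff)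
  then have x: "0 \<le> x" "x \<le> pi / 2" using Q_pos pi_gt_zero by (auto simp: x_def field_simps)
  have "4 * of_int \<bar>j\<bar> / of_int Q = 2 * (2 * x / pi)" by (simp add: x_def)
  then show "4 * of_int \<bar>j\<bar> / of_int Q \<le> cmod (1 - mode j)" using sin_ge_linear[OF x] eq by simp
  have "\<bar>sin x\<bar> \<le> x" using abs_sin_x_le_abs_x[of x] x by simp
  then show "cmod (1 - mode j) \<le> 2 * pi * of_int \<bar>j\<bar> / of_int Q" using eq by (simp add: x_def)
qed

text \<open>Here \<open>s\<close> is the larger modulus of the two frequencies. The three terms are the bounds by \<open>1 / l\<close>, without test functions, and with
  the test functions of parameter \<open>K\<close>, the largest one admissible for \<open>s\<close>; \<open>720 = 20 * 6^2\<close>.\<close>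

definition mode_bound :: "real \<Rightarrow> int \<Rightarrow> real" where
  "mode_bound l s = (if 16 * (of_int s)\<^sup>2 < l * (of_int Q)\<^sup>2 then 1 / l else 0) +
     (of_int Q)\<^sup>2 / (16 * (of_int s)\<^sup>2) * ((if Q < s * 2 ^ 720 then 2 else 0) +
       (\<Sum>K\<in>{6..nat Q}. if s * 2 ^ (20 * K\<^sup>2) \<le> Q \<and> Q < s * 2 ^ (20 * (Suc K)\<^sup>2) then 145 / real K ^ 3 else 0))"

lemma mode_bound_nonneg: "l > 0 \<Longrightarrow> mode_bound l s \<ge> 0"
  unfolding mode_bound_def by (intro add_nonneg_nonneg mult_nonneg_nonneg sum_nonneg) auto

lemma green_mean_mode_le_aux:
  assumes j: "\<bar>j2\<bar> \<le> \<bar>j1\<bar>" "j1 \<noteq> 0" "2 * \<bar>j1\<bar> \<le> Q" and l: "l > 0"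
  shows "green_mean (mode j1) (mode j2) l \<le> mode_bound l \<bar>j1\<bar>"
proof -
  define s where "s = \<bar>j1\<bar>"
  define d where "d = cmod (1 - mode j1)"
  define G where "G = green_mean (mode j1) (mode j2) l"
  have s: "s \<ge> 1" using j by (simp add: s_def)
  have d: "4 * of_int s / of_int Q \<le> d" "d \<le> 2 * pi * of_int s / of_int Q"
    using norm_one_minus_mode[of j1] j by (simp_all add: d_def s_def)
  have d2: "cmod (1 - mode j2) \<le> 2 * pi * of_int s / of_int Q"
  proof -
    have "cmod (1 - mode j2) \<le> 2 * pi * of_int \<bar>j2\<bar> / of_int Q" using norm_one_minus_mode[of j2] j by simp
    also have "\<dots> \<le> 2 * pi * of_int s / of_int Q"
      using j Q_pos by (intro divide_right_mono mult_left_mono) (auto simp: s_def)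
    finally show ?thesis .
  qed
  have d_pos: "0 < 4 * of_int s / (of_int Q :: real)" using s Q_pos by simp
  have sq: "16 * (of_int s)\<^sup>2 / (of_int Q)\<^sup>2 \<le> d\<^sup>2"
    using power_mono[OF d(1), of 2] d_pos by (simp add: power_divide power_mult_distrib)
  have tail: "(\<Sum>K\<in>{6..nat Q}. if s * 2 ^ (20 * K\<^sup>2) \<le> Q \<and> Q < s * 2 ^ (20 * (Suc K)\<^sup>2) then 145 / real K ^ 3 else 0) \<ge> 0"
    by (intro sum_nonneg) auto
  have from_c: "G \<le> (of_int Q)\<^sup>2 / (16 * (of_int s)\<^sup>2) * c" if "d\<^sup>2 * G \<le> c" "c \<ge> 0" for c
  proof -
    have x: "0 < 16 * (of_int s)\<^sup>2 / (of_int Q :: real)\<^sup>2" using s Q_pos by simp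
    then have d2: "d\<^sup>2 > 0" using sq by linarith
    then have "G \<le> c / d\<^sup>2" using that by (simp add: le_divide_eq mult.commute)
    also have "\<dots> \<le> c / (16 * (of_int s)\<^sup>2 / (of_int Q)\<^sup>2)"
      using sq that(2) mult_pos_pos[OF d2 x] by (rule divide_left_mono)
    finally show ?thesis by (simp add: mult.commute)
  qed
  have first: "(if 16 * (of_int s)\<^sup>2 < l * (of_int Q)\<^sup>2 then 1 / l else 0) \<ge> 0" using l by simp
  show ?thesis
  proof (cases "d\<^sup>2 < l")
    case True
    then have "16 * (of_int s)\<^sup>2 / (of_int Q)\<^sup>2 < l" using sq by linarith
    then have "16 * (of_int s)\<^sup>2 < l * (of_int Q)\<^sup>2" using Q_pos by (simp add: divide_less_eq)
    moreover have "G \<le> 1 / l" unfolding G_def by (rule green_mean_le[OF norm_mode norm_mode l])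
    moreover have "0 \<le> (of_int Q)\<^sup>2 / (16 * (of_int s)\<^sup>2) * ((if Q < s * 2 ^ 720 then 2 else 0) +
       (\<Sum>K\<in>{6..nat Q}. if s * 2 ^ (20 * K\<^sup>2) \<le> Q \<and> Q < s * 2 ^ (20 * (Suc K)\<^sup>2) then 145 / real K ^ 3 else 0))"
      using tail by (intro mult_nonneg_nonneg add_nonneg_nonneg) auto
    ultimately show ?thesis unfolding mode_bound_def G_def[symmetric] s_def[symmetric] by simp
  next
    case False
    \<comment> \<open>This is the condition on \<open>l\<close> under which the test functions may
      be used.\<close>
    then have ld: "l \<le> (cmod (1 - mode j1))\<^sup>2" by (simp add: d_def)
    have "d\<^sup>2 * G \<le> (if Q < s * 2 ^ 720 then 2 else 0) +
       (\<Sum>K\<in>{6..nat Q}. if s * 2 ^ (20 * K\<^sup>2) \<le> Q \<and> Q < s * 2 ^ (20 * (Suc K)\<^sup>2) then 145 / real K ^ 3 else 0)"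
    proof (cases "Q < s * 2 ^ 720")
      case True
      have "mode j1 \<noteq> 1" using ld l by auto
      then have "d\<^sup>2 * G \<le> 2" unfolding d_def G_def by (intro green_mean_trivial norm_mode l)
      then show ?thesis using tail True by simp
    next
      case False
      define P where "P K \<longleftrightarrow> 6 \<le> K \<and> s * 2 ^ (20 * K\<^sup>2) \<le> Q" for K :: nat
      have P6: "P 6" using False by (simp add: P_def)
      have bound: "K \<le> nat Q" if "P K" for K
      proof -
        have "K \<le> 20 * K\<^sup>2" by (simp add: power2_eq_square)
        then have "(2::nat) ^ K \<le> 2 ^ (20 * K\<^sup>2)" by (intro power_increasing) auto
        then have "K \<le> 2 ^ (20 * K\<^sup>2)" using less_exp[of K] by linarith
        then have "int K \<le> int (2 ^ (20 * K\<^sup>2))" by (rule of_nat_mono)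
        also have "\<dots> = 2 ^ (20 * K\<^sup>2)" by simp
        also have "\<dots> \<le> s * 2 ^ (20 * K\<^sup>2)" using s by simp
        finally have "int K \<le> Q" using that by (auto simp: P_def)
        then show ?thesis by simp
      qed
      \<comment> \<open>Failure of \<open>P (Suc K)\<close> gives the upper bound on
        \<open>Q\<close>, which selects the one term of the sum that belongs to
        \<open>s\<close>.\<close>
      define K where "K = Greatest P"
      have PK: "P K" unfolding K_def using P6 bound by (rule GreatestI_nat)
      have "\<not> P (Suc K)"
      proof
        assume "P (Suc K)"
        then have "Suc K \<le> K" unfolding K_def using bound by (rule Greatest_le_nat)
        then show False by simp
      qed
      then have K: "6 \<le> K" "s * 2 ^ (20 * K\<^sup>2) \<le> Q" "Q < s * 2 ^ (20 * (Suc K)\<^sup>2)"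
        using PK by (auto simp: P_def)
      have "of_int (s * 2 ^ (20 * K\<^sup>2)) \<le> (of_int Q :: real)" using K(2) by (simp only: of_int_le_iff)
      then have "2 * pi * (of_int s * 2 ^ (20 * K\<^sup>2)) \<le> 2 * pi * of_int Q" by (intro mult_left_mono) auto
      then have "2 * pi * of_int s / of_int Q * 2 ^ (20 * K\<^sup>2) \<le> 2 * pi" using Q_pos by (simp add: field_simps)
      \<comment> \<open>Origin of the 7 in \<open>green_mean_corrector\<close>: frequencies are at
        most \<open>2 * pi * s / Q\<close>.\<close>
      moreover have "2 * pi \<le> 7" using pi_less_4 pi_approx by simp
      ultimately have seven: "x * 2 ^ (20 * K\<^sup>2) \<le> 7" if "x \<le> 2 * pi * of_int s / of_int Q" for x
        using mult_right_mono[OF that, of "2 ^ (20 * K\<^sup>2)"] by simp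
      have "2 ^ (20 * K\<^sup>2) \<le> s * 2 ^ (20 * K\<^sup>2)" using s by simp
      then have "2 ^ (20 * K\<^sup>2) \<le> Q" using K(2) by linarith
      then have "d\<^sup>2 * G \<le> 145 / real K ^ 3"
        unfolding d_def G_def using d(2) d2
        by (intro green_mean_corrector norm_mode l ld K(1) seven) (simp_all add: d_def)
      also have "\<dots> = (\<Sum>K\<in>{K}. if s * 2 ^ (20 * K\<^sup>2) \<le> Q \<and> Q < s * 2 ^ (20 * (Suc K)\<^sup>2) then 145 / real K ^ 3 else 0)"
        using K by simp
      also have "\<dots> \<le> (\<Sum>K\<in>{6..nat Q}. if s * 2 ^ (20 * K\<^sup>2) \<le> Q \<and> Q < s * 2 ^ (20 * (Suc K)\<^sup>2) then 145 / real K ^ 3 else 0)"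
        using K(1) bound[OF PK] by (intro sum_mono2) auto
      finally show ?thesis using False by simp
    qed
    from from_c[OF this] tail first show ?thesis
      unfolding mode_bound_def G_def[symmetric] s_def[symmetric] by simp
  qed
qed

lemma green_mean_mode_le:
  assumes "max \<bar>j1\<bar> \<bar>j2\<bar> \<noteq> 0" "2 * max \<bar>j1\<bar> \<bar>j2\<bar> \<le> Q" "l > 0"
  shows "green_mean (mode j1) (mode j2) l \<le> mode_bound l (max \<bar>j1\<bar> \<bar>j2\<bar>)"
proof (cases "\<bar>j2\<bar> \<le> \<bar>j1\<bar>")
  case True
  then show ?thesis using green_mean_mode_le_aux[of j2 j1 l] assms by (simp add: max_def)
next
  case False
  then show ?thesis using green_mean_mode_le_aux[of j1 j2 l] assms green_mean_swap[of "mode j1"] by (simp add: max_def)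
qed

text \<open>The size \<open>8 * s\<close> of a shell turns the planar weight
  \<open>Q ^ 2 / (16 * s ^ 2)\<close> into \<open>Q ^ 2 / (2 * s)\<close>, so each dyadic block
  contributes a bounded multiple of \<open>Q ^ 2\<close>. The three parts give \<open>1 / 2\<close>,
  720 (one per block) and 629.\<close>

lemma sum_mode_bound:
  assumes l: "l > 0" and m: "m \<le> Q"
  shows "(\<Sum>s\<in>{1..m}. 8 * of_int s * mode_bound l s) \<le> 1350 * (of_int Q)\<^sup>2"
proof -
  let ?q = "(of_int Q)\<^sup>2 :: real"
  let ?a = "\<lambda>s. if 16 * (of_int s)\<^sup>2 < l * ?q then 8 * of_int s / l else (0::real)"
  let ?b = "\<lambda>s::int. if s * 2 ^ 0 \<le> Q \<and> Q < s * 2 ^ (0 + 720) then 1 / of_int s else (0::real)"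
  let ?c = "\<lambda>K s::int. if s * 2 ^ (20 * K\<^sup>2) \<le> Q \<and> Q < s * 2 ^ (20 * K\<^sup>2 + 20 * (2 * K + 1)) then 1 / of_int s else (0::real)"
  have q: "?q > 0" using Q_pos by simp
  have A: "(\<Sum>s\<in>{1..m}. ?a s) \<le> ?q / 2"
  proof -
    define X where "X = sqrt l * of_int Q / 4"
    have X: "X \<ge> 0" "X\<^sup>2 = l * ?q / 16" using l Q_pos by (auto simp: X_def power_mult_distrib power_divide)
    have "(\<Sum>s\<in>{1..m}. ?a s) \<le> (\<Sum>s\<in>{1..m}. if s \<in> {1..\<lfloor>X\<rfloor>} then 8 * X / l else 0)"
    proof (rule sum_mono)
      fix s assume s: "s \<in> {1..m}"
      show "?a s \<le> (if s \<in> {1..\<lfloor>X\<rfloor>} then 8 * X / l else 0)"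
      proof (cases "16 * (of_int s)\<^sup>2 < l * ?q")
        case True
        then have "(of_int s)\<^sup>2 \<le> X\<^sup>2" using X by simp
        then have "of_int s \<le> X" using X(1) by (rule power2_le_imp_le)
        then show ?thesis using s l True by (auto simp: le_floor_iff intro!: divide_right_mono)
      qed (use X l in auto)
    qed
    also have "\<dots> = (\<Sum>s\<in>{1..m} \<inter> {1..\<lfloor>X\<rfloor>}. 8 * X / l)" by (rule sum.inter_restrict[symmetric]) simp
    also have "\<dots> \<le> (\<Sum>s\<in>{1..\<lfloor>X\<rfloor>}. 8 * X / l)" using X l by (intro sum_mono2) auto
    also have "\<dots> = real (nat \<lfloor>X\<rfloor>) * (8 * X / l)" by simp
    also have "\<dots> \<le> X * (8 * X / l)" using X l by (intro mult_right_mono) auto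
    also have "\<dots> = 8 * X\<^sup>2 / l" by (simp add: power2_eq_square)
    also have "\<dots> = ?q / 2" unfolding X using l by simp
    finally show ?thesis .
  qed
  have B: "(\<Sum>s\<in>{1..m}. ?b s) \<le> 720" using sum_dyadic_range[OF Q_pos, where a = 0 and n = 720 and m = m] by simp
  have C: "(\<Sum>K\<in>{6..nat Q}. 145 / (2 * real K ^ 3) * (\<Sum>s\<in>{1..m}. ?c K s)) \<le> 629"
  proof -
    have "(\<Sum>K\<in>{6..nat Q}. 145 / (2 * real K ^ 3) * (\<Sum>s\<in>{1..m}. ?c K s)) \<le> (\<Sum>K\<in>{6..nat Q}. 3142 * (1 / (real K)\<^sup>2))"
    proof (rule sum_mono)
      fix K assume K: "K \<in> {6..nat Q}"
      have "(\<Sum>s\<in>{1..m}. ?c K s) \<le> real (20 * (2 * K + 1))" by (rule sum_dyadic_range[OF Q_pos])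
      \<comment> \<open>\<open>2 * K + 1 \<le> 13 / 6 * K\<close> from \<open>K = 6\<close> on, and
        \<open>145 / 2 * 20 * 13 / 6 < 3142\<close>.\<close>
      also have "\<dots> \<le> 20 * (13 / 6 * real K)" using K by simp
      finally have "145 / (2 * real K ^ 3) * (\<Sum>s\<in>{1..m}. ?c K s) \<le> 145 / (2 * real K ^ 3) * (20 * (13 / 6 * real K))"
        by (rule mult_left_mono) simp
      also have "\<dots> \<le> 3142 * (1 / (real K)\<^sup>2)" using K by (simp add: field_simps power_numeral_reduce)
      finally show "145 / (2 * real K ^ 3) * (\<Sum>s\<in>{1..m}. ?c K s) \<le> 3142 * (1 / (real K)\<^sup>2)" .
    qed
    also have "\<dots> \<le> 3142 * (1 / 5)"
      unfolding sum_distrib_left[symmetric] by (intro mult_left_mono sum_inverse_squares_le) simp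
    finally show ?thesis by simp
  qed
  have "(\<Sum>s\<in>{1..m}. 8 * of_int s * mode_bound l s)
    = (\<Sum>s\<in>{1..m}. ?a s + ?q * (?b s + (\<Sum>K\<in>{6..nat Q}. 145 / (2 * real K ^ 3) * ?c K s)))"
  proof (rule sum.cong)
    fix s assume s: "s \<in> {1..m}"
    have 20: "20 * (Suc K)\<^sup>2 = 20 * K\<^sup>2 + 20 * (2 * K + 1)" for K by (simp add: power2_eq_square algebra_simps)
    have e: "8 * of_int s * (?q / (16 * (of_int s)\<^sup>2) * x) = ?q * (x / (2 * of_int s))" for x
      using s by (simp add: power2_eq_square field_simps)
    let ?I = "if Q < s * 2 ^ 720 then 2 else (0::real)"
    let ?S = "\<Sum>K\<in>{6..nat Q}. if s * 2 ^ (20 * K\<^sup>2) \<le> Q \<and> Q < s * 2 ^ (20 * (Suc K)\<^sup>2) then 145 / real K ^ 3 else 0"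
    have S: "?S / (2 * of_int s) = (\<Sum>K\<in>{6..nat Q}. 145 / (2 * real K ^ 3) * ?c K s)"
      unfolding sum_divide_distrib 20 by (intro sum.cong refl) (simp add: mult.commute)
    have "s \<le> Q" using s m by simp
    then have I: "?I / (2 * of_int s) = ?b s" by simp
    have "8 * of_int s * mode_bound l s =
      8 * of_int s * (if 16 * (of_int s)\<^sup>2 < l * ?q then 1 / l else 0) + ?q * (?I / (2 * of_int s) + ?S / (2 * of_int s))"
      unfolding mode_bound_def distrib_left[of "8 * of_int s"] e add_divide_distrib ..
    also have "8 * of_int s * (if 16 * (of_int s)\<^sup>2 < l * ?q then 1 / l else 0) = ?a s" by simp
    finally show "8 * of_int s * mode_bound l s = ?a s + ?q * (?b s + (\<Sum>K\<in>{6..nat Q}. 145 / (2 * real K ^ 3) * ?c K s))"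
      unfolding I S .
  qed simp
  also have "\<dots> = (\<Sum>s\<in>{1..m}. ?a s) + ?q * ((\<Sum>s\<in>{1..m}. ?b s) + (\<Sum>K\<in>{6..nat Q}. 145 / (2 * real K ^ 3) * (\<Sum>s\<in>{1..m}. ?c K s)))"
    by (simp only: sum.distrib sum_distrib_left[symmetric], subst sum.swap, simp only: sum_distrib_left[symmetric])
  also have "\<dots> \<le> ?q / 2 + ?q * (720 + 629)"
    using q by (intro add_mono mult_left_mono A B C) auto
  also have "\<dots> \<le> 1350 * ?q" using q by simp
  finally show ?thesis .
qed

end

section \<open>The semigroup as a sum over paths\<close>

definition neighbour :: "env \<Rightarrow> site \<Rightarrow> 2 \<Rightarrow> site" where
  "neighbour \<omega> z i = z + \<omega> (z, i) *s axis i 1"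

primrec paths :: "env \<Rightarrow> nat \<Rightarrow> site \<Rightarrow> site \<Rightarrow> real" where
  "paths \<omega> 0 x y = (if x = y then 1 else 0)"
| "paths \<omega> (Suc n) x y = (\<Sum>i\<in>UNIV. paths \<omega> n (neighbour \<omega> x i) y)"

lemma paths_nonneg: "paths \<omega> n x y \<ge> 0"
  by (induction n arbitrary: x) (auto intro!: sum_nonneg)

lemma paths_le: "paths \<omega> n x y \<le> 2 ^ n"
proof (induction n arbitrary: x)
  case (Suc n)
  have "paths \<omega> (Suc n) x y \<le> (\<Sum>i\<in>(UNIV :: 2 set). 2 ^ n)" unfolding paths.simps by (intro sum_mono Suc)
  then show ?case by simp
qed simp

lemma paths_total: "\<exists>F. finite F \<and> (\<forall>y. y \<notin> F \<longrightarrow> paths \<omega> n x y = 0) \<and> (\<Sum>y\<in>F. paths \<omega> n x y) = 2 ^ n"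
proof (induction n arbitrary: x)
  case 0
  show ?case by (rule exI[of _ "{x}"]) auto
next
  case (Suc n)
  have "\<forall>i. \<exists>F. finite F \<and> (\<forall>y. y \<notin> F \<longrightarrow> paths \<omega> n (neighbour \<omega> x i) y = 0) \<and> (\<Sum>y\<in>F. paths \<omega> n (neighbour \<omega> x i) y) = 2 ^ n"
    using Suc by blast
  then obtain F where F: "\<And>i. finite (F i)" "\<And>i y. y \<notin> F i \<Longrightarrow> paths \<omega> n (neighbour \<omega> x i) y = 0"
    "\<And>i. (\<Sum>y\<in>F i. paths \<omega> n (neighbour \<omega> x i) y) = 2 ^ n" by metis
  let ?U = "\<Union>i. F i"
  have fin: "finite ?U" using F(1) by auto
  have "(\<Sum>y\<in>?U. paths \<omega> n (neighbour \<omega> x i) y) = 2 ^ n" for i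
    unfolding F(3)[of i, symmetric] using fin F(2) by (intro sum.mono_neutral_right) auto
  then have "(\<Sum>y\<in>?U. paths \<omega> (Suc n) x y) = 2 ^ Suc n"
    unfolding paths.simps by (subst sum.swap) simp
  moreover have "paths \<omega> (Suc n) x y = 0" if "y \<notin> ?U" for y
    using that F(2) by simp
  ultimately show ?case using fin by blast
qed

lemma exp_partial_sums: "(\<lambda>N. \<Sum>k\<le>N. x ^ k / fact k) \<longlonglongrightarrow> exp (x :: real)"
  using exp_converges[of x] by (simp add: sums_def_le divide_inverse mult.commute)

text \<open>The Poisson limit: jumps counted in \<open>n\<close> intervals of length
  \<open>t / n\<close> acquire Poisson weights.\<close>

lemma binomial_scaled_limit: "(\<lambda>n. real (n choose k) * (t / real n) ^ k) \<longlonglongrightarrow> t ^ k / fact k"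
proof -
  have "(\<lambda>n. t ^ k * ((\<Prod>i = 0..<k. 1 - real i / real n) / fact k)) \<longlonglongrightarrow> t ^ k * ((\<Prod>i = 0..<k. 1 - 0) / fact k)"
    by (intro tendsto_intros lim_const_over_n) auto
  moreover have "\<forall>\<^sub>F n in sequentially. t ^ k * ((\<Prod>i = 0..<k. 1 - real i / real n) / fact k) = real (n choose k) * (t / real n) ^ k"
  proof (rule eventually_sequentiallyI[of 1])
    fix n :: nat assume n: "n \<ge> 1"
    have "(\<Prod>i = 0..<k. 1 - real i / real n) = (\<Prod>i = 0..<k. (real n - real i) / real n)"
      using n by (intro prod.cong) (auto simp: diff_divide_distrib)
    then show "t ^ k * ((\<Prod>i = 0..<k. 1 - real i / real n) / fact k) = real (n choose k) * (t / real n) ^ k"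
      by (simp add: binomial_gbinomial gbinomial_prod_rev prod_dividef power_divide mult_ac)
  qed
  ultimately have "(\<lambda>n. real (n choose k) * (t / real n) ^ k) \<longlonglongrightarrow> t ^ k * ((\<Prod>i = 0..<k. 1 - 0) / fact k)"
    by (rule Lim_transform_eventually)
  then show ?thesis by simp
qed

context
  fixes \<omega> :: env and P :: "real \<Rightarrow> site \<Rightarrow> site \<Rightarrow> real"
  assumes env: "\<omega> \<in> environments" and P: "markov_transition_probs (jump_rate \<omega>) P"
begin

lemma neighbour_component: "neighbour \<omega> x i $ j = x $ j + (if i = j then \<omega> (x, i) else 0)"
  by (simp add: neighbour_def axis_def)

lemma orientation_nonzero: "\<omega> (x, i) \<noteq> 0"
proof -
  have "\<omega> (x, i) \<in> {-1, 1}" using env by (simp add: environments_def)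
  then show ?thesis by auto
qed

lemma neighbour_neq: "neighbour \<omega> x i \<noteq> x"
proof
  assume "neighbour \<omega> x i = x"
  then have "neighbour \<omega> x i $ i = x $ i" by simp
  then show False using orientation_nonzero[of x i] by (simp add: neighbour_component)
qed

lemma neighbour_inj: "neighbour \<omega> x i = neighbour \<omega> x j \<longleftrightarrow> i = j"
proof
  assume "neighbour \<omega> x i = neighbour \<omega> x j"
  then have "neighbour \<omega> x i $ i = neighbour \<omega> x j $ i" by simp
  then have "\<omega> (x, i) = (if j = i then \<omega> (x, j) else 0)" unfolding neighbour_component by simp
  then show "i = j" using orientation_nonzero[of x i] by metis
qed simp

lemma jump_rate_eq: "jump_rate \<omega> x y = (\<Sum>i\<in>UNIV. if y = neighbour \<omega> x i then 1 else 0)"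
  by (simp add: jump_rate_def neighbour_def)

lemma jump_rate_neighbour: "jump_rate \<omega> x (neighbour \<omega> x i) = 1"
  by (simp add: jump_rate_eq neighbour_inj)

lemma jump_rate_total: "(\<Sum>\<^sub>\<infinity>y\<in>UNIV - {x}. jump_rate \<omega> x y) = 2"
proof -
  have "(\<Sum>\<^sub>\<infinity>y\<in>UNIV - {x}. jump_rate \<omega> x y) = (\<Sum>\<^sub>\<infinity>y\<in>range (neighbour \<omega> x). jump_rate \<omega> x y)"
    using neighbour_neq[of x, symmetric] by (intro infsum_cong_neutral) (auto simp: jump_rate_eq intro!: sum.neutral)
  also have "\<dots> = (\<Sum>y\<in>range (neighbour \<omega> x). jump_rate \<omega> x y)" by simp
  also have "\<dots> = (\<Sum>i\<in>UNIV. jump_rate \<omega> x (neighbour \<omega> x i))"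
    by (subst sum.reindex) (auto simp: inj_on_def neighbour_inj)
  finally show ?thesis by (simp add: jump_rate_neighbour)
qed

lemma P_nonneg: "t \<ge> 0 \<Longrightarrow> P t x y \<ge> 0"
  and P_sum: "t \<ge> 0 \<Longrightarrow> (P t x has_sum 1) UNIV"
  and P_zero: "P 0 x y = (if x = y then 1 else 0)"
  and P_semigroup: "s \<ge> 0 \<Longrightarrow> t \<ge> 0 \<Longrightarrow> ((\<lambda>y. P s x y * P t y z) has_sum P (s + t) x z) UNIV"
  and P_deriv: "x \<noteq> y \<Longrightarrow> ((\<lambda>t. P t x y) has_real_derivative jump_rate \<omega> x y) (at 0 within {0..})"
  and P_deriv_diag: "((\<lambda>t. P t x x) has_real_derivative - 2) (at 0 within {0..})"
  using P unfolding markov_transition_probs_def jump_rate_total by blast+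

lemma P_sum_le: "t \<ge> 0 \<Longrightarrow> finite F \<Longrightarrow> (\<Sum>y\<in>F. P t x y) \<le> 1"
  by (rule has_sum_mono_neutral[OF has_sum_finite P_sum]) (auto simp: P_nonneg)

lemma P_add_ge: "s \<ge> 0 \<Longrightarrow> t \<ge> 0 \<Longrightarrow> finite F \<Longrightarrow> (\<Sum>y\<in>F. P s x y * P t y z) \<le> P (s + t) x z"
  by (rule has_sum_mono_neutral[OF has_sum_finite P_semigroup]) (auto simp: P_nonneg)

lemma P_power: "h \<ge> 0 \<Longrightarrow> P h x x ^ n \<le> P (real n * h) x x"
proof (induction n)
  case (Suc n)
  have "P h x x ^ Suc n \<le> P h x x * P (real n * h) x x"
    using Suc by (simp add: mult_left_mono P_nonneg)
  also have "\<dots> \<le> P (h + real n * h) x x" using P_add_ge[of h "real n * h" "{x}" x x] Suc by simp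
  finally show ?case by (simp add: algebra_simps)
qed (simp add: P_zero)

lemma scaled_limit:
  assumes f: "(f has_real_derivative D) (at 0 within {0..})" and t: "t > 0"
  shows "(\<lambda>n. real n * (f (t / real n) - f 0)) \<longlonglongrightarrow> t * D"
proof -
  have "((\<lambda>h. (f h - f 0) / h) \<longlongrightarrow> D) (at 0 within {0..})"
    using f by (simp add: has_field_derivative_iff)
  moreover have "filterlim (\<lambda>n. t / real n) (at 0 within {0..}) sequentially"
    unfolding filterlim_at using t
    by (auto intro!: lim_const_over_n eventually_sequentiallyI[of 1])
  ultimately have "(\<lambda>n. (f (t / real n) - f 0) / (t / real n)) \<longlonglongrightarrow> D" by (rule filterlim_compose)
  then have "(\<lambda>n. t * ((f (t / real n) - f 0) / (t / real n))) \<longlonglongrightarrow> t * D" by (intro tendsto_mult tendsto_const)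
  moreover have "t * (a / (t / real n)) = real n * a" for a n using t by simp
  ultimately show ?thesis by simp
qed

text \<open>It is enough to find the process at \<open>x\<close> at all multiples of
  \<open>t / n\<close>, and \<open>P (t / n) x x\<close> is \<open>1 - 2 * t / n\<close> to first
  order.\<close>

lemma P_diag_ge: "t \<ge> 0 \<Longrightarrow> exp (- 2 * t) \<le> P t x x"
proof (cases "t = 0")
  case False
  assume "t \<ge> 0"
  then have t: "t > 0" using False by simp
  \<comment> \<open>The strict inequality leaves room for the error in the derivative;
    \<open>c\<close> tends to \<open>- 2 * t\<close> afterwards.\<close>
  have bound: "exp c \<le> P t x x" if c: "c < - 2 * t" for c
  proof -
    have "(\<lambda>n. real n * (P (t / real n) x x - P 0 x x)) \<longlonglongrightarrow> - 2 * t"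
      using scaled_limit[OF P_deriv_diag[of x] t] by (simp only: mult.commute)
    then have ev: "\<forall>\<^sub>F n in sequentially. c < real n * (P (t / real n) x x - P 0 x x)"
      using c by (rule order_tendstoD)
    obtain N :: nat where N: "real N > - c" using reals_Archimedean2 by blast
    from ev eventually_ge_at_top[of "max 1 N"]
    have "\<forall>\<^sub>F n in sequentially. (1 + c / real n) ^ n \<le> P t x x"
    proof eventually_elim
      case (elim n)
      then have n: "real n > 0" "real n > - c" using N by auto
      have "c / real n < P (t / real n) x x - 1" using elim(1) n by (simp add: P_zero divide_less_eq mult.commute)
      then have "(1 + c / real n) ^ n \<le> P (t / real n) x x ^ n"
        using n by (intro power_mono) (auto simp: field_simps)
      also have "\<dots> \<le> P (real n * (t / real n)) x x" using t by (intro P_power) simp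
      finally show ?case using n by simp
    qed
    then show ?thesis by (rule tendsto_upperbound[OF tendsto_exp_limit_sequentially]) simp
  qed
  have "((\<lambda>c. exp c) \<longlongrightarrow> exp (- 2 * t)) (at_left (- 2 * t))" by (intro tendsto_intros)
  then show ?thesis
    by (rule tendsto_upperbound) (auto simp: eventually_at_left_field intro!: exI[of _ "- 2 * t - 1"] bound)
qed (simp add: P_zero)

text \<open>Decomposition by the one of the \<open>n\<close> intervals in which the process moves
  from \<open>x\<close> to \<open>y\<close>. In the induction either the move has already happened
  and the process stays at \<open>y\<close>, or it happens in the last interval.\<close>

lemma P_step_power:
  assumes h: "h \<ge> 0" and xy: "x \<noteq> y"
  shows "real n * exp (- 2 * (real n * h)) * P h x y \<le> P (real n * h) x y"
proof (induction n)
  case (Suc n)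
  have "real (Suc n) * exp (- 2 * (real (Suc n) * h)) * P h x y =
     real n * exp (- 2 * (real n * h)) * P h x y * exp (- 2 * h) + exp (- 2 * (real n * h)) * P h x y * exp (- 2 * h)"
    by (simp add: algebra_simps exp_add[symmetric])
  also have "\<dots> \<le> P (real n * h) x y * P h y y + P (real n * h) x x * P h x y * 1"
    using h P_diag_ge[OF h, of y] P_diag_ge[of "real n * h" x] Suc
    by (intro add_mono mult_mono) (auto simp: P_nonneg)
  also have "\<dots> = (\<Sum>w\<in>{x, y}. P (real n * h) x w * P h w y)" using xy by simp
  also have "\<dots> \<le> P (real n * h + h) x y" using h by (intro P_add_ge) auto
  finally show ?case by (simp add: algebra_simps)
qed (use h in \<open>simp add: P_zero\<close>)

lemma P_step_ge: "t \<ge> 0 \<Longrightarrow> t * exp (- 2 * t) \<le> P t x (neighbour \<omega> x i)"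
proof (cases "t = 0")
  case False
  assume "t \<ge> 0"
  then have t: "t > 0" using False by simp
  let ?y = "neighbour \<omega> x i"
  have xy: "x \<noteq> ?y" using neighbour_neq[of x i] by simp
  have "(\<lambda>n. exp (- 2 * t) * (real n * (P (t / real n) x ?y - P 0 x ?y))) \<longlonglongrightarrow> exp (- 2 * t) * (t * 1)"
    using P_deriv[OF xy] t unfolding jump_rate_neighbour by (intro tendsto_mult tendsto_const scaled_limit)
  moreover have "\<forall>\<^sub>F n in sequentially. exp (- 2 * t) * (real n * (P (t / real n) x ?y - P 0 x ?y)) \<le> P t x ?y"
  proof (rule eventually_sequentiallyI[of 1])
    fix n :: nat assume n: "n \<ge> 1"
    have "0 \<le> t / real n" using t by simp
    from P_step_power[OF this xy, of n] show "exp (- 2 * t) * (real n * (P (t / real n) x ?y - P 0 x ?y)) \<le> P t x ?y"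
      using n xy by (simp add: P_zero mult_ac)
  qed
  ultimately show ?thesis using tendsto_upperbound[of _ _ sequentially] by (simp add: mult.commute)
qed (simp add: P_nonneg)

text \<open>The entry at \<open>(x, y)\<close> of the power \<open>(1 + h * A) ^ n\<close>, where
  \<open>A\<close> is the adjacency matrix of the directed lattice.\<close>

definition binomial_paths :: "nat \<Rightarrow> real \<Rightarrow> site \<Rightarrow> site \<Rightarrow> real" where
  "binomial_paths n h x y = (\<Sum>k\<le>n. real (n choose k) * h ^ k * paths \<omega> k x y)"

lemma binomial_paths_Suc:
  "binomial_paths (Suc n) h x y = binomial_paths n h x y + h * (\<Sum>i\<in>UNIV. binomial_paths n h (neighbour \<omega> x i) y)"
proof -
  have "binomial_paths (Suc n) h x y = paths \<omega> 0 x y + (\<Sum>k\<le>n. real (Suc n choose Suc k) * h ^ Suc k * paths \<omega> (Suc k) x y)"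
    unfolding binomial_paths_def by (subst sum.atMost_Suc_shift) simp
  also have "\<dots> = (paths \<omega> 0 x y + (\<Sum>k\<le>n. real (n choose Suc k) * h ^ Suc k * paths \<omega> (Suc k) x y))
     + (\<Sum>k\<le>n. real (n choose k) * h ^ Suc k * paths \<omega> (Suc k) x y)"
    unfolding binomial_Suc_Suc by (simp only: of_nat_add distrib_right sum.distrib add_ac)
  also have "paths \<omega> 0 x y + (\<Sum>k\<le>n. real (n choose Suc k) * h ^ Suc k * paths \<omega> (Suc k) x y) =
     (\<Sum>k\<le>Suc n. real (n choose k) * h ^ k * paths \<omega> k x y)"
    by (subst sum.atMost_Suc_shift) simp
  also have "\<dots> = binomial_paths n h x y" by (simp add: binomial_paths_def)
  also have "(\<Sum>k\<le>n. real (n choose k) * h ^ Suc k * paths \<omega> (Suc k) x y) =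
     (\<Sum>k\<le>n. \<Sum>i\<in>UNIV. h * (real (n choose k) * h ^ k * paths \<omega> k (neighbour \<omega> x i) y))"
    by (intro sum.cong refl) (simp only: paths.simps sum_distrib_left, simp add: mult_ac)
  also have "\<dots> = h * (\<Sum>i\<in>UNIV. binomial_paths n h (neighbour \<omega> x i) y)"
    unfolding binomial_paths_def sum_distrib_left by (rule sum.swap)
  finally show ?thesis .
qed

text \<open>In the first interval only staying and the single moves to the two neighbours are kept;
  everything else is discarded.\<close>

lemma P_ge_binomial_paths:
  assumes h: "h \<ge> 0"
  shows "exp (- 2 * (real n * h)) * binomial_paths n h x y \<le> P (real n * h) x y"
proof (induction n arbitrary: x)
  case 0
  show ?case by (simp add: binomial_paths_def P_zero)
next
  case (Suc n)
  let ?B = "binomial_paths n h" and ?e = "exp (- 2 * (real n * h))"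
  have B0: "?B x y \<ge> 0" for x using h by (auto simp: binomial_paths_def paths_nonneg intro!: sum_nonneg mult_nonneg_nonneg)
  have "exp (- 2 * (real (Suc n) * h)) * binomial_paths (Suc n) h x y =
    exp (- 2 * h) * (?e * ?B x y) + (\<Sum>i\<in>UNIV. (h * exp (- 2 * h)) * (?e * ?B (neighbour \<omega> x i) y))"
  proof -
    have "exp (- 2 * (real (Suc n) * h)) = exp (- 2 * h) * ?e" by (simp add: exp_add[symmetric] algebra_simps)
    then show ?thesis unfolding binomial_paths_Suc by (simp add: distrib_left sum_distrib_left mult_ac)
  qed
  also have "\<dots> \<le> P h x x * P (real n * h) x y + (\<Sum>i\<in>UNIV. P h x (neighbour \<omega> x i) * P (real n * h) (neighbour \<omega> x i) y)"
    using h B0 by (intro add_mono sum_mono mult_mono P_diag_ge P_step_ge Suc) (auto simp: P_nonneg)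
  also have "(\<Sum>i\<in>UNIV. P h x (neighbour \<omega> x i) * P (real n * h) (neighbour \<omega> x i) y) =
    (\<Sum>w\<in>range (neighbour \<omega> x). P h x w * P (real n * h) w y)"
    by (subst sum.reindex) (auto simp: inj_on_def neighbour_inj)
  also have "P h x x * P (real n * h) x y + \<dots> = (\<Sum>w\<in>insert x (range (neighbour \<omega> x)). P h x w * P (real n * h) w y)"
    using neighbour_neq by (subst sum.insert) (auto, metis)
  also have "\<dots> \<le> P (h + real n * h) x y" using h by (intro P_add_ge) auto
  finally show ?case by (simp add: algebra_simps)
qed

text \<open>Only a lower bound for \<open>P\<close> is needed, since both sides have total mass 1.\<close>

lemma P_ge_partial_sum:
  assumes t: "t \<ge> 0"
  shows "exp (- 2 * t) * (\<Sum>k\<le>N. t ^ k / fact k * paths \<omega> k x y) \<le> P t x y"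
proof (rule tendsto_upperbound)
  show "(\<lambda>n. exp (- 2 * t) * (\<Sum>k\<le>N. real (n choose k) * (t / real n) ^ k * paths \<omega> k x y))
     \<longlonglongrightarrow> exp (- 2 * t) * (\<Sum>k\<le>N. t ^ k / fact k * paths \<omega> k x y)"
    by (intro tendsto_intros binomial_scaled_limit)
  show "\<forall>\<^sub>F n in sequentially. exp (- 2 * t) * (\<Sum>k\<le>N. real (n choose k) * (t / real n) ^ k * paths \<omega> k x y) \<le> P t x y"
  proof (rule eventually_sequentiallyI[of "Suc N"])
    fix n assume n: "n \<ge> Suc N"
    have "(\<Sum>k\<le>N. real (n choose k) * (t / real n) ^ k * paths \<omega> k x y) \<le> binomial_paths n (t / real n) x y"
      unfolding binomial_paths_def using n t by (intro sum_mono2) (auto simp: paths_nonneg)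
    then have "exp (- 2 * t) * (\<Sum>k\<le>N. real (n choose k) * (t / real n) ^ k * paths \<omega> k x y) \<le> exp (- 2 * t) * binomial_paths n (t / real n) x y"
      by simp
    also have "\<dots> \<le> P t x y" using P_ge_binomial_paths[of "t / real n" n x y] n t by simp
    finally show "exp (- 2 * t) * (\<Sum>k\<le>N. real (n choose k) * (t / real n) ^ k * paths \<omega> k x y) \<le> P t x y" .
  qed
qed simp

lemma P_le_partial_sum:
  assumes t: "t \<ge> 0"
  shows "P t x y \<le> exp (- 2 * t) * (\<Sum>k\<le>N. t ^ k / fact k * paths \<omega> k x y) + (1 - exp (- 2 * t) * (\<Sum>k\<le>N. (2 * t) ^ k / fact k))"
proof -
  let ?q = "\<lambda>y. exp (- 2 * t) * (\<Sum>k\<le>N. t ^ k / fact k * paths \<omega> k x y)"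
  have "\<forall>k. \<exists>F. finite F \<and> (\<forall>y. y \<notin> F \<longrightarrow> paths \<omega> k x y = 0) \<and> (\<Sum>y\<in>F. paths \<omega> k x y) = 2 ^ k"
    using paths_total by blast
  then obtain F where F: "\<And>k. finite (F k)" "\<And>k y. y \<notin> F k \<Longrightarrow> paths \<omega> k x y = 0" "\<And>k. (\<Sum>y\<in>F k. paths \<omega> k x y) = 2 ^ k"
    by metis
  \<comment> \<open>A finite set that carries all paths of length up to \<open>N\<close>, so the
    lower bounds at its points sum to the full truncated Poisson mass.\<close>
  define U where "U = insert y (\<Union>k\<le>N. F k)"
  have fin: "finite U" using F(1) by (simp add: U_def)
  have tot: "(\<Sum>y\<in>U. paths \<omega> k x y) = 2 ^ k" if "k \<le> N" for k
    unfolding F(3)[of k, symmetric] using fin F(2) that by (intro sum.mono_neutral_right) (auto simp: U_def)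
  have "(\<Sum>y\<in>U. ?q y) = exp (- 2 * t) * (\<Sum>k\<le>N. \<Sum>y\<in>U. t ^ k / fact k * paths \<omega> k x y)"
    by (subst sum.swap) (simp add: sum_distrib_left)
  also have "\<dots> = exp (- 2 * t) * (\<Sum>k\<le>N. (2 * t) ^ k / fact k)"
  proof (intro arg_cong[where f = "\<lambda>x. _ * x"] sum.cong refl)
    fix k assume "k \<in> {..N}"
    then show "(\<Sum>y\<in>U. t ^ k / fact k * paths \<omega> k x y) = (2 * t) ^ k / fact k"
      unfolding sum_distrib_left[symmetric] by (simp add: tot power_mult_distrib)
  qed
  finally have Q: "(\<Sum>y\<in>U. ?q y) = exp (- 2 * t) * (\<Sum>k\<le>N. (2 * t) ^ k / fact k)" .
  have "P t x y + (\<Sum>w\<in>U - {y}. ?q w) \<le> P t x y + (\<Sum>w\<in>U - {y}. P t x w)"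
    by (intro add_left_mono sum_mono P_ge_partial_sum t)
  also have "\<dots> = (\<Sum>w\<in>U. P t x w)" using fin by (subst sum.remove[of U y]) (auto simp: U_def)
  also have "\<dots> \<le> 1" using fin t by (intro P_sum_le)
  also have "(\<Sum>w\<in>U - {y}. ?q w) = (\<Sum>w\<in>U. ?q w) - ?q y" using fin by (subst sum.remove[of U y]) (auto simp: U_def)
  finally show ?thesis using Q by simp
qed

lemma transition_prob_eq_paths:
  assumes t: "t \<ge> 0"
  shows "(\<lambda>k. exp (- 2 * t) * (t ^ k / fact k * paths \<omega> k x y)) sums P t x y"
  unfolding sums_def_le
proof (rule tendsto_sandwich)
  have e: "exp (- 2 * t) * exp (2 * t) = 1" by (simp add: exp_add[symmetric])
  have "(\<lambda>N. P t x y - (1 - exp (- 2 * t) * (\<Sum>k\<le>N. (2 * t) ^ k / fact k))) \<longlonglongrightarrow> P t x y - (1 - exp (- 2 * t) * exp (2 * t))"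
    by (intro tendsto_intros exp_partial_sums)
  then show "(\<lambda>N. P t x y - (1 - exp (- 2 * t) * (\<Sum>k\<le>N. (2 * t) ^ k / fact k))) \<longlonglongrightarrow> P t x y"
    unfolding e by simp
  show "\<forall>\<^sub>F N in sequentially. P t x y - (1 - exp (- 2 * t) * (\<Sum>k\<le>N. (2 * t) ^ k / fact k)) \<le> (\<Sum>k\<le>N. exp (- 2 * t) * (t ^ k / fact k * paths \<omega> k x y))"
    unfolding sum_distrib_left[symmetric] using P_le_partial_sum[OF t, of x y] by (intro always_eventually) (simp add: diff_le_eq)
  show "\<forall>\<^sub>F N in sequentially. (\<Sum>k\<le>N. exp (- 2 * t) * (t ^ k / fact k * paths \<omega> k x y)) \<le> P t x y"
    unfolding sum_distrib_left[symmetric] using P_ge_partial_sum[OF t] by (intro always_eventually) simp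
qed (rule tendsto_const)

end

section \<open>Loops in a periodic environment\<close>

lemma neighbour_env_of_lines:
  "neighbour (env_of_lines \<sigma>) x i $ j = x $ j + (if i = j then \<sigma> (i, x $ (i + 1)) else 0)"
  by (simp add: neighbour_def axis_def env_of_lines_def)

primrec path_sum :: "env \<Rightarrow> nat \<Rightarrow> (site \<Rightarrow> complex) \<Rightarrow> site \<Rightarrow> complex" where
  "path_sum \<omega> 0 f x = f x"
| "path_sum \<omega> (Suc n) f x = (\<Sum>i\<in>UNIV. path_sum \<omega> n f (neighbour \<omega> x i))"

text \<open>Steps only add values at neighbours, so an inequality between terminal functions
  propagates. It is applied with the indicator of the origin below a sum of characters.\<close>

lemma paths_le_path_sum:
  assumes "\<And>x. c * (if x = y then 1 else 0) \<le> (\<Sum>j\<in>J. Re (f j x))"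
  shows "c * paths \<omega> n x y \<le> (\<Sum>j\<in>J. Re (path_sum \<omega> n (f j) x))"
proof (induction n arbitrary: x)
  case (Suc n)
  have "c * paths \<omega> (Suc n) x y \<le> (\<Sum>i\<in>UNIV. \<Sum>j\<in>J. Re (path_sum \<omega> n (f j) (neighbour \<omega> x i)))"
    unfolding paths.simps sum_distrib_left by (intro sum_mono Suc)
  also have "\<dots> = (\<Sum>j\<in>J. Re (path_sum \<omega> (Suc n) (f j) x))"
    unfolding path_sum.simps Re_sum by (rule sum.swap)
  finally show ?case .
qed (use assms[of x] in \<open>simp add: assms\<close>)

lemma two_eq: "(2::2) + 1 = 1" "(1::2) + 1 = 2" "(1::2) \<noteq> 2" "(2::2) \<noteq> 1" "(3::2) = 1"
  by simp_all

context periodic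
begin

definition character :: "int \<times> int \<Rightarrow> site \<Rightarrow> complex" where
  "character p x = cis (2 * pi * of_int (fst p * x $ 1 + snd p * x $ 2) / of_int Q)"

lemma cis_shift: "cis (2 * pi * of_int (a + b) / of_int Q) = cis (2 * pi * of_int a / of_int Q) * mode b"
  by (simp add: mode_def cis_mult distrib_left add_divide_distrib)

lemma mode_minus: "mode (- b) = cnj (mode b)"
  by (simp add: mode_def cis_cnj)

text \<open>Each step multiplies a character by a phase and translates the environment seen from the
  walker, so the starting point enters only through a prefactor and a shift of the lines.\<close>

lemma path_sum_character:
  assumes sg: "\<And>k. \<sigma> k = 1 \<or> \<sigma> k = -1"
  shows "path_sum (env_of_lines \<sigma>) n (character p) x =
    character p x * walk_sum (mode (fst p)) (mode (snd p)) n
      (\<lambda>a. of_int (\<sigma> (1, a + x $ 2)), \<lambda>a. of_int (\<sigma> (2, a + x $ 1)))"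
proof (induction n arbitrary: x)
  case (Suc n)
  let ?y = "neighbour (env_of_lines \<sigma>) x"
  have y1: "?y 1 $ 1 = x $ 1 + \<sigma> (1, x $ 2)" "?y 1 $ 2 = x $ 2"
    and y2: "?y 2 $ 1 = x $ 1" "?y 2 $ 2 = x $ 2 + \<sigma> (2, x $ 1)"
    by (simp_all add: neighbour_env_of_lines two_eq)
  have c1: "character p (?y 1) = character p x * (if \<sigma> (1, x $ 2) = 1 then mode (fst p) else cnj (mode (fst p)))"
  proof -
    have "character p (?y 1) = character p x * mode (fst p * \<sigma> (1, x $ 2))"
      unfolding character_def y1 cis_shift[symmetric] by (simp add: algebra_simps)
    then show ?thesis using sg[of "(1, x $ 2)"] by (auto simp: mode_minus)
  qed
  have c2: "character p (?y 2) = character p x * (if \<sigma> (2, x $ 1) = 1 then mode (snd p) else cnj (mode (snd p)))"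
  proof -
    have "character p (?y 2) = character p x * mode (snd p * \<sigma> (2, x $ 1))"
      unfolding character_def y2 cis_shift[symmetric] by (simp add: algebra_simps)
    then show ?thesis using sg[of "(2, x $ 1)"] by (auto simp: mode_minus)
  qed
  show ?case
    unfolding path_sum.simps sum_2 Suc c1 c2 y1 y2 walk_sum.simps walk_op_def fst_conv snd_conv
    using sg[of "(1, x $ 2)"] sg[of "(2, x $ 1)"]
    by (auto simp: algebra_simps)
qed simp

text \<open>For odd \<open>Q\<close> the symmetric range is a full period. Multiplication by the
  summand at \<open>j = 1\<close> therefore permutes the terms, so the sum vanishes unless that
  factor is 1.\<close>

lemma sum_character_line:
  assumes Q: "Q = 2 * m + 1"
  shows "(\<Sum>j\<in>{-m..m}. cis (2 * pi * of_int (j * x) / of_int Q)) = (if Q dvd x then of_int Q else 0)"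
proof -
  let ?c = "\<lambda>j. cis (2 * pi * of_int (j * x) / of_int Q)"
  let ?D = "\<Sum>j\<in>{-m..m}. ?c j"
  have m: "m \<ge> 0" using Q Q_pos by simp
  have step: "?c (j + 1) = ?c j * ?c 1" for j
    by (simp add: cis_mult add_divide_distrib[symmetric] algebra_simps)
  have period: "?c (m + 1) = ?c (- m)"
  proof -
    have "2 * pi * of_int ((m + 1) * x) / of_int Q = 2 * pi * of_int (- m * x) / of_int Q + 2 * pi * of_int x"
    proof -
      have "(m + 1) * x = - m * x + Q * x" unfolding Q by (simp add: algebra_simps)
      then have "2 * pi * of_int ((m + 1) * x) / of_int Q = 2 * pi * (of_int (- m * x) + of_int Q * of_int x) / of_int Q"
        by (simp only: of_int_add of_int_mult)
      also have "\<dots> = 2 * pi * of_int (- m * x) / of_int Q + 2 * pi * of_int x"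
        using Q_pos by (simp add: field_simps)
      finally show ?thesis .
    qed
    then show ?thesis by (simp only: cis_mult[symmetric]) (simp add: cis_multiple_2pi)
  qed
  have "?D * ?c 1 = (\<Sum>j\<in>{-m..m}. ?c (j + 1))" by (simp only: step sum_distrib_right)
  also have "\<dots> = (\<Sum>j\<in>{-m+1..m+1}. ?c j)"
    by (rule sum.reindex_bij_witness[of _ "\<lambda>j. j - 1" "\<lambda>j. j + 1"]) auto
  also have "{-m+1..m+1} = insert (m+1) {-m+1..m}" using m by auto
  also have "(\<Sum>j\<in>insert (m+1) {-m+1..m}. ?c j) = ?c (m + 1) + (\<Sum>j\<in>{-m+1..m}. ?c j)" by (rule sum.insert) auto
  also have "\<dots> = (\<Sum>j\<in>insert (-m) {-m+1..m}. ?c j)" unfolding period by (rule sum.insert[symmetric]) auto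
  also have "insert (-m) {-m+1..m} = {-m..m}" using m by auto
  finally have D: "?D * ?c 1 = ?D" .
  show ?thesis
  proof (cases "Q dvd x")
    case True
    then obtain k where k: "x = Q * k" by (auto simp: dvd_def)
    have "?c j = 1" for j
    proof -
      have "2 * pi * of_int (j * x) / of_int Q = 2 * pi * of_int (j * k)" using Q_pos by (simp add: k)
      then show ?thesis by (simp only: cis_multiple_2pi[OF Ints_of_int])
    qed
    then show ?thesis using True m Q by simp
  next
    case False
    have "?c 1 \<noteq> 1"
    proof
      assume "?c 1 = 1"
      then have "cos (2 * pi * of_int x / of_int Q) = 1" by (simp add: cis.code complex_eq_iff)
      then obtain k :: int where "2 * pi * of_int x / of_int Q = of_int k * 2 * pi" by (auto simp: cos_one_2pi_int)
      then have "of_int x = (of_int (k * Q) :: real)" using Q_pos by (simp add: field_simps)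
      then have "x = k * Q" by (simp only: of_int_eq_iff)
      then show False using False by simp
    qed
    moreover have "?D * (?c 1 - 1) = 0" using D by (simp only: right_diff_distrib mult_1_right) simp
    ultimately have "?D = 0" by simp
    then show ?thesis using False by simp
  qed
qed

text \<open>The characters detect divisibility of both coordinates by \<open>Q\<close>. The
  additional lattice points only increase the sum, and an upper bound on loops is all that is
  wanted.\<close>

lemma sum_characters:
  assumes Q: "Q = 2 * m + 1"
  shows "(of_int Q)\<^sup>2 * (if x = 0 then 1 else 0) \<le> (\<Sum>p\<in>{-m..m} \<times> {-m..m}. Re (character p x))"
proof -
  have "character p x = cis (2 * pi * of_int (fst p * x $ 1) / of_int Q) * cis (2 * pi * of_int (snd p * x $ 2) / of_int Q)" for p
    by (simp add: character_def cis_mult distrib_left add_divide_distrib)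
  then have "(\<Sum>p\<in>{-m..m} \<times> {-m..m}. character p x) =
      (\<Sum>j\<in>{-m..m}. cis (2 * pi * of_int (j * x $ 1) / of_int Q)) * (\<Sum>j\<in>{-m..m}. cis (2 * pi * of_int (j * x $ 2) / of_int Q))"
    unfolding sum_product sum.cartesian_product by (simp add: case_prod_beta)
  then have "(\<Sum>p\<in>{-m..m} \<times> {-m..m}. Re (character p x)) = (if Q dvd x $ 1 \<and> Q dvd x $ 2 then (of_int Q)\<^sup>2 else 0)"
    unfolding Re_sum[symmetric] sum_character_line[OF Q] by (simp add: power2_eq_square)
  then show ?thesis by auto
qed

lemma paths_le_walk_sum:
  assumes Q: "Q = 2 * m + 1" and sg: "\<And>k. \<sigma> k = 1 \<or> \<sigma> k = -1"
  shows "(of_int Q)\<^sup>2 * paths (env_of_lines \<sigma>) n 0 0 \<le>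
    (\<Sum>p\<in>{-m..m} \<times> {-m..m}. Re (walk_sum (mode (fst p)) (mode (snd p)) n (\<lambda>a. of_int (\<sigma> (1, a)), \<lambda>a. of_int (\<sigma> (2, a)))))"
proof -
  have "character p 0 = 1" for p by (simp add: character_def)
  then show ?thesis
    using paths_le_path_sum[OF sum_characters[OF Q], of "env_of_lines \<sigma>" n 0]
    by (simp add: path_sum_character[OF sg])
qed

text \<open>The floor only changes the type: on \<open>Or \<times> Or\<close> its argument is 1 or
  -1.\<close>

definition lines_of :: "lines \<Rightarrow> 2 \<times> int \<Rightarrow> int" where
  "lines_of \<omega> k = \<lfloor>if fst k = 1 then fst \<omega> (snd k) else snd \<omega> (snd k)\<rfloor>"

lemma lines_of_sign:
  assumes "\<omega> \<in> Or \<times> Or"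
  shows "lines_of \<omega> k = 1 \<or> lines_of \<omega> k = -1"
    "real_of_int (lines_of \<omega> (1, a)) = fst \<omega> a" "real_of_int (lines_of \<omega> (2, a)) = snd \<omega> a"
proof -
  have s: "fst \<omega> a = 1 \<or> fst \<omega> a = -1" "snd \<omega> a = 1 \<or> snd \<omega> a = -1" for a
    using assms sign_or[of "fst \<omega>" a] sign_or[of "snd \<omega>" a] by auto
  have fl: "\<lfloor>- 1 :: real\<rfloor> = - 1" by (simp add: floor_eq_iff)
  then show "lines_of \<omega> k = 1 \<or> lines_of \<omega> k = -1" using s[of "snd k"] unfolding lines_of_def by auto
  show "real_of_int (lines_of \<omega> (1, a)) = fst \<omega> a" "real_of_int (lines_of \<omega> (2, a)) = snd \<omega> a"
    using s[of a] fl unfolding lines_of_def by (auto simp: two_eq simp del: of_int_floor_cancel)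
qed

definition periodic_return :: "nat \<Rightarrow> real" where
  "periodic_return n = (\<Sum>\<omega>\<in>Or \<times> Or. paths (env_of_lines (lines_of \<omega>)) n 0 0) / (card Or)\<^sup>2"

lemma periodic_return_nonneg: "periodic_return n \<ge> 0"
  unfolding periodic_return_def by (intro divide_nonneg_nonneg sum_nonneg paths_nonneg) simp

text \<open>The sum over the modes counts, with weight \<open>Q ^ 2\<close>, all paths that end at a
  multiple of the period, which include the loops. Its terms are non-negative for this reason, so
  the series may be truncated at any \<open>k\<close>.\<close>

lemma periodic_return_green:
  assumes Q: "Q = 2 * m + 1" and l: "l > 0"
  shows "(of_int Q)\<^sup>2 * (\<Sum>n<k. periodic_return n / (2 + l) ^ Suc n) \<le>
     (\<Sum>p\<in>{-m..m} \<times> {-m..m}. green_mean (mode (fst p)) (mode (snd p)) l)"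
proof -
  let ?S = "{-m..m} \<times> {-m..m}" and ?q = "(of_int Q)\<^sup>2 :: real"
  define b where "b n = (\<Sum>p\<in>?S. Re (\<Sum>\<omega>\<in>Or \<times> Or. walk_sum (mode (fst p)) (mode (snd p)) n \<omega>)) / (card Or)\<^sup>2" for n
  have le: "?q * periodic_return n \<le> b n" for n
  proof -
    have "?q * (\<Sum>\<omega>\<in>Or \<times> Or. paths (env_of_lines (lines_of \<omega>)) n 0 0) \<le>
      (\<Sum>\<omega>\<in>Or \<times> Or. \<Sum>p\<in>?S. Re (walk_sum (mode (fst p)) (mode (snd p)) n \<omega>))"
      unfolding sum_distrib_left
    proof (rule sum_mono)
      fix \<omega> assume w: "\<omega> \<in> Or \<times> Or"
      show "?q * paths (env_of_lines (lines_of \<omega>)) n 0 0 \<le> (\<Sum>p\<in>?S. Re (walk_sum (mode (fst p)) (mode (snd p)) n \<omega>))"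
        using paths_le_walk_sum[where \<sigma> = "lines_of \<omega>" and n = n, OF Q lines_of_sign(1)[OF w]] by (simp add: lines_of_sign[OF w])
    qed
    also have "\<dots> = (\<Sum>p\<in>?S. Re (\<Sum>\<omega>\<in>Or \<times> Or. walk_sum (mode (fst p)) (mode (snd p)) n \<omega>))"
      unfolding Re_sum by (rule sum.swap)
    finally show ?thesis unfolding periodic_return_def b_def by (simp add: divide_right_mono)
  qed
  have sums: "(\<lambda>n. b n / (2 + l) ^ Suc n) sums (\<Sum>p\<in>?S. green_mean (mode (fst p)) (mode (snd p)) l)"
  proof -
    have "(\<lambda>n. (\<Sum>p\<in>?S. Re (\<Sum>\<omega>\<in>Or \<times> Or. walk_sum (mode (fst p)) (mode (snd p)) n \<omega> / of_real ((2 + l) ^ Suc n)) / (card Or)\<^sup>2))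
      sums (\<Sum>p\<in>?S. green_mean (mode (fst p)) (mode (snd p)) l)"
      unfolding green_mean_def by (intro sums_sum sums_divide sums_Re green_sums norm_mode l)
    moreover have "(\<Sum>p\<in>?S. Re (\<Sum>\<omega>\<in>Or \<times> Or. walk_sum (mode (fst p)) (mode (snd p)) n \<omega> / of_real ((2 + l) ^ Suc n)) / (card Or)\<^sup>2)
      = b n / (2 + l) ^ Suc n" for n
      unfolding b_def sum_divide_distrib[symmetric] Re_divide_of_real by simp
    ultimately show ?thesis by simp
  qed
  have "?q * (\<Sum>n<k. periodic_return n / (2 + l) ^ Suc n) = (\<Sum>n<k. ?q * periodic_return n / (2 + l) ^ Suc n)"
    by (simp add: sum_distrib_left)
  also have "\<dots> \<le> (\<Sum>n<k. b n / (2 + l) ^ Suc n)"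
    using l le by (intro sum_mono divide_right_mono) auto
  also have "\<dots> \<le> (\<Sum>n. b n / (2 + l) ^ Suc n)"
  proof (rule sum_le_suminf[OF sums_summable[OF sums]])
    fix n
    have "0 \<le> ?q * periodic_return n" by (simp add: periodic_return_nonneg)
    then show "0 \<le> b n / (2 + l) ^ Suc n" using le[of n] l by simp
  qed simp
  also have "\<dots> = (\<Sum>p\<in>?S. green_mean (mode (fst p)) (mode (snd p)) l)" using sums by (simp add: sums_iff)
  finally show ?thesis .
qed

lemma periodic_green_bound:
  assumes Q: "Q = 2 * m + 1" and l: "l > 0" and Ql: "1 \<le> l * (of_int Q)\<^sup>2"
  shows "(\<Sum>n<k. periodic_return n / (2 + l) ^ Suc n) \<le> 1351"
proof -
  let ?S = "{-m..m} \<times> {-m..m}" and ?q = "(of_int Q)\<^sup>2 :: real"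
  let ?f = "\<lambda>s. if s = 0 then 1 / l else mode_bound l s"
  have m: "m \<ge> 0" "m \<le> Q" using Q Q_pos by auto
  have "(\<Sum>p\<in>?S. green_mean (mode (fst p)) (mode (snd p)) l) \<le> (\<Sum>p\<in>?S. ?f (max \<bar>fst p\<bar> \<bar>snd p\<bar>))"
  proof (rule sum_mono)
    fix p assume p: "p \<in> ?S"
    show "green_mean (mode (fst p)) (mode (snd p)) l \<le> ?f (max \<bar>fst p\<bar> \<bar>snd p\<bar>)"
    proof (cases "max \<bar>fst p\<bar> \<bar>snd p\<bar> = 0")
      case True
      then have "?f (max \<bar>fst p\<bar> \<bar>snd p\<bar>) = 1 / l" by (simp only: if_True simp_thms)
      then show ?thesis using green_mean_le[OF norm_mode norm_mode l] by (simp only:)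
    next
      case False
      have "max \<bar>fst p\<bar> \<bar>snd p\<bar> \<le> m" using p by auto
      then have "2 * max \<bar>fst p\<bar> \<bar>snd p\<bar> \<le> Q" using Q by linarith
      then show ?thesis using green_mean_mode_le[OF False _ l] False by simp
    qed
  qed
  also have "\<dots> \<le> ?f 0 + (\<Sum>s\<in>{1..m}. 8 * of_int s * ?f s)"
    using l m mode_bound_nonneg[OF l] by (intro sum_max_norm_le) auto
  also have "(\<Sum>s\<in>{1..m}. 8 * of_int s * ?f s) = (\<Sum>s\<in>{1..m}. 8 * of_int s * mode_bound l s)"
    by (intro sum.cong) auto
  also have "\<dots> \<le> 1350 * ?q" using m by (intro sum_mode_bound l)
  \<comment> \<open>The zero mode has only the bound \<open>1 / l\<close>; by the choice of the
    period it adds 1 to the 1350.\<close>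
  also have "?f 0 \<le> ?q" using l Ql by (simp add: divide_le_eq mult.commute)
  finally have "?q * (\<Sum>n<k. periodic_return n / (2 + l) ^ Suc n) \<le> ?q * 1351"
    using periodic_return_green[OF Q l, of k] by simp
  then show ?thesis using Q_pos by simp
qed

end

section \<open>The annealed return probability\<close>

text \<open>A step raises the bound \<open>M\<close> on the position by one and lowers the number of
  remaining steps by one, so \<open>M + int n\<close> limits the visible lines throughout.\<close>

lemma paths_env_of_lines_cong:
  assumes "\<And>i a. \<bar>a\<bar> \<le> M + int n \<Longrightarrow> \<sigma> (i, a) = \<sigma>' (i, a)" "\<And>i a. \<bar>a\<bar> \<le> M + int n \<Longrightarrow> \<bar>\<sigma> (i, a)\<bar> \<le> 1"
    and "\<And>k. \<bar>x $ k\<bar> \<le> M"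
  shows "paths (env_of_lines \<sigma>) n x y = paths (env_of_lines \<sigma>') n x y"
  using assms
proof (induction n arbitrary: x M)
  case (Suc n)
  have M: "\<bar>x $ k\<bar> \<le> M + int (Suc n)" for k using Suc.prems(3)[of k] by simp
  have nb: "neighbour (env_of_lines \<sigma>') x i = neighbour (env_of_lines \<sigma>) x i" for i
    using Suc.prems(1)[OF M] by (simp add: vec_eq_iff neighbour_env_of_lines)
  have "\<bar>neighbour (env_of_lines \<sigma>) x i $ k\<bar> \<le> M + 1" for i k
    using Suc.prems(3)[of k] Suc.prems(2)[OF M, of i "i + 1"] by (auto simp: neighbour_env_of_lines)
  then have "paths (env_of_lines \<sigma>) n (neighbour (env_of_lines \<sigma>) x i) y = paths (env_of_lines \<sigma>') n (neighbour (env_of_lines \<sigma>) x i) y" for i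
    using Suc.prems(1,2) by (intro Suc.IH[of "M + 1"]) (auto simp: add_ac)
  then show ?case by (simp add: nb)
qed simp

abbreviation line_law :: "(2 \<times> int \<Rightarrow> int) measure" where
  "line_law \<equiv> \<Pi>\<^sub>M _\<in>UNIV. uniform_count_measure {-1, 1}"

text \<open>The range from \<open>- m\<close> to \<open>m\<close> is exactly one period. A function
  of these lines integrates as a uniform average over their sign patterns, and periodic extension
  identifies the patterns with \<open>Or \<times> Or\<close>.\<close>

lemma (in periodic) integral_line_law:
  assumes Q: "Q = 2 * m + 1"
    and h: "\<And>\<sigma> \<sigma>'. (\<And>i a. a \<in> {-m..m} \<Longrightarrow> \<sigma> (i, a) \<in> {-1, 1} \<and> \<sigma>' (i, a) = \<sigma> (i, a)) \<Longrightarrow> h \<sigma> = (h \<sigma>' :: real)"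
  shows "(\<integral>\<sigma>. h \<sigma> \<partial>line_law) = (\<Sum>\<omega>\<in>Or \<times> Or. h (lines_of \<omega>)) / (card Or)\<^sup>2"
proof -
  let ?u = "uniform_count_measure {-1, 1 :: int}"
  let ?J = "(UNIV :: 2 set) \<times> {-m..m}"
  let ?T = "PiE ?J (\<lambda>_. {-1, 1 :: int})"
  let ?A = "\<lambda>\<tau>. prod_emb UNIV (\<lambda>_. ?u) ?J (PiE ?J (\<lambda>k. {\<tau> k}))"
  interpret u: product_prob_space "\<lambda>_ :: 2 \<times> int. ?u" UNIV
    by (intro product_prob_spaceI prob_space_uniform_count_measure) auto
  have finJ: "finite ?J" by simp
  have finT: "finite ?T" by (intro finite_PiE finJ) auto
  have space: "space line_law = PiE UNIV (\<lambda>_. {-1, 1})" by (simp add: space_PiM space_uniform_count_measure)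
  have A: "\<sigma> \<in> ?A \<tau> \<longleftrightarrow> restrict \<sigma> ?J = \<tau>" if "\<sigma> \<in> space line_law" "\<tau> \<in> ?T" for \<sigma> \<tau>
    using that unfolding space prod_emb_def
    by (auto simp: PiE_iff space_uniform_count_measure fun_eq_iff restrict_def extensional_def split: if_splits)
  have meas: "measure line_law (?A \<tau>) = (1 / 2) ^ card ?J" if "\<tau> \<in> ?T" for \<tau>
  proof -
    have "measure line_law (?A \<tau>) = (\<Prod>k\<in>?J. measure ?u {\<tau> k})"
      using that by (intro u.measure_PiM_emb finJ) (auto simp: sets_uniform_count_measure)
    also have "\<dots> = (\<Prod>k\<in>?J. 1 / 2)"
      using that by (intro prod.cong refl) (subst measure_uniform_count_measure, auto simp: PiE_iff)
    finally show ?thesis by simp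
  qed
  have sets: "?A \<tau> \<in> sets line_law" if "\<tau> \<in> ?T" for \<tau>
    using that by (intro sets_PiM_I finJ) (auto simp: sets_uniform_count_measure)
  have "(\<integral>\<sigma>. h \<sigma> \<partial>line_law) = (\<integral>\<sigma>. (\<Sum>\<tau>\<in>?T. h \<tau> * indicator (?A \<tau>) \<sigma>) \<partial>line_law)"
  proof (rule Bochner_Integration.integral_cong)
    fix \<sigma> assume \<sigma>: "\<sigma> \<in> space line_law"
    then have r: "restrict \<sigma> ?J \<in> ?T" by (auto simp: space)
    have "(\<Sum>\<tau>\<in>?T. h \<tau> * indicator (?A \<tau>) \<sigma>) = (\<Sum>\<tau>\<in>?T. if \<tau> = restrict \<sigma> ?J then h \<tau> else 0)"
      by (intro sum.cong refl) (auto simp: A[OF \<sigma>] indicator_def)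
    also have "\<dots> = h (restrict \<sigma> ?J)" using r finT by simp
    also have "\<dots> = h \<sigma>" using \<sigma> by (intro h[symmetric]) (auto simp: space)
    finally show "h \<sigma> = (\<Sum>\<tau>\<in>?T. h \<tau> * indicator (?A \<tau>) \<sigma>)" by simp
  qed simp
  also have "\<dots> = (\<Sum>\<tau>\<in>?T. h \<tau> * measure line_law (?A \<tau>))"
    using sets by (subst Bochner_Integration.integral_sum) (auto simp: u.emeasure_eq_measure)
  also have "\<dots> = (\<Sum>\<tau>\<in>?T. h \<tau>) * (1 / 2) ^ card ?J"
    by (simp add: meas sum_distrib_right)
  finally have int: "(\<integral>\<sigma>. h \<sigma> \<partial>line_law) = (\<Sum>\<tau>\<in>?T. h \<tau>) * (1 / 2) ^ card ?J" .
  have m: "m \<ge> 0" using Q Q_pos by simp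
  \<comment> \<open>The representative of \<open>a\<close> modulo \<open>Q\<close> in the central
    period.\<close>
  define c where "c a = (a + m) mod Q - m" for a
  have c: "c a \<in> {-m..m}" "c (a + Q) = c a" "a \<in> {-m..m} \<Longrightarrow> c a = a" for a
  proof -
    have "0 \<le> (a + m) mod Q" "(a + m) mod Q < Q" using Q_pos by auto
    then show "c a \<in> {-m..m}" using Q by (auto simp: c_def)
    have "a + Q + m = a + m + Q" by simp
    then show "c (a + Q) = c a" by (simp only: c_def mod_add_self2)
    show "a \<in> {-m..m} \<Longrightarrow> c a = a" using Q by (auto simp: c_def)
  qed
  have c_mod: "f (c a) = f a" if "f \<in> Or" for f a
  proof -
    have "c a mod Q = a mod Q" by (simp add: c_def mod_diff_left_eq)
    then show ?thesis using orientations_mod[OF that Q_pos] by metis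
  qed
  let ?to = "\<lambda>\<omega>. restrict (lines_of \<omega>) ?J"
  let ?from = "\<lambda>\<tau>. (\<lambda>a. real_of_int (\<tau> (1, c a)), \<lambda>a. real_of_int (\<tau> (2, c a)))"
  have bij: "bij_betw ?to (Or \<times> Or) ?T"
  proof (rule bij_betw_byWitness[where f' = ?from])
    show "\<forall>\<omega>\<in>Or \<times> Or. ?from (?to \<omega>) = \<omega>"
      using c(1) lines_of_sign c_mod by (auto simp: fun_eq_iff)
    show "\<forall>\<tau>\<in>?T. ?to (?from \<tau>) = \<tau>"
    proof
      fix \<tau> assume \<tau>: "\<tau> \<in> ?T"
      show "?to (?from \<tau>) = \<tau>"
      proof (rule ext)
        fix k :: "2 \<times> int"
        obtain i a where k: "k = (i, a)" by fastforce
        show "?to (?from \<tau>) k = \<tau> k"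
          using exhaust_2[of i] c(3)[of a] \<tau> by (auto simp: k lines_of_def PiE_iff extensional_def)
      qed
    qed
    show "?to ` (Or \<times> Or) \<subseteq> ?T"
    proof (rule image_subsetI)
      fix \<omega> assume "\<omega> \<in> Or \<times> Or"
      from lines_of_sign(1)[OF this] show "?to \<omega> \<in> ?T" by (intro restrict_PiE_iff[THEN iffD2]) auto
    qed
    show "?from ` ?T \<subseteq> Or \<times> Or"
    proof
      fix \<omega> assume "\<omega> \<in> ?from ` ?T"
      then obtain \<tau> where \<tau>: "\<tau> \<in> ?T" "\<omega> = ?from \<tau>" by auto
      have "\<tau> (i, c a) = 1 \<or> \<tau> (i, c a) = -1" for i a
        using PiE_mem[OF \<tau>(1), of "(i, c a)"] c(1)[of a] by auto
      then have "real_of_int (\<tau> (i, c a)) = 1 \<or> real_of_int (\<tau> (i, c a)) = -1" for i a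
        by (metis of_int_1 of_int_minus)
      then show "\<omega> \<in> Or \<times> Or" by (simp add: \<tau>(2) orientations_def c(2))
    qed
  qed
  have "(\<Sum>\<tau>\<in>?T. h \<tau>) = (\<Sum>\<omega>\<in>Or \<times> Or. h (?to \<omega>))"
    by (rule sum.reindex_bij_betw[OF bij, symmetric])
  also have "\<dots> = (\<Sum>\<omega>\<in>Or \<times> Or. h (lines_of \<omega>))"
  proof (rule sum.cong)
    fix \<omega> assume "\<omega> \<in> Or \<times> Or"
    from lines_of_sign(1)[OF this] show "h (?to \<omega>) = h (lines_of \<omega>)"
      by (intro h[symmetric]) auto
  qed simp
  finally have 1: "(\<Sum>\<tau>\<in>?T. h \<tau>) = (\<Sum>\<omega>\<in>Or \<times> Or. h (lines_of \<omega>))" .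
  have "card (Or \<times> Or) = card ?T" by (rule bij_betw_same_card[OF bij])
  also have "\<dots> = 2 ^ card ?J" by (subst card_PiE[OF finJ]) (simp add: numeral_2_eq_2)
  finally have "(real (card Or))\<^sup>2 = 2 ^ card ?J" unfolding card_pairs[symmetric] by simp
  then show ?thesis unfolding int 1 by (simp add: power_divide)
qed

definition mean_return :: "nat \<Rightarrow> real" where
  "mean_return n = (\<integral>\<omega>. paths \<omega> n 0 0 \<partial>env_law)"

lemma sets_env_law: "sets env_law = sets env_space" by (simp add: env_law_def)

lemma orientation_measurable: "{\<omega> \<in> space env_space. \<omega> k = 1} \<in> sets env_space"
proof -
  have "(\<lambda>\<omega>. \<omega> k) \<in> (\<Pi>\<^sub>M _\<in>UNIV. count_space {-1, 1 :: int}) \<rightarrow>\<^sub>M count_space {-1, 1}"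
    by (rule measurable_component_singleton) simp
  then have m: "(\<lambda>\<omega>. \<omega> k) \<in> env_space \<rightarrow>\<^sub>M count_space {-1, 1 :: int}"
    unfolding env_space_def by (rule measurable_restrict_space1)
  have "(\<lambda>\<omega>. \<omega> k) -` {1} \<inter> space env_space \<in> sets env_space" by (rule measurable_sets[OF m]) simp
  moreover have "(\<lambda>\<omega>. \<omega> k) -` {1} \<inter> space env_space = {\<omega> \<in> space env_space. \<omega> k = 1}" by auto
  ultimately show ?thesis by simp
qed

lemma paths_measurable: "(\<lambda>\<omega>. paths \<omega> n x y) \<in> borel_measurable env_law"
  unfolding measurable_cong_sets[OF sets_env_law refl]
proof (induction n arbitrary: x)
  case (Suc n)
  \<comment> \<open>Splitting by the orientation makes the two possible next sites independent of
    \<open>\<omega>\<close>, so that the induction hypothesis applies.\<close>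
  have "(\<lambda>\<omega>. \<Sum>i\<in>UNIV. if \<omega> (x, i) = 1 then paths \<omega> n (x + axis i 1) y else paths \<omega> n (x - axis i 1) y) \<in> borel_measurable env_space"
    by (intro borel_measurable_sum measurable_If Suc orientation_measurable)
  moreover have "(\<Sum>i\<in>UNIV. if \<omega> (x, i) = 1 then paths \<omega> n (x + axis i 1) y else paths \<omega> n (x - axis i 1) y) = paths \<omega> (Suc n) x y"
    if "\<omega> \<in> space env_space" for \<omega>
  proof -
    have "\<omega> (x, i) = 1 \<or> \<omega> (x, i) = -1" for i
      using that space_env_law unfolding environments_def by (auto simp: env_law_def)
    then have "neighbour \<omega> x i = (if \<omega> (x, i) = 1 then x + axis i 1 else x - axis i 1)" for i
      using \<open>\<And>i. \<omega> (x, i) = 1 \<or> \<omega> (x, i) = -1\<close>[of i] by (elim disjE) (simp_all add: neighbour_def vec_eq_iff)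
    then show ?thesis by (simp add: if_distrib[of "\<lambda>z. paths \<omega> n z y"] cong: if_cong)
  qed
  ultimately show ?case by (subst measurable_cong[symmetric]) auto
qed simp

lemma paths_integrable: "integrable env_law (\<lambda>\<omega>. paths \<omega> n x y)"
proof -
  interpret prob_space env_law by (rule prob_space_env_law)
  show ?thesis
    by (rule integrable_const_bound[where B = "2 ^ n"]) (auto simp: paths_measurable paths_nonneg paths_le)
qed

lemma mean_return_bounds: "0 \<le> mean_return n" "mean_return n \<le> 2 ^ n"
proof -
  interpret prob_space env_law by (rule prob_space_env_law)
  show "0 \<le> mean_return n" unfolding mean_return_def by (simp add: paths_nonneg)
  have "mean_return n \<le> (\<integral>\<omega>. 2 ^ n \<partial>env_law)"
    unfolding mean_return_def by (intro integral_mono paths_integrable paths_le) simp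
  then show "mean_return n \<le> 2 ^ n" by (simp add: prob_space)
qed

lemma mean_return_eq_periodic:
  assumes Q: "Q = 2 * m + 1" and n: "int n \<le> m"
  shows "mean_return n = periodic.periodic_return Q n"
proof -
  interpret periodic Q by unfold_locales (use assms in simp)
  have "mean_return n = (\<integral>\<sigma>. paths (env_of_lines \<sigma>) n 0 0 \<partial>line_law)"
    unfolding mean_return_def env_law_def
    using paths_measurable unfolding measurable_cong_sets[OF sets_env_law refl]
    by (intro integral_distr env_of_lines_measurable)
  also have "\<dots> = periodic_return n"
    unfolding periodic_return_def
  proof (rule integral_line_law[OF Q])
    fix \<sigma> \<sigma>' :: "2 \<times> int \<Rightarrow> int"
    assume a: "\<And>i a. a \<in> {-m..m} \<Longrightarrow> \<sigma> (i, a) \<in> {-1, 1} \<and> \<sigma>' (i, a) = \<sigma> (i, a)"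
    show "paths (env_of_lines \<sigma>) n 0 0 = paths (env_of_lines \<sigma>') n 0 0"
    proof (rule paths_env_of_lines_cong[where M = 0])
      fix i and a :: int assume "\<bar>a\<bar> \<le> 0 + int n"
      then have "a \<in> {-m..m}" using n by auto
      from a[OF this, of i] show "\<sigma> (i, a) = \<sigma>' (i, a)" "\<bar>\<sigma> (i, a)\<bar> \<le> 1" by auto
    qed simp
  qed
  finally show ?thesis .
qed

lemma sum_mean_return_pos:
  assumes l: "l > 0"
  shows "(\<Sum>n<N. mean_return n / (2 + l) ^ Suc n) \<le> 1351"
proof -
  obtain k :: nat where k: "real k > 1 / l" using reals_Archimedean2 by blast
  \<comment> \<open>\<open>N\<close> steps have to stay within one period, and \<open>k\<close>
    makes the zero mode affordable. The resulting bound depends on neither.\<close>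
  define m where "m = int (N + k)"
  define Q where "Q = 2 * m + 1"
  interpret periodic Q by unfold_locales (simp add: Q_def m_def)
  have "real k \<le> (of_int Q)\<^sup>2"
  proof -
    have "real k \<le> of_int Q" by (simp add: Q_def m_def)
    also have "\<dots> \<le> (of_int Q)\<^sup>2" by (rule self_le_power) (simp_all add: Q_def m_def)
    finally show ?thesis .
  qed
  then have "1 / l \<le> (of_int Q)\<^sup>2" using k by linarith
  then have "1 \<le> l * (of_int Q)\<^sup>2" using l by (simp add: divide_le_eq mult.commute)
  from periodic_green_bound[OF Q_def l this, of N]
  have "(\<Sum>n<N. periodic_return n / (2 + l) ^ Suc n) \<le> 1351" .
  moreover have "mean_return n = periodic_return n" if "n < N" for n
    by (rule mean_return_eq_periodic[OF Q_def]) (use that in \<open>simp add: m_def\<close>)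
  ultimately show ?thesis by simp
qed

text \<open>For finitely many terms the uniform bound passes to \<open>l = 0\<close> by continuity.
  This limit case yields the finiteness of the integral without exponential factor.\<close>

lemma sum_mean_return:
  assumes l: "l \<ge> 0"
  shows "(\<Sum>n<N. mean_return n / (2 + l) ^ Suc n) \<le> 1351"
proof (cases "l = 0")
  case True
  have "((\<lambda>l. \<Sum>n<N. mean_return n / (2 + l) ^ Suc n) \<longlongrightarrow> (\<Sum>n<N. mean_return n / (2 + 0) ^ Suc n)) (at_right 0)"
    by (intro tendsto_intros) auto
  moreover have "\<forall>\<^sub>F l in at_right 0. (\<Sum>n<N. mean_return n / (2 + l) ^ Suc n) \<le> 1351"
    using eventually_at_right_less by eventually_elim (rule sum_mean_return_pos)
  ultimately show ?thesis unfolding True by (rule tendsto_upperbound) simp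
qed (use sum_mean_return_pos l in simp)

lemma nn_integral_erlang: "l > 0 \<Longrightarrow> (\<integral>\<^sup>+t. ennreal (erlang_density k l t) \<partial>lborel) = 1"
  using nn_integral_erlang_ith_moment[of l k 0] by simp

context
  fixes p :: "env \<Rightarrow> real \<Rightarrow> site \<Rightarrow> site \<Rightarrow> real"
  assumes p: "\<And>\<omega>. \<omega> \<in> environments \<Longrightarrow> markov_transition_probs (jump_rate \<omega>) (p \<omega>)"
begin

lemma annealed_return_prob_sums:
  assumes t: "t \<ge> 0"
  shows "(\<lambda>k. exp (- 2 * t) * (t ^ k / fact k * mean_return k)) sums annealed_return_prob p t"
proof -
  let ?f = "\<lambda>k \<omega>. exp (- 2 * t) * (t ^ k / fact k * paths \<omega> k 0 0)"
  have f0: "?f k \<omega> \<ge> 0" for k \<omega> using t by (simp add: paths_nonneg)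
  have sums: "(\<lambda>k. ?f k \<omega>) sums p \<omega> t 0 0" if "\<omega> \<in> environments" for \<omega>
    by (rule transition_prob_eq_paths[OF that p[OF that] t])
  have int: "integral\<^sup>L env_law (?f k) = exp (- 2 * t) * (t ^ k / fact k * mean_return k)" for k
    by (simp add: mean_return_def)
  have "(\<lambda>k. integral\<^sup>L env_law (?f k)) sums (\<integral>\<omega>. (\<Sum>k. ?f k \<omega>) \<partial>env_law)"
  proof (rule sums_integral)
    show "integrable env_law (?f k)" for k by (intro integrable_mult_right paths_integrable)
    show "AE \<omega> in env_law. summable (\<lambda>k. norm (?f k \<omega>))"
      using sums_summable[OF sums] unfolding real_norm_def abs_of_nonneg[OF f0]
      by (intro AE_I2) (simp only: space_env_law)
    have norm: "(\<integral>\<omega>. norm (?f k \<omega>) \<partial>env_law) = exp (- 2 * t) * (t ^ k / fact k * mean_return k)" for k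
      unfolding real_norm_def abs_of_nonneg[OF f0] by (fact int)
    show "summable (\<lambda>k. \<integral>\<omega>. norm (?f k \<omega>) \<partial>env_law)"
      unfolding norm
    proof (rule summable_comparison_test')
      show "summable (\<lambda>k. exp (- 2 * t) * ((2 * t) ^ k / fact k))"
        using summable_exp[of "2 * t"] by (intro summable_mult) (simp add: divide_inverse mult.commute)
      fix k
      have "exp (- 2 * t) * (t ^ k / fact k * mean_return k) \<le> exp (- 2 * t) * (t ^ k / fact k * 2 ^ k)"
        using t mean_return_bounds(2) by (intro mult_left_mono) auto
      then show "norm (exp (- 2 * t) * (t ^ k / fact k * mean_return k)) \<le> exp (- 2 * t) * ((2 * t) ^ k / fact k)"
        using t mean_return_bounds(1)[of k] by (simp add: abs_mult power_mult_distrib mult.commute[of "2 ^ k"])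
    qed
  qed
  moreover have "(\<integral>\<omega>. (\<Sum>k. ?f k \<omega>) \<partial>env_law) = annealed_return_prob p t"
    unfolding annealed_return_prob_def
    by (rule Bochner_Integration.integral_cong) (use sums in \<open>auto simp: space_env_law sums_iff\<close>)
  ultimately show ?thesis unfolding int by simp
qed

text \<open>After multiplication by \<open>exp (- l * t)\<close> the Poisson weights are Erlang
  densities of rate \<open>2 + l\<close>, up to the factors \<open>(2 + l) ^ Suc k\<close>. These
  densities integrate to 1, and non-negativity allows integration term by term.\<close>

lemma laplace_annealed_return:
  assumes l: "l \<ge> 0"
  shows "(\<integral>\<^sup>+t\<in>{0..}. ennreal (exp (- l * t) * annealed_return_prob p t) \<partial>lborel) \<le> 1351"
proof -
  let ?c = "\<lambda>k. mean_return k / (2 + l) ^ Suc k"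
  have c0: "?c k \<ge> 0" for k using l mean_return_bounds(1) by simp
  have "(\<integral>\<^sup>+t\<in>{0..}. ennreal (exp (- l * t) * annealed_return_prob p t) \<partial>lborel) =
    (\<integral>\<^sup>+t. (\<Sum>k. ennreal (?c k) * ennreal (erlang_density k (2 + l) t)) \<partial>lborel)"
  proof (rule nn_integral_cong)
    fix t :: real
    show "ennreal (exp (- l * t) * annealed_return_prob p t) * indicator {0..} t =
      (\<Sum>k. ennreal (?c k) * ennreal (erlang_density k (2 + l) t))"
    proof (cases "t \<ge> 0")
      case True
      have "(\<lambda>k. exp (- l * t) * (exp (- 2 * t) * (t ^ k / fact k * mean_return k))) sums (exp (- l * t) * annealed_return_prob p t)"
        by (intro sums_mult annealed_return_prob_sums True)
      moreover have "exp (- l * t) * (exp (- 2 * t) * (t ^ k / fact k * mean_return k)) = ?c k * erlang_density k (2 + l) t" for k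
      proof -
        have "exp (- (2 + l) * t) = exp (- l * t) * exp (- 2 * t)" by (simp add: exp_add[symmetric] algebra_simps)
        then have "erlang_density k (2 + l) t = (2 + l) ^ Suc k * (t ^ k / fact k * (exp (- l * t) * exp (- 2 * t)))"
          using True by (simp add: erlang_density_def)
        moreover have "(2 + l) ^ Suc k \<noteq> 0" using l by simp
        ultimately show ?thesis by simp
      qed
      ultimately have s: "(\<lambda>k. ?c k * erlang_density k (2 + l) t) sums (exp (- l * t) * annealed_return_prob p t)" by simp
      have "(\<Sum>k. ennreal (?c k) * ennreal (erlang_density k (2 + l) t)) = (\<Sum>k. ennreal (?c k * erlang_density k (2 + l) t))"
        by (intro suminf_cong ennreal_mult'[OF c0, symmetric])
      also have "\<dots> = ennreal (\<Sum>k. ?c k * erlang_density k (2 + l) t)"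
        using c0 l by (intro suminf_ennreal2 mult_nonneg_nonneg sums_summable[OF s]) auto
      finally show ?thesis using True s by (simp add: sums_iff)
    qed (simp add: erlang_density_def)
  qed
  also have "\<dots> = (\<Sum>k. \<integral>\<^sup>+t. ennreal (?c k) * ennreal (erlang_density k (2 + l) t) \<partial>lborel)"
    by (rule nn_integral_suminf) simp
  also have "\<dots> = (\<Sum>k. ennreal (?c k))"
    using l by (simp add: nn_integral_cmult nn_integral_erlang)
  also have "\<dots> \<le> 1351"
  proof (rule suminf_le_const)
    fix N
    have "(\<Sum>k<N. ennreal (?c k)) = ennreal (\<Sum>k<N. ?c k)" using c0 by (intro sum_ennreal) auto
    also have "\<dots> \<le> ennreal 1351" using sum_mean_return[OF l] by (rule ennreal_leI)
    finally show "(\<Sum>k<N. ennreal (?c k)) \<le> 1351" by simp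
  qed simp
  finally show ?thesis .
qed

end

theorem theorem1p2:
  fixes p :: "env \<Rightarrow> real \<Rightarrow> site \<Rightarrow> site \<Rightarrow> real"
  assumes "\<And>\<omega>. \<omega> \<in> environments \<Longrightarrow> markov_transition_probs (jump_rate \<omega>) (p \<omega>)"
  shows "(\<forall>l::real. 0 < l \<and> l \<le> 1 \<longrightarrow>
            (\<integral>\<^sup>+t\<in>{0..}. ennreal (exp (- l * t) * annealed_return_prob p t) \<partial>lborel) \<le> 2048) \<and>
         (\<integral>\<^sup>+t\<in>{0..}. ennreal (annealed_return_prob p t) \<partial>lborel) < \<infinity>"
proof -
  have b: "(\<integral>\<^sup>+t\<in>{0..}. ennreal (exp (- l * t) * annealed_return_prob p t) \<partial>lborel) \<le> 1351" if "l \<ge> 0" for l :: real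
    using assms that by (rule laplace_annealed_return)
  have "(1351 :: ennreal) \<le> 2048" by simp
  moreover have "(\<integral>\<^sup>+t\<in>{0..}. ennreal (annealed_return_prob p t) \<partial>lborel) < \<infinity>"
    using b[of 0] by (simp add: order_le_less_trans)
  ultimately show ?thesis using b by (meson less_imp_le order_trans)
qed

end
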